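(* Let $M$ be a geodesically complete connected oriented non-compact Riemannian $C^\infty$-manifold, let $\mu$ be a non-atomic Radon measure on $(M,\mathcal{B}(M))$ with $\mu(O)>0$ for every non-empty open $O\subset M$ and $\mu(M)=\infty$, let $0<\alpha<1$, and let $A$ be a positive self-adjoint operator on $L^2(\mu)$ with domain $D(A)$. Let $H_A^\alpha:=I_\alpha^{-1}H_A^{LP}I_\alpha$ be the second quantization operator of $A$ on $L^2(\lambda_\mu^\alpha)$. Then for any $f\in D(A)$ we have, for $\lambda_\mu$-a.a. $\eta\in\Gamma_0$, $$\left(H_A^\alpha e_\alpha(f)\right)(\eta)=\sqrt{\frac{E_\alpha^{(|\eta|-1)}(0)}{E_\alpha^{(|\eta|)}(0)}}\sum_{x\in\eta}(Af)(x)\,e_\alpha(f,\eta\setminus\{x\}),$$ where the right-hand side is read as $0$ for $\eta=\emptyset$.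
   Context: $E_\alpha(z)=\sum_{n=0}^\infty \frac{z^n}{\Gamma(\alpha n+1)}$ is the Mittag-Leffler function ($\Gamma(\cdot)$ the Euler Gamma function), $E_\alpha^{(n)}$ is its $n$-th derivative, and $|\eta|$ is the cardinality of $\eta$. $\Gamma_0:=\bigsqcup_{n=0}^\infty\Gamma_M^{(n)}$ is the space of finite configurations, where $\Gamma_M^{(n)}$ is the set of $n$-point subsets of $M$ and $\Gamma_M^{(0)}=\{\emptyset\}$. With $\widetilde{M^n}:=\{(x_1,\dots,x_n)\in M^n:x_i\ne x_j\text{ if }i\neq j\}$ and $\mathrm{sym}_M^n:\widetilde{M^n}\to\Gamma_M^{(n)}$, $(x_1,\dots,x_n)\mapsto\{x_1,\dots,x_n\}$, the space $\Gamma_M^{(n)}$ is identified with $\widetilde{M^n}/S_n$ and carries the induced topology and Borel $\sigma$-algebra; $\Gamma_0$ carries the disjoint-union topology and its Borel $\sigma$-algebra $\mathcal{B}(\Gamma_0)$. Put $\mu^{(n)}:=\mu^{\otimes n}\circ(\mathrm{sym}_M^n)^{-1}$, with $\mu^{(0)}$ the unit mass at $\emptyset$, and define $\lambda_\mu:=\sum_{n=0}^\infty\frac{1}{n!}\mu^{(n)}$ and $\lambda_\mu^\alpha:=\sum_{n=0}^\infty\frac{1}{\Gamma(\alpha n+1)}\mu^{(n)}$ on $(\Gamma_0,\mathcal{B}(\Gamma_0))$. All $L^2$-spaces are complex. $I_\alpha:L^2(\lambda_\mu^\alpha)\to L^2(\lambda_\mu)$ is the unitary isomorphism $I_\alpha(G):=G\sqrt{E_\alpha^{(|\cdot|)}(0)}$,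 i.e. $(I_\alpha G)(\eta)=G(\eta)\sqrt{E_\alpha^{(|\eta|)}(0)}$. Coherent states: for a $\mathcal{B}(M)$-measurable $f:M\to\mathbb{C}$, $e_\lambda(f,\eta):=\prod_{x\in\eta}f(x)$ for $\eta\neq\emptyset$ and $e_\lambda(f,\emptyset):=1$; the fractional coherent state is $e_\alpha(f,\eta):=e_\lambda(f,\eta)/\sqrt{E_\alpha^{(|\eta|)}(0)}$, $\eta\in\Gamma_0$. Second quantization: $\mathrm{Exp}L^2(\mu)$ is the symmetric (Bose) Fock space of sequences $(g^{(n)})_{n\ge0}$ of symmetric functions $g^{(n)}\in L^2(\mu^{\otimes n})$ with squared norm $\sum_n n!\,\|g^{(n)}\|^2_{L^2(\mu^{\otimes n})}$, and $e(f):=(f^{\otimes n}/n!)_{n\ge0}$, $f\in L^2(\mu)$, are its coherent states. Let $U:L^2(\lambda_\mu)\to\mathrm{Exp}L^2(\mu)$ be the unitary isomorphism $UG:=(g^{(n)})_{n\ge0}$ with $g^{(n)}(x_1,\dots,x_n)=\frac{1}{n!}G(\{x_1,\dots,x_n\})$, $g^{(0)}=G(\emptyset)$; it satisfies $U e_\lambda(f)=e(f)$ for $f\in L^2(\mu)$. For a contraction $B$ on $L^2(\mu)$, $\mathrm{Exp}B$ is the contraction on $\mathrm{Exp}L^2(\mu)$ with $\mathrm{Exp}B(e(f))=e(Bf)$ for all $f\in L^2(\mu)$. For a positive self-adjoint $A$ on $L^2(\mu)$, $d\mathrm{Exp}A$ is the positive self-adjoint operator on $\mathrm{Exp}L^2(\mu)$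 generating the contraction semigroup $\mathrm{Exp}(e^{-tA})$, $t\ge0$, i.e. $\mathrm{Exp}(e^{-tA})=e^{-t\,d\mathrm{Exp}A}$. $H_A^{LP}:=U^{-1}(d\mathrm{Exp}A)U$ is the operator on $L^2(\lambda_\mu)$ corresponding to $d\mathrm{Exp}A$ under the unitary isomorphism $U$. *)

theory Defs
  imports "HOL-Analysis.Analysis"
begin

section \<open>Oriented Riemannian manifolds\<close>

text \<open>
  A manifold is a Hausdorff, second countable type \<open>'m\<close> with an atlas modelled on
  \<open>real^'n\<close>.  A chart is its domain together with the coordinate map, which is only
  meaningful on that domain; \<open>chart_inv\<close> is the inverse of the coordinate map.
\<close>

type_synonym ('m, 'n) chart = "'m set \<times> ('m \<Rightarrow> real ^ 'n)"

definition chart_inv :: "('m, 'n::finite) chart \<Rightarrow> real ^ 'n \<Rightarrow> 'm" where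
  "chart_inv c = inv_into (fst c) (snd c)"

definition transition :: "('m, 'n::finite) chart \<Rightarrow> ('m, 'n) chart \<Rightarrow> real ^ 'n \<Rightarrow> real ^ 'n" where
  "transition c d = snd d \<circ> chart_inv c"

text \<open>
  The set \<open>S\<close> is meant to be open.  Quantifying over all directions \<open>v\<close> amounts to
  requiring all iterated partial derivatives up to order \<open>k\<close> to exist and be continuous.
\<close>

primrec C_k_on :: "nat \<Rightarrow> 'a::euclidean_space set \<Rightarrow> ('a \<Rightarrow> 'b::real_normed_vector) \<Rightarrow> bool" where
  "C_k_on 0 S f = continuous_on S f"
| "C_k_on (Suc k) S f =
     (f differentiable_on S \<and> (\<forall>v. C_k_on k S (\<lambda>x. frechet_derivative f (at x) v)))"

definition smooth_on :: "'a::euclidean_space set \<Rightarrow> ('a \<Rightarrow> 'b::real_normed_vector) \<Rightarrow> bool" where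
  "smooth_on S f \<longleftrightarrow> (\<forall>k. C_k_on k S f)"

definition is_chart :: "('m::topological_space, 'n::finite) chart \<Rightarrow> bool" where
  "is_chart c \<longleftrightarrow> open (fst c) \<and> open (snd c ` fst c) \<and>
     homeomorphism (fst c) (snd c ` fst c) (snd c) (chart_inv c)"

text \<open>
  An orientation is given by an atlas all of whose transition maps have positive
  Jacobian determinant.  The atlas need not be maximal.
\<close>

definition oriented_smooth_atlas :: "('m::topological_space, 'n::finite) chart set \<Rightarrow> bool" where
  "oriented_smooth_atlas \<A> \<longleftrightarrow>
     (\<forall>c\<in>\<A>. is_chart c) \<and> (\<Union>c\<in>\<A>. fst c) = UNIV \<and>
     (\<forall>c\<in>\<A>. \<forall>d\<in>\<A>.
        smooth_on (snd c ` (fst c \<inter> fst d)) (transition c d) \<and>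
        (\<forall>p \<in> snd c ` (fst c \<inter> fst d). det (jacobian (transition c d) (at p)) > 0))"

text \<open>
  A Riemannian metric is given by its coordinate matrices \<open>g c p\<close>, for each chart \<open>c\<close> and
  each point \<open>p\<close> of the coordinate domain of \<open>c\<close>, subject to the transformation law
  of a covariant 2-tensor.
\<close>

definition riemannian_metric ::
  "('m::topological_space, 'n::finite) chart set \<Rightarrow>
   (('m, 'n) chart \<Rightarrow> real ^ 'n \<Rightarrow> real ^ 'n ^ 'n) \<Rightarrow> bool" where
  "riemannian_metric \<A> g \<longleftrightarrow>
     (\<forall>c\<in>\<A>.
        (\<forall>i j. smooth_on (snd c ` fst c) (\<lambda>p. g c p $ i $ j)) \<and>
        (\<forall>p \<in> snd c ` fst c.
           transpose (g c p) = g c p \<and> (\<forall>v. v \<noteq> 0 \<longrightarrow> v \<bullet> (g c p *v v) > 0))) \<and>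
     (\<forall>c\<in>\<A>. \<forall>d\<in>\<A>. \<forall>x \<in> fst c \<inter> fst d.
        let J = jacobian (transition c d) (at (snd c x))
        in g c (snd c x) = transpose J ** g d (snd d x) ** J)"

definition partial_deriv :: "'n::finite \<Rightarrow> (real ^ 'n \<Rightarrow> real) \<Rightarrow> real ^ 'n \<Rightarrow> real" where
  "partial_deriv i h p = frechet_derivative h (at p) (axis i 1)"

definition christoffel ::
  "(real ^ 'n::finite \<Rightarrow> real ^ 'n ^ 'n) \<Rightarrow> real ^ 'n \<Rightarrow> 'n \<Rightarrow> 'n \<Rightarrow> 'n \<Rightarrow> real" where
  "christoffel G p k i j =
     (\<Sum>l\<in>UNIV. matrix_inv (G p) $ k $ l *
        (partial_deriv i (\<lambda>q. G q $ j $ l) p + partial_deriv j (\<lambda>q. G q $ i $ l) p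
          - partial_deriv l (\<lambda>q. G q $ i $ j) p)) / 2"

text \<open>
  The interval \<open>I\<close> is meant to be open; \<open>v\<close> and \<open>a\<close> are the coordinate velocity and
  acceleration of \<open>\<gamma>\<close> in the chart \<open>c\<close>.
\<close>

definition geodesic_on ::
  "('m::topological_space, 'n::finite) chart set \<Rightarrow>
   (('m, 'n) chart \<Rightarrow> real ^ 'n \<Rightarrow> real ^ 'n ^ 'n) \<Rightarrow> real set \<Rightarrow> (real \<Rightarrow> 'm) \<Rightarrow> bool" where
  "geodesic_on \<A> g I \<gamma> \<longleftrightarrow> continuous_on I \<gamma> \<and>
     (\<forall>c\<in>\<A>. \<exists>v a. \<forall>t\<in>I. \<gamma> t \<in> fst c \<longrightarrow>
        ((snd c \<circ> \<gamma>) has_vector_derivative v t) (at t) \<and>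
        (v has_vector_derivative a t) (at t) \<and>
        (\<forall>k. a t $ k +
           (\<Sum>i\<in>UNIV. \<Sum>j\<in>UNIV. christoffel (g c) (snd c (\<gamma> t)) k i j * v t $ i * v t $ j) = 0))"

definition geodesically_complete ::
  "('m::topological_space, 'n::finite) chart set \<Rightarrow>
   (('m, 'n) chart \<Rightarrow> real ^ 'n \<Rightarrow> real ^ 'n ^ 'n) \<Rightarrow> bool" where
  "geodesically_complete \<A> g \<longleftrightarrow>
     (\<forall>I \<gamma>. open I \<and> is_interval I \<and> geodesic_on \<A> g I \<gamma> \<longrightarrow>
        (\<exists>\<gamma>'. geodesic_on \<A> g UNIV \<gamma>' \<and> (\<forall>t\<in>I. \<gamma>' t = \<gamma> t)))"


section \<open>Measures\<close>

definition radon_measure :: "'m::topological_space measure \<Rightarrow> bool" where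
  "radon_measure \<mu> \<longleftrightarrow> sets \<mu> = sets borel \<and>
     (\<forall>K. compact K \<longrightarrow> emeasure \<mu> K < \<infinity>) \<and>
     (\<forall>B\<in>sets borel. emeasure \<mu> B = (SUP K\<in>{K. compact K \<and> K \<subseteq> B}. emeasure \<mu> K))"

definition nonatomic :: "'a measure \<Rightarrow> bool" where
  "nonatomic \<mu> \<longleftrightarrow>
     (\<forall>B\<in>sets \<mu>. emeasure \<mu> B > 0 \<longrightarrow>
        (\<exists>C\<in>sets \<mu>. C \<subseteq> B \<and> 0 < emeasure \<mu> C \<and> emeasure \<mu> C < emeasure \<mu> B))"


section \<open>Finite configurations\<close>

definition finite_configs :: "'m set set" where
  "finite_configs = {\<eta>. finite \<eta>}"

text \<open>
  Points of \<open>M^n\<close> are functions in \<open>{..<n} \<rightarrow>\<^sub>E UNIV\<close>; those with pairwise distinct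
  coordinates are the injective ones, and the symmetrisation map sends \<open>x\<close> to its range
  \<open>x ` {..<n}\<close>.  \<open>config_open W\<close> spells out the quotient topology on each \<open>n\<close>-point
  sector and the disjoint union topology over all \<open>n\<close>.
\<close>

definition tuples_distinct :: "nat \<Rightarrow> (nat \<Rightarrow> 'm) set" where
  "tuples_distinct n = {x \<in> {..<n} \<rightarrow>\<^sub>E UNIV. inj_on x {..<n}}"

definition config_open :: "'m::topological_space set set \<Rightarrow> bool" where
  "config_open W \<longleftrightarrow> W \<subseteq> finite_configs \<and>
     (\<forall>n. openin (subtopology (product_topology (\<lambda>_. euclidean) {..<n}) (tuples_distinct n))
            {x \<in> tuples_distinct n. x ` {..<n} \<in> W})"

definition config_borel :: "'m::topological_space set measure" where
  "config_borel = sigma finite_configs {W. config_open W}"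

definition n_point_measure :: "'m::topological_space measure \<Rightarrow> nat \<Rightarrow> 'm set measure" where
  "n_point_measure \<mu> n =
     distr (restrict_space (PiM {..<n} (\<lambda>_. \<mu>)) (tuples_distinct n)) config_borel (\<lambda>x. x ` {..<n})"

definition weighted_config_measure ::
  "(nat \<Rightarrow> real) \<Rightarrow> 'm::topological_space measure \<Rightarrow> 'm set measure" where
  "weighted_config_measure w \<mu> = measure_of finite_configs (sets config_borel)
     (\<lambda>B. \<Sum>n. ennreal (w n) * emeasure (n_point_measure \<mu> n) B)"

definition lebesgue_poisson :: "'m::topological_space measure \<Rightarrow> 'm set measure" where
  "lebesgue_poisson \<mu> = weighted_config_measure (\<lambda>n. 1 / fact n) \<mu>"

definition frac_lebesgue_poisson :: "real \<Rightarrow> 'm::topological_space measure \<Rightarrow> 'm set measure" where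
  "frac_lebesgue_poisson \<alpha> \<mu> = weighted_config_measure (\<lambda>n. 1 / Gamma (\<alpha> * real n + 1)) \<mu>"


section \<open>Hilbert spaces of functions and their operators\<close>

text \<open>
  The elements of a Hilbert space are represented by complex functions; two functions stand
  for the same element iff their difference has norm zero.  Operators, possibly unbounded,
  are given by their graphs, which are required to respect this identification.  Hence
  \<open>(f, h) \<in> T\<close> means that the class of \<open>f\<close> belongs to the domain of \<open>T\<close> and that
  \<open>h\<close> is a version of \<open>T f\<close>.
\<close>

record 'i hspace =
  vecs :: "('i \<Rightarrow> complex) set"
  ip :: "('i \<Rightarrow> complex) \<Rightarrow> ('i \<Rightarrow> complex) \<Rightarrow> complex"

type_synonym 'i operator = "(('i \<Rightarrow> complex) \<times> ('i \<Rightarrow> complex)) set"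

definition hnorm :: "'i hspace \<Rightarrow> ('i \<Rightarrow> complex) \<Rightarrow> real" where
  "hnorm H f = sqrt (Re (ip H f f))"

definition heq :: "'i hspace \<Rightarrow> ('i \<Rightarrow> complex) \<Rightarrow> ('i \<Rightarrow> complex) \<Rightarrow> bool" where
  "heq H f g \<longleftrightarrow> f \<in> vecs H \<and> g \<in> vecs H \<and> hnorm H (\<lambda>i. f i - g i) = 0"

definition L2 :: "'i measure \<Rightarrow> 'i hspace" where
  "L2 M = \<lparr>vecs = {f \<in> borel_measurable M. integrable M (\<lambda>x. (norm (f x))\<^sup>2)},
           ip = (\<lambda>f g. \<integral>x. f x * cnj (g x) \<partial>M)\<rparr>"

definition is_operator :: "'i hspace \<Rightarrow> 'i operator \<Rightarrow> bool" where
  "is_operator H T \<longleftrightarrow>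
     T \<subseteq> vecs H \<times> vecs H \<and> ((\<lambda>_. 0), (\<lambda>_. 0)) \<in> T \<and>
     (\<forall>(f, h)\<in>T. \<forall>(f', h')\<in>T. ((\<lambda>i. f i + f' i), (\<lambda>i. h i + h' i)) \<in> T) \<and>
     (\<forall>(f, h)\<in>T. \<forall>a. ((\<lambda>i. a * f i), (\<lambda>i. a * h i)) \<in> T) \<and>
     (\<forall>f h h'. (f, h) \<in> T \<and> (f, h') \<in> T \<longrightarrow> heq H h h') \<and>
     (\<forall>f f' h h'. (f, h) \<in> T \<and> heq H f f' \<and> heq H h h' \<longrightarrow> (f', h') \<in> T)"

definition densely_defined :: "'i hspace \<Rightarrow> 'i operator \<Rightarrow> bool" where
  "densely_defined H T \<longleftrightarrow>
     (\<forall>f\<in>vecs H. \<forall>\<epsilon>>0. \<exists>h\<in>Domain T. hnorm H (\<lambda>i. f i - h i) < \<epsilon>)"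

definition adjoint_op :: "'i hspace \<Rightarrow> 'i operator \<Rightarrow> 'i operator" where
  "adjoint_op H T =
     {(f, h). f \<in> vecs H \<and> h \<in> vecs H \<and> (\<forall>(u, v)\<in>T. ip H v f = ip H u h)}"

definition self_adjoint :: "'i hspace \<Rightarrow> 'i operator \<Rightarrow> bool" where
  "self_adjoint H T \<longleftrightarrow> is_operator H T \<and> densely_defined H T \<and> adjoint_op H T = T"

text \<open>For self-adjoint \<open>T\<close> the inner products below are real.\<close>

definition positive_op :: "'i hspace \<Rightarrow> 'i operator \<Rightarrow> bool" where
  "positive_op H T \<longleftrightarrow> (\<forall>(f, h)\<in>T. 0 \<le> Re (ip H h f))"

definition contraction_op :: "'i hspace \<Rightarrow> 'i operator \<Rightarrow> bool" where
  "contraction_op H T \<longleftrightarrow>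
     is_operator H T \<and> Domain T = vecs H \<and> (\<forall>(f, h)\<in>T. hnorm H h \<le> hnorm H f)"

text \<open>
  The existential quantifier over \<open>u\<close> picks a version \<open>u t\<close> of \<open>T t f\<close>, for each \<open>t > 0\<close>;
  the limits below do not depend on that choice.
\<close>

definition contraction_semigroup :: "'i hspace \<Rightarrow> (real \<Rightarrow> 'i operator) \<Rightarrow> bool" where
  "contraction_semigroup H T \<longleftrightarrow>
     (\<forall>t\<ge>0. contraction_op H (T t)) \<and> T 0 = {(f, h). heq H f h} \<and>
     (\<forall>s\<ge>0. \<forall>t\<ge>0. T (s + t) = T t O T s) \<and>
     (\<forall>f\<in>vecs H. \<exists>u. (\<forall>t>0. (f, u t) \<in> T t) \<and>
        ((\<lambda>t. hnorm H (\<lambda>i. u t i - f i)) \<longlongrightarrow> 0) (at_right 0))"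

text \<open>
  The sign convention is the one of \<open>T t = e\<^sup>-\<^sup>t\<^sup>A\<close>: the generator is \<open>A\<close>, the limit of
  \<open>(f - T t f) / t\<close> as \<open>t\<close> decreases to zero, with domain all \<open>f\<close> for which this
  limit exists in norm.
\<close>

definition generator :: "'i hspace \<Rightarrow> (real \<Rightarrow> 'i operator) \<Rightarrow> 'i operator" where
  "generator H T =
     {(f, h). f \<in> vecs H \<and> h \<in> vecs H \<and>
        (\<exists>u. (\<forall>t>0. (f, u t) \<in> T t) \<and>
           ((\<lambda>t. hnorm H (\<lambda>i. (f i - u t i) / complex_of_real t - h i)) \<longlongrightarrow> 0) (at_right 0))}"

text \<open>
  The semigroup \<open>e\<^sup>-\<^sup>t\<^sup>A\<close> of a positive self-adjoint \<open>A\<close>.  A strongly continuous contraction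
  semigroup is determined by its generator, so the choice is unique for \<open>t \<ge> 0\<close>.
\<close>

definition exp_semigroup :: "'i hspace \<Rightarrow> 'i operator \<Rightarrow> real \<Rightarrow> 'i operator" where
  "exp_semigroup H A = (SOME T. contraction_semigroup H T \<and> generator H T = A)"

text \<open>
  The operator \<open>V\<^sup>-\<^sup>1 T V\<close> on \<open>H\<close>, where \<open>V\<close> is a unitary isomorphism from \<open>H\<close> to the
  space on which \<open>T\<close> acts.
\<close>

definition conj_op ::
  "'i hspace \<Rightarrow> (('i \<Rightarrow> complex) \<Rightarrow> ('j \<Rightarrow> complex)) \<Rightarrow> 'j operator \<Rightarrow> 'i operator" where
  "conj_op H V T = {(F, G). F \<in> vecs H \<and> G \<in> vecs H \<and> (V F, V G) \<in> T}"


section \<open>Fock space and second quantization\<close>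

text \<open>
  A sequence of functions \<open>g\<^sup>(\<^sup>n\<^sup>)\<close> on \<open>M^n\<close> is encoded as a single function on the pairs
  \<open>(n, x)\<close> with \<open>x \<in> {..<n} \<rightarrow>\<^sub>E UNIV\<close>.
\<close>

definition fock :: "'m measure \<Rightarrow> (nat \<times> (nat \<Rightarrow> 'm)) hspace" where
  "fock \<mu> = \<lparr>
     vecs = {g.
       (\<forall>n. (\<lambda>x. g (n, x)) \<in> vecs (L2 (PiM {..<n} (\<lambda>_. \<mu>)))) \<and>
       (\<forall>n. AE x in PiM {..<n} (\<lambda>_. \<mu>). \<forall>\<sigma>. \<sigma> permutes {..<n} \<longrightarrow> g (n, x \<circ> \<sigma>) = g (n, x)) \<and>
       summable (\<lambda>n. fact n * (hnorm (L2 (PiM {..<n} (\<lambda>_. \<mu>))) (\<lambda>x. g (n, x)))\<^sup>2)},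
     ip = (\<lambda>g h. \<Sum>n. fact n * ip (L2 (PiM {..<n} (\<lambda>_. \<mu>))) (\<lambda>x. g (n, x)) (\<lambda>x. h (n, x)))\<rparr>"

definition fock_coherent :: "('m \<Rightarrow> complex) \<Rightarrow> nat \<times> (nat \<Rightarrow> 'm) \<Rightarrow> complex" where
  "fock_coherent f = (\<lambda>(n, x). (\<Prod>i<n. f (x i)) / fact n)"

text \<open>The choice is unique because the coherent states are total in the Fock space.\<close>

definition Exp_op :: "'m measure \<Rightarrow> 'm operator \<Rightarrow> (nat \<times> (nat \<Rightarrow> 'm)) operator" where
  "Exp_op \<mu> B = (SOME C. contraction_op (fock \<mu>) C \<and>
     (\<forall>(f, h)\<in>B. (fock_coherent f, fock_coherent h) \<in> C))"

definition dExp_op :: "'m measure \<Rightarrow> 'm operator \<Rightarrow> (nat \<times> (nat \<Rightarrow> 'm)) operator" where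
  "dExp_op \<mu> A = generator (fock \<mu>) (\<lambda>t. Exp_op \<mu> (exp_semigroup (L2 \<mu>) A t))"

text \<open>
  The isomorphism of \<open>L\<^sup>2\<close> over the Lebesgue-Poisson measure with the Fock space; the value
  on tuples with coinciding coordinates, a null set for nonatomic \<open>\<mu>\<close>, is immaterial.
\<close>

definition fock_iso :: "('m set \<Rightarrow> complex) \<Rightarrow> nat \<times> (nat \<Rightarrow> 'm) \<Rightarrow> complex" where
  "fock_iso G = (\<lambda>(n, x). if inj_on x {..<n} then G (x ` {..<n}) / fact n else 0)"

definition H_LP :: "'m::topological_space measure \<Rightarrow> 'm operator \<Rightarrow> 'm set operator" where
  "H_LP \<mu> A = conj_op (L2 (lebesgue_poisson \<mu>)) fock_iso (dExp_op \<mu> A)"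


section \<open>The fractional second quantization\<close>

definition mittag_leffler :: "real \<Rightarrow> 'a::{real_normed_field,banach} \<Rightarrow> 'a" where
  "mittag_leffler \<alpha> z = (\<Sum>n. z ^ n /\<^sub>R Gamma (\<alpha> * real n + 1))"

definition ml_deriv0 :: "real \<Rightarrow> nat \<Rightarrow> real" where
  "ml_deriv0 \<alpha> n = (deriv ^^ n) (mittag_leffler \<alpha>) 0"

definition frac_iso :: "real \<Rightarrow> ('m set \<Rightarrow> complex) \<Rightarrow> 'm set \<Rightarrow> complex" where
  "frac_iso \<alpha> G = (\<lambda>\<eta>. G \<eta> * complex_of_real (sqrt (ml_deriv0 \<alpha> (card \<eta>))))"

definition coherent :: "('m \<Rightarrow> complex) \<Rightarrow> 'm set \<Rightarrow> complex" where
  "coherent f \<eta> = (\<Prod>x\<in>\<eta>. f x)"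

definition frac_coherent :: "real \<Rightarrow> ('m \<Rightarrow> complex) \<Rightarrow> 'm set \<Rightarrow> complex" where
  "frac_coherent \<alpha> f \<eta> = coherent f \<eta> / complex_of_real (sqrt (ml_deriv0 \<alpha> (card \<eta>)))"

definition H_frac :: "real \<Rightarrow> 'm::topological_space measure \<Rightarrow> 'm operator \<Rightarrow> 'm set operator" where
  "H_frac \<alpha> \<mu> A = conj_op (L2 (frac_lebesgue_poisson \<alpha> \<mu>)) (frac_iso \<alpha>) (H_LP \<mu> A)"

end

theory Submission
  imports Defs "HOL-Library.Function_Algebras"
begin

text \<open>
  All Hilbert spaces are spaces of functions with a semi-inner product, so every identity holds
  modulo null vectors.

  The semigroup of a positive self-adjoint \<open>A\<close> is the limit of the dyadic implicit Euler schemes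
  \<open>(1 + t A / 2^k)\<^sup>-\<^sup>1\<close> to the power \<open>2^k\<close>: on the domain of \<open>A\<^sup>2\<close> halving the step changes the
  scheme by at most \<open>t\<^sup>2 / (4 2^k)\<close> times the norm of \<open>A\<^sup>2 f\<close>.  For a contraction \<open>B\<close>, the map
  \<open>e(f) \<mapsto> e(B f)\<close> is contractive on the span of the coherent states, because the entrywise powers of
  two Gram matrices inherit their order (Schur), so it extends to a contraction of the Fock space.
  Hence the generator of \<open>Exp (e\<^sup>-\<^sup>t\<^sup>A)\<close> at \<open>e(f)\<close> is the derivative of \<open>t \<mapsto> - e(e\<^sup>-\<^sup>t\<^sup>A f)\<close> at \<open>0\<close>,
  which has the components \<open>\<Sum>i. f \<otimes> \<dots> \<otimes> A f \<otimes> \<dots> \<otimes> f / n!\<close>.  Since \<open>\<mu>\<close> has no atoms, tuples with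
  coinciding coordinates are negligible, and transported to configurations this vector is
  \<open>\<Sum>x\<in>\<eta>. (A f)(x) e(f, \<eta> - {x})\<close>.  The weights of the fractional measure are
  \<open>1 / \<Gamma>(\<alpha> n + 1) = E\<^sup>(\<^sup>n\<^sup>)(0) / n!\<close>, which turns this into the claimed formula.
\<close>

section \<open>Semi-inner-product spaces and their operators\<close>

text \<open>The semigroup and \<open>Exp_op\<close> are introduced by a choice operator, so nothing
  is known about them until an object with the required properties has been built. Hence the
  generation and extension theorems, although the claim concerns a derivative at \<open>0\<close>.
  Afterwards the construction is forgotten: since the chosen semigroup has the generator
  \<open>A\<close>, there are versions \<open>u t\<close> of the evolved \<open>f\<close> whose
  difference quotients tend to \<open>A f\<close>, and the chosen \<open>Exp_op\<close> sends
  \<open>e(f)\<close> to \<open>e(u t)\<close>.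

  The Euler scheme rests on resolvents alone, hence on self-adjointness and orthogonal projection
  instead of spectral calculus. Halving the step makes consecutive differences a geometric series on
  the dense domain of \<open>A^2\<close>; contractivity carries the limit to all vectors.

  In the \<open>n\<close>-th sector the derivative of \<open>e\<close> has \<open>n\<close> terms
  and its error \<open>n^2\<close>. The weight \<open>fact n\<close> against the squared
  \<open>1 / fact n\<close> of coherent states leaves an exponential series, which absorbs such
  polynomials.

  A graph contains all versions of an image, so a formula for one version is not enough: a generator
  is shown to determine its values modulo null vectors.\<close>

declare plus_fun_apply [simp del] zero_fun_apply [simp del] minus_apply [simp del] uminus_apply [simp del]

text \<open>Kept as a function of its own so that the theory of vector spaces, in particular of
  linear projections onto subspaces, applies to functions. The pointwise rules are removed from simp
  so that vector identities are treated as group identities.\<close>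

definition scl :: "complex \<Rightarrow> ('i \<Rightarrow> complex) \<Rightarrow> 'i \<Rightarrow> complex" where
  "scl c f = (\<lambda>i. c * f i)"

global_interpretation scl: vector_space "scl :: complex \<Rightarrow> ('i \<Rightarrow> complex) \<Rightarrow> _"
  by standard (auto simp: scl_def fun_eq_iff plus_fun_apply algebra_simps)

locale semi_inner =
  fixes H :: "'i hspace"
  assumes zero [simp, intro]: "0 \<in> vecs H"
    and add [simp, intro]: "f \<in> vecs H \<Longrightarrow> g \<in> vecs H \<Longrightarrow> f + g \<in> vecs H"
    and scale [simp, intro]: "f \<in> vecs H \<Longrightarrow> scl c f \<in> vecs H"
    and ip_add_left: "f \<in> vecs H \<Longrightarrow> g \<in> vecs H \<Longrightarrow> h \<in> vecs H \<Longrightarrow> ip H (f + g) h = ip H f h + ip H g h"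
    and ip_scl_left: "f \<in> vecs H \<Longrightarrow> g \<in> vecs H \<Longrightarrow> ip H (scl c f) g = c * ip H f g"
    and ip_cnj: "f \<in> vecs H \<Longrightarrow> g \<in> vecs H \<Longrightarrow> ip H g f = cnj (ip H f g)"
    and ip_pos: "f \<in> vecs H \<Longrightarrow> 0 \<le> Re (ip H f f)"
begin

abbreviation "V \<equiv> vecs H"
abbreviation "nrm \<equiv> hnorm H"

lemma uminus_eq_scl: "- f = scl (-1) (f :: 'i \<Rightarrow> complex)"
  by (simp add: scl_def fun_eq_iff uminus_apply)

lemma uminus_mem [simp, intro]: "f \<in> V \<Longrightarrow> - f \<in> V"
  by (simp add: uminus_eq_scl del: scl.scale_minus_left)

lemma diff_mem [simp, intro]: "f \<in> V \<Longrightarrow> g \<in> V \<Longrightarrow> f - g \<in> V"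
  using add[of f "- g"] by simp

lemma sum_mem [simp, intro]: "(\<And>k. k \<in> I \<Longrightarrow> F k \<in> V) \<Longrightarrow> sum F I \<in> V"
  by (induction I rule: infinite_finite_induct) auto

lemma ip_add_right: "f \<in> V \<Longrightarrow> g \<in> V \<Longrightarrow> h \<in> V \<Longrightarrow> ip H h (f + g) = ip H h f + ip H h g"
  using ip_cnj[of "f + g" h] ip_cnj[of f h] ip_cnj[of g h] by (simp add: ip_add_left)

lemma ip_scl_right: "f \<in> V \<Longrightarrow> g \<in> V \<Longrightarrow> ip H f (scl c g) = cnj c * ip H f g"
  using ip_cnj[of "scl c g" f] ip_cnj[of g f] by (simp add: ip_scl_left)

lemma ip_minus_left: "f \<in> V \<Longrightarrow> g \<in> V \<Longrightarrow> ip H (- f) g = - ip H f g"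
  by (simp add: uminus_eq_scl ip_scl_left del: scl.scale_minus_left)

lemma ip_minus_right: "f \<in> V \<Longrightarrow> g \<in> V \<Longrightarrow> ip H f (- g) = - ip H f g"
  by (simp add: uminus_eq_scl ip_scl_right del: scl.scale_minus_left)

lemma ip_diff_left: "f \<in> V \<Longrightarrow> g \<in> V \<Longrightarrow> h \<in> V \<Longrightarrow> ip H (f - g) h = ip H f h - ip H g h"
  using ip_add_left[of f "- g" h] by (simp add: ip_minus_left)

lemma ip_diff_right: "f \<in> V \<Longrightarrow> g \<in> V \<Longrightarrow> h \<in> V \<Longrightarrow> ip H h (f - g) = ip H h f - ip H h g"
  using ip_add_right[of f "- g" h] by (simp add: ip_minus_right)

lemma ip_zero_left [simp]: "f \<in> V \<Longrightarrow> ip H 0 f = 0"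
  using ip_scl_left[of f f 0] ip_scl_left[of 0 f 0] by simp

lemma ip_zero_right [simp]: "f \<in> V \<Longrightarrow> ip H f 0 = 0"
  using ip_cnj[of 0 f] by simp

lemmas ip_simps = ip_add_left ip_add_right ip_diff_left ip_diff_right ip_scl_left ip_scl_right
  ip_minus_left ip_minus_right

lemma ip_sum_left: "(\<And>k. k \<in> I \<Longrightarrow> F k \<in> V) \<Longrightarrow> f \<in> V \<Longrightarrow> ip H (sum F I) f = (\<Sum>k\<in>I. ip H (F k) f)"
  by (induction I rule: infinite_finite_induct) (auto simp: ip_add_left)

lemma ip_sum_right: "(\<And>k. k \<in> I \<Longrightarrow> F k \<in> V) \<Longrightarrow> f \<in> V \<Longrightarrow> ip H f (sum F I) = (\<Sum>k\<in>I. ip H f (F k))"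
  by (induction I rule: infinite_finite_induct) (auto simp: ip_add_right)

section \<open>Norm, Cauchy-Schwarz and triangle inequalities\<close>

lemma nrm_sq: "f \<in> V \<Longrightarrow> (nrm f)\<^sup>2 = Re (ip H f f)"
  by (simp add: hnorm_def ip_pos)

lemma ip_self: "f \<in> V \<Longrightarrow> ip H f f = complex_of_real ((nrm f)\<^sup>2)"
  using ip_cnj[of f f] by (simp add: nrm_sq complex_eq_iff)

lemma nrm_nonneg [simp]: "f \<in> V \<Longrightarrow> 0 \<le> nrm f"
  by (simp add: hnorm_def ip_pos)

lemma nrm_zero [simp]: "nrm 0 = 0"
  by (simp add: hnorm_def)

lemma nrm_scl: "f \<in> V \<Longrightarrow> nrm (scl c f) = cmod c * nrm f"
proof -
  assume f: "f \<in> V"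
  have "(nrm (scl c f))\<^sup>2 = (cmod c * nrm f)\<^sup>2"
  proof -
    have "ip H (scl c f) (scl c f) = complex_of_real ((cmod c)\<^sup>2) * ip H f f"
      using f by (simp add: ip_simps complex_norm_square mult.assoc del: of_real_power)
    then show ?thesis using f by (simp add: nrm_sq power_mult_distrib del: of_real_power)
  qed
  then show ?thesis using f by (metis nrm_nonneg power2_eq_iff_nonneg scale norm_ge_zero mult_nonneg_nonneg)
qed

lemma nrm_minus [simp]: "f \<in> V \<Longrightarrow> nrm (- f) = nrm f"
  by (simp add: uminus_eq_scl nrm_scl del: scl.scale_minus_left)

lemma nrm_diff_commute: "f \<in> V \<Longrightarrow> g \<in> V \<Longrightarrow> nrm (f - g) = nrm (g - f)"
  using nrm_minus[of "f - g"] by simp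

lemma nrm_sq_add: "f \<in> V \<Longrightarrow> g \<in> V \<Longrightarrow> (nrm (f + g))\<^sup>2 = (nrm f)\<^sup>2 + 2 * Re (ip H f g) + (nrm g)\<^sup>2"
  using ip_cnj[of f g] by (simp add: nrm_sq ip_simps)

lemma nrm_sq_diff: "f \<in> V \<Longrightarrow> g \<in> V \<Longrightarrow> (nrm (f - g))\<^sup>2 = (nrm f)\<^sup>2 - 2 * Re (ip H f g) + (nrm g)\<^sup>2"
  using ip_cnj[of f g] by (simp add: nrm_sq ip_simps)

text \<open>The squared norm of \<open>f - s g\<close> is nonnegative for all real \<open>s\<close>.
  In a semi-inner product space either norm can vanish on a nonzero vector, so null \<open>g\<close>
  and null \<open>f\<close> need their own choice of \<open>s\<close>.\<close>

lemma Re_ip_le: assumes f: "f \<in> V" and g: "g \<in> V" shows "Re (ip H f g) \<le> nrm f * nrm g"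
proof -
  have *: "2 * s * Re (ip H f g) \<le> (nrm f)\<^sup>2 + s\<^sup>2 * (nrm g)\<^sup>2" for s
  proof -
    have "0 \<le> (nrm (f - scl (complex_of_real s) g))\<^sup>2" by simp
    also have "\<dots> = (nrm f)\<^sup>2 - 2 * s * Re (ip H f g) + s\<^sup>2 * (nrm g)\<^sup>2"
      using f g by (simp add: nrm_sq_diff ip_simps nrm_scl power_mult_distrib)
    finally show ?thesis by simp
  qed
  have nn: "0 \<le> nrm f" "0 \<le> nrm g" using f g by auto
  show ?thesis
  proof (cases "nrm g = 0")
    case True
    show ?thesis
    proof (rule ccontr)
      assume "\<not> ?thesis"
      then have pos: "Re (ip H f g) > 0" using True by simp
      \<comment> \<open>For null \<open>g\<close> the bound is linear in \<open>s\<close>; the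
        chosen \<open>s\<close> makes its left side exceed the constant right side by one.\<close>
      have "(nrm f)\<^sup>2 + 1 \<le> (nrm f)\<^sup>2"
        using *[of "((nrm f)\<^sup>2 + 1) / (2 * Re (ip H f g))"] True pos by (simp add: field_simps)
      then show False by simp
    qed
  next
    case False
    then have gp: "nrm g > 0" using nn by simp
    have "2 * (nrm f / nrm g) * Re (ip H f g) \<le> 2 * (nrm f)\<^sup>2"
      using *[of "nrm f / nrm g"] gp by (simp add: power_divide)
    then have "nrm f * Re (ip H f g) \<le> nrm f * (nrm f * nrm g)"
      using gp by (simp add: field_simps power2_eq_square)
    then have "nrm f \<noteq> 0 \<Longrightarrow> ?thesis" using nn by (simp add: mult_le_cancel_left)
    moreover have "?thesis" if "nrm f = 0"
    proof (rule ccontr)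
      assume "\<not> ?thesis"
      then have pos: "Re (ip H f g) > 0" using that by simp
      define s where "s = Re (ip H f g) / (nrm g)\<^sup>2"
      have "2 * s * Re (ip H f g) \<le> s * (s * (nrm g)\<^sup>2)" using *[of s] that by (simp add: power2_eq_square)
      also have "s * (nrm g)\<^sup>2 = Re (ip H f g)" using gp by (simp add: s_def)
      finally have "s * Re (ip H f g) \<le> 0" by simp
      moreover have "s > 0" using pos gp by (simp add: s_def)
      ultimately show False using pos by (simp add: mult_le_0_iff)
    qed
    ultimately show ?thesis by blast
  qed
qed

lemma cauchy_schwarz: assumes f: "f \<in> V" and g: "g \<in> V" shows "cmod (ip H f g) \<le> nrm f * nrm g"
proof (cases "ip H f g = 0")
  case True then show ?thesis using f g by simp
next
  case False
  \<comment> \<open>Rotating \<open>f\<close> by this phase makes the inner product real and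
    nonnegative, so the bound for real parts applies.\<close>
  define c where "c = cnj (sgn (ip H f g))"
  have "cmod (ip H f g) = Re (ip H (scl c f) g)"
  proof -
    have "c * ip H f g = complex_of_real (cmod (ip H f g))"
      using False complex_norm_square[of "ip H f g"]
      by (simp add: c_def sgn_eq field_simps power2_eq_square)
    then show ?thesis using f g by (simp add: ip_simps)
  qed
  also have "\<dots> \<le> nrm (scl c f) * nrm g" using f g by (intro Re_ip_le) auto
  also have "\<dots> = nrm f * nrm g" using f False by (simp add: nrm_scl c_def norm_sgn)
  finally show ?thesis .
qed

lemma nrm_triangle: assumes f: "f \<in> V" and g: "g \<in> V" shows "nrm (f + g) \<le> nrm f + nrm g"
proof -
  have "(nrm (f + g))\<^sup>2 \<le> (nrm f + nrm g)\<^sup>2"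
    using Re_ip_le[OF f g] nrm_sq_add[OF f g] by (simp add: power2_sum)
  then show ?thesis using f g by (simp add: power2_le_iff_abs_le)
qed

lemma nrm_triangle_diff: "f \<in> V \<Longrightarrow> g \<in> V \<Longrightarrow> nrm (f - g) \<le> nrm f + nrm g"
  using nrm_triangle[of f "- g"] by simp

lemma nrm_triangle3: "f \<in> V \<Longrightarrow> g \<in> V \<Longrightarrow> h \<in> V \<Longrightarrow> nrm (f - h) \<le> nrm (f - g) + nrm (g - h)"
  using nrm_triangle[of "f - g" "g - h"] by simp

lemma nrm_diff_ge: "f \<in> V \<Longrightarrow> g \<in> V \<Longrightarrow> \<bar>nrm f - nrm g\<bar> \<le> nrm (f - g)"
  using nrm_triangle[of "f - g" g] nrm_triangle[of "g - f" f] nrm_diff_commute[of f g] by simp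

lemma nrm_sum: "(\<And>k. k \<in> I \<Longrightarrow> F k \<in> V) \<Longrightarrow> nrm (sum F I) \<le> (\<Sum>k\<in>I. nrm (F k))"
proof (induction I rule: infinite_finite_induct)
  case (insert x I)
  have "nrm (F x + sum F I) \<le> nrm (F x) + nrm (sum F I)" using insert by (intro nrm_triangle) auto
  moreover have "nrm (sum F I) \<le> (\<Sum>k\<in>I. nrm (F k))" using insert by auto
  moreover have "sum F (insert x I) = F x + sum F I" "(\<Sum>k\<in>insert x I. nrm (F k)) = nrm (F x) + (\<Sum>k\<in>I. nrm (F k))"
    using insert(1,2) by (rule sum.insert)+
  ultimately show ?case by (metis (no_types) add_left_mono order_trans)
qed auto

lemma heq_iff: "heq H f g \<longleftrightarrow> f \<in> V \<and> g \<in> V \<and> nrm (f - g) = 0"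
  by (simp add: heq_def fun_diff_def)

lemma nrm_cong: "f \<in> V \<Longrightarrow> g \<in> V \<Longrightarrow> nrm (f - g) = 0 \<Longrightarrow> nrm f = nrm g"
  using nrm_diff_ge[of f g] by simp

lemma heq_trans': "f \<in> V \<Longrightarrow> g \<in> V \<Longrightarrow> h \<in> V \<Longrightarrow> nrm (f - g) = 0 \<Longrightarrow> nrm (g - h) = 0 \<Longrightarrow> nrm (f - h) = 0"
  using nrm_triangle3[of f g h] nrm_nonneg[of "f - h"] by (simp add: antisym)

lemma ip_null: "f \<in> V \<Longrightarrow> g \<in> V \<Longrightarrow> nrm f = 0 \<Longrightarrow> ip H f g = 0"
  using cauchy_schwarz[of f g] by simp

lemma ip_cong_left: "f \<in> V \<Longrightarrow> f' \<in> V \<Longrightarrow> g \<in> V \<Longrightarrow> nrm (f - f') = 0 \<Longrightarrow> ip H f g = ip H f' g"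
  using ip_null[of "f - f'" g] by (simp add: ip_simps)

lemma ip_cong_right: "f \<in> V \<Longrightarrow> f' \<in> V \<Longrightarrow> g \<in> V \<Longrightarrow> nrm (f - f') = 0 \<Longrightarrow> ip H g f = ip H g f'"
  using ip_cong_left[of f f' g] ip_cnj[of f g] ip_cnj[of f' g] by simp

section \<open>Limits in norm\<close>

lemma tendsto_ip:
  assumes F: "\<And>k. F k \<in> V" "f \<in> V" "(\<lambda>k. nrm (F k - f)) \<longlonglongrightarrow> 0"
    and G: "\<And>k. G k \<in> V" "g \<in> V" "(\<lambda>k. nrm (G k - g)) \<longlonglongrightarrow> 0"
  shows "(\<lambda>k. ip H (F k) (G k)) \<longlonglongrightarrow> ip H f g"
proof -
  have b: "cmod (ip H (F k) (G k) - ip H f g) \<le> nrm (F k - f) * nrm (G k - g) + nrm (F k - f) * nrm g + nrm f * nrm (G k - g)" for k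
  proof -
    have eq: "ip H (F k) (G k) - ip H f g = ip H (F k - f) (G k - g) + ip H (F k - f) g + ip H f (G k - g)"
      using F G by (simp add: ip_simps)
    have "cmod (ip H (F k) (G k) - ip H f g) \<le> cmod (ip H (F k - f) (G k - g)) + cmod (ip H (F k - f) g) + cmod (ip H f (G k - g))"
      unfolding eq by (intro norm_triangle_le add_mono norm_triangle_ineq order.refl)
    also have "\<dots> \<le> nrm (F k - f) * nrm (G k - g) + nrm (F k - f) * nrm g + nrm f * nrm (G k - g)"
      using F G by (intro add_mono cauchy_schwarz) auto
    finally show ?thesis .
  qed
  have "(\<lambda>k. nrm (F k - f) * nrm (G k - g) + nrm (F k - f) * nrm g + nrm f * nrm (G k - g)) \<longlonglongrightarrow> 0 * 0 + 0 * nrm g + nrm f * 0"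
    using F G by (intro tendsto_intros) auto
  then have "(\<lambda>k. ip H (F k) (G k) - ip H f g) \<longlonglongrightarrow> 0"
    by (intro Lim_null_comparison[OF always_eventually[OF allI[OF b]]]) simp
  then show ?thesis by (simp add: LIM_zero_iff)
qed

lemma tendsto_nrm:
  assumes F: "\<And>k. F k \<in> V" "f \<in> V" "(\<lambda>k. nrm (F k - f)) \<longlonglongrightarrow> 0"
  shows "(\<lambda>k. nrm (F k)) \<longlonglongrightarrow> nrm f"
  using tendsto_rabs_zero_iff Lim_null_comparison[of "\<lambda>k. nrm (F k) - nrm f", OF always_eventually F(3)]
    nrm_diff_ge F by (auto simp: LIM_zero_iff)

lemma limit_unique:
  assumes F: "\<And>k. F k \<in> V" "f \<in> V" "(\<lambda>k. nrm (F k - f)) \<longlonglongrightarrow> 0" "g \<in> V" "(\<lambda>k. nrm (F k - g)) \<longlonglongrightarrow> 0"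
  shows "nrm (f - g) = 0"
proof -
  have "(\<lambda>k. nrm (F k - f) + nrm (F k - g)) \<longlonglongrightarrow> 0" using tendsto_add[OF F(3) F(5)] by simp
  moreover have "nrm (f - g) \<le> nrm (F k - f) + nrm (F k - g)" for k
    using nrm_triangle3[of f "F k" g] nrm_diff_commute[of f "F k"] F by simp
  ultimately have "nrm (f - g) \<le> 0" by (meson LIMSEQ_le_const)
  then show ?thesis using nrm_nonneg[of "f - g"] F by (simp add: antisym)
qed

lemma limit_cauchy:
  assumes F: "\<And>k. F k \<in> V" "f \<in> V" "(\<lambda>k. nrm (F k - f)) \<longlonglongrightarrow> 0" and e: "e > 0"
  shows "\<exists>N. \<forall>m\<ge>N. \<forall>n\<ge>N. nrm (F m - F n) < e"
proof -
  obtain N where N: "\<And>k. k \<ge> N \<Longrightarrow> nrm (F k - f) < e / 2"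
    using F(3) e unfolding LIMSEQ_def dist_real_def
    by (metis abs_less_iff diff_zero half_gt_zero)
  show ?thesis
  proof (intro exI allI impI)
    fix m n assume "m \<ge> N" "n \<ge> N"
    then show "nrm (F m - F n) < e"
      using N[of m] N[of n] nrm_triangle3[of "F m" f "F n"] nrm_diff_commute[of f "F n"] F by simp
  qed
qed

text \<open>Representatives: the null vectors are split off by an algebraic complement, so that
  on the range \<open>W\<close> of the linear map \<open>q\<close> equality is equality of classes.\<close>

definition q :: "('i \<Rightarrow> complex) \<Rightarrow> 'i \<Rightarrow> complex" where
  "q = (SOME q. Vector_Spaces.linear scl scl q \<and> (\<forall>f\<in>V. q f \<in> V \<and> nrm (f - q f) = 0) \<and> (\<forall>f\<in>V. nrm f = 0 \<longrightarrow> q f = 0))"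

text \<open>The null vectors form a subspace \<open>N\<close>, and a linear left inverse
  \<open>p\<close> of the identity on \<open>N\<close> with range in \<open>N\<close> is a
  projection onto it. Then \<open>f - p f\<close> lies in the class of \<open>f\<close> and vanishes
  for null \<open>f\<close>.\<close>

lemma q_spec: "Vector_Spaces.linear scl scl q \<and> (\<forall>f\<in>V. q f \<in> V \<and> nrm (f - q f) = 0) \<and> (\<forall>f\<in>V. nrm f = 0 \<longrightarrow> q f = 0)"
proof -
  define N where "N = {f \<in> V. nrm f = 0}"
  interpret vp: vector_space_pair "scl :: complex \<Rightarrow> ('i \<Rightarrow> complex) \<Rightarrow> _" "scl :: complex \<Rightarrow> ('i \<Rightarrow> complex) \<Rightarrow> _" ..
  have N: "scl.subspace N"
  proof (rule scl.subspaceI)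
    fix f g assume "f \<in> N" "g \<in> N"
    then show "f + g \<in> N" using nrm_triangle[of f g] nrm_nonneg[of "f + g"] by (simp add: N_def antisym)
  qed (auto simp: N_def nrm_scl)
  obtain p where p: "range p \<subseteq> N" "Vector_Spaces.linear scl scl p" "\<And>v. v \<in> N \<Longrightarrow> p v = v"
    using vp.linear_exists_left_inverse_on[OF scl.linear_id N] by auto
  have l: "Vector_Spaces.linear scl scl (\<lambda>f. f - p f)"
    using vp.linear_compose_sub[OF scl.linear_id p(2)] by (simp add: id_def)
  have ex: "\<exists>q. Vector_Spaces.linear scl scl q \<and> (\<forall>f\<in>V. q f \<in> V \<and> nrm (f - q f) = 0) \<and> (\<forall>f\<in>V. nrm f = 0 \<longrightarrow> q f = 0)"
    using p l by (intro exI[of _ "\<lambda>f. f - p f"]) (auto simp: N_def)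
  show ?thesis unfolding q_def by (rule someI_ex[OF ex])
qed

definition W where "W = q ` V"

lemma q_add: "q (f + g) = q f + q g" and q_scl: "q (scl c f) = scl c (q f)"
proof -
  interpret Vector_Spaces.linear scl scl q using q_spec by blast
  show "q (f + g) = q f + q g" "q (scl c f) = scl c (q f)" by (rule add, rule scale)
qed

lemma q_diff: "q (f - g) = q f - q g"
  using q_add[of f "scl (-1) g"] q_scl[of "-1" g] by (simp flip: uminus_eq_scl)

lemma q_mem [simp, intro]: "f \<in> V \<Longrightarrow> q f \<in> V"
  and nrm_q: "f \<in> V \<Longrightarrow> nrm (f - q f) = 0"
  and q_null: "f \<in> V \<Longrightarrow> nrm f = 0 \<Longrightarrow> q f = 0"
  using q_spec by blast+

lemma q_W [simp, intro]: "f \<in> V \<Longrightarrow> q f \<in> W" by (auto simp: W_def)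

lemma W_V [simp, intro]: "f \<in> W \<Longrightarrow> f \<in> V" by (auto simp: W_def)

lemma q_eqI: "f \<in> V \<Longrightarrow> g \<in> V \<Longrightarrow> nrm (f - g) = 0 \<Longrightarrow> q f = q g"
  using q_null[of "f - g"] by (simp add: q_diff)

lemma q_idem: "f \<in> W \<Longrightarrow> q f = f"
  using q_eqI[OF _ _ nrm_q] by (auto simp: W_def)

lemma q_eq_iff: "f \<in> V \<Longrightarrow> g \<in> V \<Longrightarrow> q f = q g \<longleftrightarrow> nrm (f - g) = 0"
  using q_eqI[of f g] nrm_q[of "f - g"] by (fastforce simp: q_diff)

lemma heq_q: "heq H f g \<longleftrightarrow> f \<in> V \<and> g \<in> V \<and> q f = q g"
  using q_eq_iff by (auto simp: heq_iff)

lemma nrm_q_eq [simp]: "f \<in> V \<Longrightarrow> nrm (q f) = nrm f"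
  using nrm_cong[of f "q f"] nrm_q by simp

lemma W_eqI: "f \<in> W \<Longrightarrow> g \<in> W \<Longrightarrow> nrm (f - g) = 0 \<Longrightarrow> f = g"
  using q_eqI[of f g] by (simp add: q_idem)

lemma W_add [simp, intro]: "f \<in> W \<Longrightarrow> g \<in> W \<Longrightarrow> f + g \<in> W"
  using q_W[of "f + g"] by (simp add: q_add q_idem)

lemma W_scl [simp, intro]: "f \<in> W \<Longrightarrow> scl c f \<in> W"
  using q_W[of "scl c f"] by (simp add: q_scl q_idem)

lemma W_diff [simp, intro]: "f \<in> W \<Longrightarrow> g \<in> W \<Longrightarrow> f - g \<in> W"
  using q_W[of "f - g"] by (simp add: q_diff q_idem)

end

section \<open>Operators given by graphs, in vector notation\<close>

context semi_inner
begin

lemma is_operatorI: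
  assumes "T \<subseteq> V \<times> V" "(0, 0) \<in> T"
    and "\<And>f h f' h'. (f, h) \<in> T \<Longrightarrow> (f', h') \<in> T \<Longrightarrow> (f + f', h + h') \<in> T"
    and "\<And>f h a. (f, h) \<in> T \<Longrightarrow> (scl a f, scl a h) \<in> T"
    and "\<And>f h h'. (f, h) \<in> T \<Longrightarrow> (f, h') \<in> T \<Longrightarrow> nrm (h - h') = 0"
    and "\<And>f f' h h'. (f, h) \<in> T \<Longrightarrow> f' \<in> V \<Longrightarrow> h' \<in> V \<Longrightarrow> nrm (f - f') = 0 \<Longrightarrow> nrm (h - h') = 0 \<Longrightarrow> (f', h') \<in> T"
  shows "is_operator H T"
proof -
  have "((\<lambda>_. 0), (\<lambda>_. 0)) \<in> T" using assms(2) by (simp add: zero_fun_def)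
  moreover have "((\<lambda>i. f i + f' i), (\<lambda>i. h i + h' i)) \<in> T" if "(f, h) \<in> T" "(f', h') \<in> T" for f h f' h'
    using assms(3)[OF that] by (simp add: plus_fun_def)
  moreover have "((\<lambda>i. a * f i), (\<lambda>i. a * h i)) \<in> T" if "(f, h) \<in> T" for f h a
    using assms(4)[OF that, of a] by (simp add: scl_def)
  moreover have "heq H h h'" if "(f, h) \<in> T" "(f, h') \<in> T" for f h h'
    using assms(5)[OF that] that assms(1) by (auto simp: heq_iff)
  moreover have "(f', h') \<in> T" if "(f, h) \<in> T" "heq H f f'" "heq H h h'" for f h f' h'
    using assms(6)[OF that(1)] that(2,3) by (auto simp: heq_iff)
  ultimately show ?thesis unfolding is_operator_def using assms(1) by blast
qed

lemma is_operatorD: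
  assumes "is_operator H T"
  shows "(f, h) \<in> T \<Longrightarrow> f \<in> V" "(f, h) \<in> T \<Longrightarrow> h \<in> V" "(0, 0) \<in> T"
    and "(f, h) \<in> T \<Longrightarrow> (f', h') \<in> T \<Longrightarrow> (f + f', h + h') \<in> T"
    and "(f, h) \<in> T \<Longrightarrow> (scl a f, scl a h) \<in> T"
    and "(f, h) \<in> T \<Longrightarrow> (f, h') \<in> T \<Longrightarrow> nrm (h - h') = 0"
    and "(f, h) \<in> T \<Longrightarrow> f' \<in> V \<Longrightarrow> h' \<in> V \<Longrightarrow> nrm (f - f') = 0 \<Longrightarrow> nrm (h - h') = 0 \<Longrightarrow> (f', h') \<in> T"
    and "(f, h) \<in> T \<Longrightarrow> (f', h') \<in> T \<Longrightarrow> (f - f', h - h') \<in> T"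
proof -
  have 1: "T \<subseteq> V \<times> V" and 2: "((\<lambda>_. 0), (\<lambda>_. 0)) \<in> T"
    and 3: "\<And>f h f' h'. (f, h) \<in> T \<Longrightarrow> (f', h') \<in> T \<Longrightarrow> ((\<lambda>i. f i + f' i), (\<lambda>i. h i + h' i)) \<in> T"
    and 4: "\<And>f h a. (f, h) \<in> T \<Longrightarrow> ((\<lambda>i. a * f i), (\<lambda>i. a * h i)) \<in> T"
    and 5: "\<And>f h h'. (f, h) \<in> T \<Longrightarrow> (f, h') \<in> T \<Longrightarrow> heq H h h'"
    and 6: "\<And>f f' h h'. (f, h) \<in> T \<Longrightarrow> heq H f f' \<Longrightarrow> heq H h h' \<Longrightarrow> (f', h') \<in> T"
  proof -
    note D0 = assms[unfolded is_operator_def, THEN conjunct2, THEN conjunct2]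
    note D = D0[THEN conjunct1] D0[THEN conjunct2, THEN conjunct1]
    note D' = D0[THEN conjunct2, THEN conjunct2, THEN conjunct1] D0[THEN conjunct2, THEN conjunct2, THEN conjunct2]
    show "T \<subseteq> V \<times> V" "((\<lambda>_. 0), (\<lambda>_. 0)) \<in> T"
      using assms[unfolded is_operator_def, THEN conjunct1] assms[unfolded is_operator_def, THEN conjunct2, THEN conjunct1]
      by blast+
    show
      "\<And>f h h'. (f, h) \<in> T \<Longrightarrow> (f, h') \<in> T \<Longrightarrow> heq H h h'"
      "\<And>f f' h h'. (f, h) \<in> T \<Longrightarrow> heq H f f' \<Longrightarrow> heq H h h' \<Longrightarrow> (f', h') \<in> T"
      using D' by blast+
    show "((\<lambda>i. f i + f' i), (\<lambda>i. h i + h' i)) \<in> T" if "(f, h) \<in> T" "(f', h') \<in> T" for f h f' h'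
      using bspec[OF D(1) that(1)] that(2) by fastforce
    show "((\<lambda>i. a * f i), (\<lambda>i. a * h i)) \<in> T" if "(f, h) \<in> T" for f h a
      using bspec[OF D(2) that(1)] by simp
  qed
  show v: "(f, h) \<in> T \<Longrightarrow> f \<in> V" "(f, h) \<in> T \<Longrightarrow> h \<in> V" for f h using 1 by auto
  show "(0, 0) \<in> T" using 2 by (simp add: zero_fun_def)
  show a: "(f, h) \<in> T \<Longrightarrow> (f', h') \<in> T \<Longrightarrow> (f + f', h + h') \<in> T" for f h f' h'
    using 3[of f h f' h'] by (simp add: plus_fun_def)
  show s: "(f, h) \<in> T \<Longrightarrow> (scl a f, scl a h) \<in> T" for f h a
    using 4[of f h a] by (simp add: scl_def)
  show "(f, h) \<in> T \<Longrightarrow> (f, h') \<in> T \<Longrightarrow> nrm (h - h') = 0"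
    using 5[of f h h'] by (simp add: heq_iff)
  show "(f, h) \<in> T \<Longrightarrow> f' \<in> V \<Longrightarrow> h' \<in> V \<Longrightarrow> nrm (f - f') = 0 \<Longrightarrow> nrm (h - h') = 0 \<Longrightarrow> (f', h') \<in> T"
    using 6[of f h f' h'] v[of f h] by (simp add: heq_iff)
  show "(f, h) \<in> T \<Longrightarrow> (f', h') \<in> T \<Longrightarrow> (f - f', h - h') \<in> T"
    using a[of f h "scl (-1) f'" "scl (-1) h'"] s[of f' h' "-1"] by simp
qed

end

text \<open>Spanning pairs instead of vectors gives the linear extension of a map before it is known
  to be well defined; a norm bound on the pairs then yields that.\<close>

inductive_set lin_span :: "'i operator \<Rightarrow> 'i operator" for E where
  lin_span_zero: "(0, 0) \<in> lin_span E"
| lin_span_step: "(F, G) \<in> lin_span E \<Longrightarrow> (a, b) \<in> E \<Longrightarrow> (F + scl c a, G + scl c b) \<in> lin_span E"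

lemma lin_span_add: "(F', G') \<in> lin_span E \<Longrightarrow> (F, G) \<in> lin_span E \<Longrightarrow> (F + F', G + G') \<in> lin_span E"
  by (induction rule: lin_span.induct) (auto simp: add.assoc[symmetric] intro: lin_span.intros)

lemma lin_span_scl: "(F, G) \<in> lin_span E \<Longrightarrow> (scl c F, scl c G) \<in> lin_span E"
  by (induction rule: lin_span.induct) (auto simp: scl.scale_right_distrib intro: lin_span.intros)

lemma lin_span_repr:
  assumes "(F, G) \<in> lin_span E"
  shows "\<exists>N c a b. (\<forall>k<N. (a k, b k) \<in> E) \<and> F = (\<Sum>k<(N::nat). scl (c k) (a k)) \<and> G = (\<Sum>k<N. scl (c k) (b k))"
  using assms
proof induction
  case lin_span_zero
  show ?case by (rule exI[of _ 0]) simp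
next
  case (lin_span_step F G x y d)
  then obtain N c a b where *: "\<forall>k<N. (a k, b k) \<in> E" "F = (\<Sum>k<(N::nat). scl (c k) (a k))" "G = (\<Sum>k<N. scl (c k) (b k))"
    by blast
  show ?case
    by (rule exI[of _ "Suc N"], rule exI[of _ "c(N := d)"], rule exI[of _ "a(N := x)"], rule exI[of _ "b(N := y)"])
      (use * lin_span_step in \<open>auto simp: less_Suc_eq\<close>)
qed

section \<open>Orthogonal projection and extension of contractions\<close>

locale hilbert = semi_inner +
  assumes complete: "(\<And>k. F k \<in> V) \<Longrightarrow> (\<And>e. e > 0 \<Longrightarrow> \<exists>N. \<forall>m\<ge>N. \<forall>n\<ge>N. nrm (F m - F n) < e)
    \<Longrightarrow> \<exists>f\<in>V. (\<lambda>k. nrm (F k - f)) \<longlonglongrightarrow> 0"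
begin

text \<open>A sequence minimising the distance to \<open>R\<close> is Cauchy by the parallelogram
  law, and its limit \<open>P\<close> attains the minimum. Orthogonality follows by comparing
  \<open>P\<close> with \<open>P + c v\<close> for \<open>v\<close> in \<open>R\<close>.\<close>

lemma projection:
  assumes R: "R \<subseteq> V" "0 \<in> R" "\<And>f g. f \<in> R \<Longrightarrow> g \<in> R \<Longrightarrow> f + g \<in> R" "\<And>c f. f \<in> R \<Longrightarrow> scl c f \<in> R"
    and closed: "\<And>F f. (\<And>k. F k \<in> R) \<Longrightarrow> f \<in> V \<Longrightarrow> (\<lambda>k. nrm (F k - f)) \<longlonglongrightarrow> 0 \<Longrightarrow> f \<in> R"
    and f: "f \<in> V"
  obtains P where "P \<in> R" "\<And>w. w \<in> R \<Longrightarrow> ip H (f - P) w = 0"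
proof -
  define D where "D = (\<lambda>w. (nrm (f - w))\<^sup>2) ` R"
  define d where "d = Inf D"
  have D: "D \<noteq> {}" "bdd_below D" using R by (auto simp: D_def intro: bdd_belowI[of _ 0])
  have dle: "d \<le> (nrm (f - w))\<^sup>2" if "w \<in> R" for w
    unfolding d_def using that D by (intro cInf_lower) (auto simp: D_def)
  have "\<exists>w\<in>R. (nrm (f - w))\<^sup>2 < d + 1 / (real k + 1)" for k
    using cInf_lessD[OF D(1), of "d + 1 / (real k + 1)"] by (auto simp: D_def d_def)
  then obtain w where w: "\<And>k. w k \<in> R" "\<And>k. (nrm (f - w k))\<^sup>2 < d + 1 / (real k + 1)" by metis
  have wV: "w k \<in> V" for k using w R by auto
  \<comment> \<open>The midpoint of \<open>w m\<close> and \<open>w n\<close> lies in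
    \<open>R\<close>, so its squared distance from \<open>f\<close> is at least \<open>d\<close>.
    The parallelogram law then bounds the distance of the two points by their excess over the
    minimum.\<close>
  have par: "(nrm (w m - w n))\<^sup>2 \<le> 2 / (real m + 1) + 2 / (real n + 1)" for m n
  proof -
    define a b where "a = f - w m" and "b = f - w n"
    have ab: "a \<in> V" "b \<in> V" using f wV by (auto simp: a_def b_def)
    have "scl (1/2) (w m + w n) \<in> R" using w R by auto
    then have "4 * d \<le> 4 * (nrm (f - scl (1/2) (w m + w n)))\<^sup>2" using dle by fastforce
    also have "f - scl (1/2) (w m + w n) = scl (1/2) (a + b)"
      by (simp add: a_def b_def fun_eq_iff scl_def plus_fun_apply minus_apply field_simps)
    also have "4 * (nrm (scl (1/2) (a + b)))\<^sup>2 = (nrm (a + b))\<^sup>2"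
      using ab by (simp add: nrm_scl norm_divide power_mult_distrib power2_eq_square)
    finally have "4 * d \<le> (nrm (a + b))\<^sup>2" .
    moreover have "w m - w n = b - a" by (simp add: a_def b_def)
    then have "(nrm (w m - w n))\<^sup>2 = (nrm (a - b))\<^sup>2" using nrm_diff_commute[OF ab] by simp
    moreover have "(nrm a)\<^sup>2 < d + 1 / (real m + 1)" "(nrm b)\<^sup>2 < d + 1 / (real n + 1)"
      using w by (auto simp: a_def b_def)
    ultimately show ?thesis using ab by (simp add: nrm_sq_add nrm_sq_diff)
  qed
  have "\<exists>N. \<forall>m\<ge>N. \<forall>n\<ge>N. nrm (w m - w n) < e" if e: "e > 0" for e
  proof -
    obtain N where N: "real N > 4 / e\<^sup>2" using reals_Archimedean2 by blast
    show ?thesis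
    proof (intro exI allI impI)
      fix m n assume mn: "m \<ge> N" "n \<ge> N"
      have e2: "e\<^sup>2 > 0" using e by simp
      have "4 < real N * e\<^sup>2" using N e2 by (simp add: divide_less_eq)
      have Np: "real N > 0" using N e2 by (smt (verit) divide_pos_pos)
      have "2 / (real m + 1) \<le> 2 / real N" "2 / (real n + 1) \<le> 2 / real N"
        using mn Np by (auto intro!: divide_left_mono mult_pos_pos)
      moreover have "2 / real N + 2 / real N < e\<^sup>2"
        using \<open>4 < real N * e\<^sup>2\<close> Np by (simp add: field_simps)
      ultimately have "(nrm (w m - w n))\<^sup>2 < e\<^sup>2" using par[of m n] by linarith
      then show "nrm (w m - w n) < e" using e by (simp add: power2_less_imp_less)
    qed
  qed
  then obtain P where P: "P \<in> V" "(\<lambda>k. nrm (w k - P)) \<longlonglongrightarrow> 0" using complete[of w] wV by blast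
  have PR: "P \<in> R" using closed P w by blast
  define z where "z = f - P"
  have zV: "z \<in> V" using f P by (simp add: z_def)
  have "(\<lambda>k. nrm (f - w k)) \<longlonglongrightarrow> nrm z"
  proof (rule tendsto_nrm)
    have "f - w k - z = - (w k - P)" for k by (simp add: z_def)
    then show "(\<lambda>k. nrm (f - w k - z)) \<longlonglongrightarrow> 0" using P wV by (simp only: nrm_minus diff_mem)
  qed (use f wV zV in auto)
  then have "(\<lambda>k. (nrm (f - w k))\<^sup>2) \<longlonglongrightarrow> (nrm z)\<^sup>2" by (intro tendsto_intros)
  moreover have "(\<lambda>k. d + 1 / (real k + 1)) \<longlonglongrightarrow> d + 0"
    using LIMSEQ_inverse_real_of_nat by (intro tendsto_intros) (simp add: inverse_eq_divide add.commute)
  ultimately have zd: "(nrm z)\<^sup>2 \<le> d"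
    using w(2) by (intro LIMSEQ_le[of "\<lambda>k. (nrm (f - w k))\<^sup>2" _ "\<lambda>k. d + 1 / (real k + 1)"]) (auto intro: less_imp_le)
  have "ip H z v = 0" if v: "v \<in> R" for v
  proof (cases "nrm v = 0")
    case True
    then show ?thesis using ip_null[of v z] ip_cnj[of v z] zV v R by auto
  next
    case False
    have vV: "v \<in> V" using v R by auto
    \<comment> \<open>The coefficient of the projection of \<open>z\<close> onto \<open>v\<close>,
      which decreases the squared norm most.\<close>
    define c where "c = ip H z v / (complex_of_real ((nrm v)\<^sup>2))"
    have "P + scl c v \<in> R" using PR v R by auto
    then have "(nrm z)\<^sup>2 \<le> (nrm (f - (P + scl c v)))\<^sup>2" using dle zd by fastforce
    also have "f - (P + scl c v) = z - scl c v" by (simp add: z_def)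
    also have "(nrm (z - scl c v))\<^sup>2 = (nrm z)\<^sup>2 - (cmod (ip H z v))\<^sup>2 / (nrm v)\<^sup>2"
    proof -
      have "cnj c * ip H z v = complex_of_real ((cmod (ip H z v))\<^sup>2 / (nrm v)\<^sup>2)"
        using False complex_norm_square[of "ip H z v"] by (simp add: c_def mult.commute)
      then have "Re (cnj c * ip H z v) = (cmod (ip H z v))\<^sup>2 / (nrm v)\<^sup>2" by (simp only: Re_complex_of_real)
      moreover have "(cmod c * nrm v)\<^sup>2 = (cmod (ip H z v))\<^sup>2 / (nrm v)\<^sup>2"
        using False by (simp add: c_def norm_divide norm_mult power2_eq_square field_simps)
      ultimately show ?thesis using zV vV by (simp add: nrm_sq_diff ip_simps nrm_scl)
    qed
    finally have "(cmod (ip H z v))\<^sup>2 / (nrm v)\<^sup>2 \<le> 0" by simp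
    then show ?thesis using False by (simp add: divide_le_0_iff)
  qed
  then show ?thesis using that PR by (simp add: z_def)
qed

text \<open>
  The extension vanishes on the orthogonal complement of the first components of \<open>E\<close>, so these
  need not be total.
\<close>

lemma contraction_extension:
  assumes E: "E \<subseteq> V \<times> V"
    and le: "\<And>N c a b. (\<And>k. k < N \<Longrightarrow> (a k, b k) \<in> E) \<Longrightarrow>
      nrm (\<Sum>k<(N::nat). scl (c k) (b k)) \<le> nrm (\<Sum>k<N. scl (c k) (a k))"
  shows "\<exists>C. contraction_op H C \<and> E \<subseteq> C"
proof -
  define L where "L = lin_span E"
  have LV: "F \<in> V \<and> G \<in> V" if "(F, G) \<in> L" for F G
    using that unfolding L_def by induction (use E in auto)
  have Lle: "nrm G \<le> nrm F" if "(F, G) \<in> L" for F G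
  proof -
    obtain N c a b where "\<forall>k<N. (a k, b k) \<in> E" "F = (\<Sum>k<(N::nat). scl (c k) (a k))" "G = (\<Sum>k<N. scl (c k) (b k))"
      using lin_span_repr[of F G E] \<open>(F, G) \<in> L\<close> unfolding L_def by blast
    then show ?thesis using le[of N a b c] by simp
  qed
  have EL: "E \<subseteq> L"
    using lin_span_step[OF lin_span_zero, of _ _ E 1] by (auto simp: L_def)
  \<comment> \<open>The closure of the graph \<open>L\<close>, written as simultaneous approximation
    of both components.\<close>
  define K where "K = {(P, Q). P \<in> V \<and> Q \<in> V \<and> (\<forall>e>0. \<exists>(a, b)\<in>L. nrm (a - P) < e \<and> nrm (b - Q) < e)}"
  have KV: "P \<in> V" "Q \<in> V" if "(P, Q) \<in> K" for P Q using that by (auto simp: K_def)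
  have Ke: "\<exists>a b. (a, b) \<in> L \<and> a \<in> V \<and> b \<in> V \<and> nrm (a - P) < e \<and> nrm (b - Q) < e"
    if "(P, Q) \<in> K" "e > 0" for P Q e
    using that LV unfolding K_def by blast
  have KI: "(P, Q) \<in> K" if "P \<in> V" "Q \<in> V" "\<And>e. e > 0 \<Longrightarrow> \<exists>a b. (a, b) \<in> L \<and> nrm (a - P) < e \<and> nrm (b - Q) < e" for P Q
    using that unfolding K_def by blast
  have LK: "L \<subseteq> K" using LV by (auto simp: K_def intro!: bexI)
  have Kle: "nrm Q \<le> nrm P" if K: "(P, Q) \<in> K" for P Q
  proof (rule field_le_epsilon)
    fix e :: real assume "e > 0"
    then obtain a b where ab: "(a, b) \<in> L" "a \<in> V" "b \<in> V" "nrm (a - P) < e / 2" "nrm (b - Q) < e / 2"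
      using Ke[OF K, of "e / 2"] by auto
    show "nrm Q \<le> nrm P + e"
      using Lle[OF ab(1)] ab nrm_diff_ge[of a P] nrm_diff_ge[of b Q] KV[OF K] by simp
  qed
  have Kadd: "(P + P', Q + Q') \<in> K" if K: "(P, Q) \<in> K" "(P', Q') \<in> K" for P Q P' Q'
  proof (rule KI)
    fix e :: real assume e: "e > 0"
    obtain a b where ab: "(a, b) \<in> L" "a \<in> V" "b \<in> V" "nrm (a - P) < e / 2" "nrm (b - Q) < e / 2"
      using Ke[OF K(1), of "e / 2"] e by auto
    obtain a' b' where ab': "(a', b') \<in> L" "a' \<in> V" "b' \<in> V" "nrm (a' - P') < e / 2" "nrm (b' - Q') < e / 2"
      using Ke[OF K(2), of "e / 2"] e by auto
    have "nrm (a + a' - (P + P')) < e"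
      using nrm_triangle[of "a - P" "a' - P'"] ab ab' KV[OF K(1)] KV[OF K(2)] by (simp add: algebra_simps)
    moreover have "nrm (b + b' - (Q + Q')) < e"
      using nrm_triangle[of "b - Q" "b' - Q'"] ab ab' KV[OF K(1)] KV[OF K(2)] by (simp add: algebra_simps)
    ultimately show "\<exists>a b. (a, b) \<in> L \<and> nrm (a - (P + P')) < e \<and> nrm (b - (Q + Q')) < e"
      using lin_span_add ab(1) ab'(1) unfolding L_def by blast
  qed (use KV K in auto)
  have Kscl: "(scl c P, scl c Q) \<in> K" if K: "(P, Q) \<in> K" for P Q c
  proof (rule KI)
    fix e :: real assume e: "e > 0"
    define d where "d = e / (cmod c + 1)"
    have d: "d > 0" "cmod c * d < e"
      using e by (auto simp: d_def field_simps add_pos_nonneg intro!: divide_pos_pos)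
    obtain a b where ab: "(a, b) \<in> L" "a \<in> V" "b \<in> V" "nrm (a - P) < d" "nrm (b - Q) < d"
      using Ke[OF K d(1)] by auto
    have "nrm (scl c a - scl c P) < e" "nrm (scl c b - scl c Q) < e"
      using ab KV[OF K] d mult_left_mono[of "nrm (a - P)" d "cmod c"] mult_left_mono[of "nrm (b - Q)" d "cmod c"]
      by (simp_all add: nrm_scl flip: scl.scale_right_diff_distrib)
    then show "\<exists>a b. (a, b) \<in> L \<and> nrm (a - scl c P) < e \<and> nrm (b - scl c Q) < e"
      using lin_span_scl ab(1) unfolding L_def by blast
  qed (use KV K in auto)
  have Kdiff: "(P - P', Q - Q') \<in> K" if K: "(P, Q) \<in> K" "(P', Q') \<in> K" for P Q P' Q'
    using Kadd[OF K(1) Kscl[OF K(2), of "-1"]] by simp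
  have Kclosed: "(P, Q) \<in> K" if K: "\<And>k. (F k, G k) \<in> K" and P: "P \<in> V" "(\<lambda>k. nrm (F k - P)) \<longlonglongrightarrow> 0"
      and Q: "Q \<in> V" "(\<lambda>k. nrm (G k - Q)) \<longlonglongrightarrow> 0" for F G :: "nat \<Rightarrow> _" and P Q
  proof (rule KI)
    fix e :: real assume e: "e > 0"
    have "\<forall>\<^sub>F k in sequentially. nrm (F k - P) < e / 2 \<and> nrm (G k - Q) < e / 2"
      using order_tendstoD(2)[OF P(2), of "e / 2"] order_tendstoD(2)[OF Q(2), of "e / 2"] e by (auto intro: eventually_conj)
    then obtain k where k: "nrm (F k - P) < e / 2" "nrm (G k - Q) < e / 2"
      unfolding eventually_sequentially by blast
    obtain a b where ab: "(a, b) \<in> L" "a \<in> V" "b \<in> V" "nrm (a - F k) < e / 2" "nrm (b - G k) < e / 2"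
      using Ke[OF K[of k], of "e / 2"] e by auto
    have "nrm (a - P) < e" "nrm (b - Q) < e"
      using nrm_triangle3[of a "F k" P] nrm_triangle3[of b "G k" Q] ab k KV[OF K[of k]] P Q by auto
    then show "\<exists>a b. (a, b) \<in> L \<and> nrm (a - P) < e \<and> nrm (b - Q) < e" using ab by blast
  qed (use P Q in auto)
  define R where "R = Domain K"
  have RV: "R \<subseteq> V" using KV by (auto simp: R_def)
  \<comment> \<open>Contractivity turns convergence of the arguments into a Cauchy sequence of
    images. So the domain of the closed graph \<open>K\<close> is closed, and orthogonal projection
    onto it is available.\<close>
  have Rclosed: "f \<in> R" if F: "\<And>k. F k \<in> R" "f \<in> V" "(\<lambda>k. nrm (F k - f)) \<longlonglongrightarrow> 0" for F f
  proof -
    obtain G where G: "\<And>k. (F k, G k) \<in> K"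
      using F(1) choice[of "\<lambda>k G. (F k, G) \<in> K"] unfolding R_def Domain_iff by blast
    have "\<exists>N. \<forall>m\<ge>N. \<forall>n\<ge>N. nrm (G m - G n) < e" if e: "e > 0" for e
    proof -
      have FV: "F k \<in> V" for k using F(1) RV by auto
      show ?thesis using limit_cauchy[OF FV F(2,3) e] Kle[OF Kdiff[OF G G]] by (meson order.strict_trans1)
    qed
    then obtain Q where "Q \<in> V" "(\<lambda>k. nrm (G k - Q)) \<longlonglongrightarrow> 0" using complete[of G] KV(2)[OF G] by auto
    then have "(f, Q) \<in> K" using Kclosed[of F G f Q] G F by blast
    then show ?thesis by (auto simp: R_def)
  qed
  have R0: "0 \<in> R" using LK lin_span_zero by (auto simp: R_def L_def)
  have Radd: "f + g \<in> R" if "f \<in> R" "g \<in> R" for f g using Kadd that unfolding R_def by blast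
  have Rscl: "scl c f \<in> R" if "f \<in> R" for f c using Kscl that unfolding R_def by blast
  \<comment> \<open>\<open>F\<close> is projected onto \<open>R\<close> and the closed contraction
    is applied to the projection. The witness \<open>P\<close> is determined only up to null
    vectors.\<close>
  define C where "C = {(F, G). F \<in> V \<and> G \<in> V \<and> (\<exists>P. (P, G) \<in> K \<and> (\<forall>w\<in>R. ip H (F - P) w = 0))}"
  have op: "is_operator H C"
  proof (rule is_operatorI)
    show "(0, 0) \<in> C" using LK lin_span_zero[of E] RV by (auto simp: C_def L_def intro!: exI[of _ 0])
  next
    fix f h f' h' assume A: "(f, h) \<in> C" "(f', h') \<in> C"
    then obtain P P' where P: "(P, h) \<in> K" "\<forall>w\<in>R. ip H (f - P) w = 0" "(P', h') \<in> K" "\<forall>w\<in>R. ip H (f' - P') w = 0"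
      by (auto simp: C_def)
    have V: "f \<in> V" "h \<in> V" "f' \<in> V" "h' \<in> V" using A by (auto simp: C_def)
    have "\<forall>w\<in>R. ip H (f + f' - (P + P')) w = 0"
    proof
      fix w assume w: "w \<in> R"
      have "ip H ((f - P) + (f' - P')) w = 0" using P w RV V KV[OF P(1)] KV[OF P(3)] by (subst ip_add_left) auto
      then show "ip H (f + f' - (P + P')) w = 0" by (simp add: algebra_simps)
    qed
    then show "(f + f', h + h') \<in> C" using Kadd[OF P(1,3)] V by (auto simp: C_def)
  next
    fix f h a assume A: "(f, h) \<in> C"
    then obtain P where P: "(P, h) \<in> K" "\<forall>w\<in>R. ip H (f - P) w = 0" by (auto simp: C_def)
    have V: "f \<in> V" "h \<in> V" using A by (auto simp: C_def)
    have "\<forall>w\<in>R. ip H (scl a f - scl a P) w = 0"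
    proof
      fix w assume w: "w \<in> R"
      have "ip H (scl a (f - P)) w = 0" using P w RV V KV[OF P(1)] by (subst ip_scl_left) auto
      then show "ip H (scl a f - scl a P) w = 0" by (simp add: scl.scale_right_diff_distrib)
    qed
    then show "(scl a f, scl a h) \<in> C" using Kscl[OF P(1)] V by (auto simp: C_def)
  next
    fix f h h' assume A: "(f, h) \<in> C" "(f, h') \<in> C"
    then obtain P P' where P: "(P, h) \<in> K" "\<forall>w\<in>R. ip H (f - P) w = 0" "(P', h') \<in> K" "\<forall>w\<in>R. ip H (f - P') w = 0"
      by (auto simp: C_def)
    have V: "f \<in> V" "h \<in> V" "h' \<in> V" using A by (auto simp: C_def)
    note PV = KV[OF P(1)] KV[OF P(3)]
    \<comment> \<open>Two projections of one vector differ by an element of \<open>R\<close>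
      orthogonal to \<open>R\<close>, hence by a null vector, and contractivity makes their images
      agree modulo null vectors.\<close>
    have K: "(P - P', h - h') \<in> K" by (rule Kdiff[OF P(1,3)])
    then have "P - P' \<in> R" by (auto simp: R_def)
    then have "ip H ((f - P') - (f - P)) (P - P') = 0" using P V PV by (subst ip_diff_left) auto
    then have "ip H (P - P') (P - P') = 0" by simp
    then have "(nrm (P - P'))\<^sup>2 = 0" using PV by (simp add: nrm_sq)
    then have "nrm (h - h') \<le> 0" using Kle[OF K] by simp
    then show "nrm (h - h') = 0" using nrm_nonneg[of "h - h'"] V by (simp add: antisym)
  next
    fix f f' h h' assume A: "(f, h) \<in> C" "f' \<in> V" "h' \<in> V" "nrm (f - f') = 0" "nrm (h - h') = 0"
    then obtain P where P: "(P, h) \<in> K" "\<forall>w\<in>R. ip H (f - P) w = 0" by (auto simp: C_def)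
    have V: "f \<in> V" "h \<in> V" using A by (auto simp: C_def)
    have "(P, h') \<in> K"
    proof (rule KI)
      fix e :: real assume "e > 0"
      then obtain a b where ab: "(a, b) \<in> L" "a \<in> V" "b \<in> V" "nrm (a - P) < e" "nrm (b - h) < e"
        using Ke[OF P(1)] by blast
      have "nrm (b - h') < e" using nrm_triangle3[of b h h'] ab A V by simp
      then show "\<exists>a b. (a, b) \<in> L \<and> nrm (a - P) < e \<and> nrm (b - h') < e" using ab by blast
    qed (use KV P A in auto)
    moreover have "\<forall>w\<in>R. ip H (f' - P) w = 0"
    proof
      fix w assume w: "w \<in> R"
      have "nrm ((f - P) - (f' - P)) = 0" using A by simp
      then show "ip H (f' - P) w = 0"
        using ip_cong_left[of "f - P" "f' - P" w] P w RV V A KV[OF P(1)] by auto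
    qed
    ultimately show "(f', h') \<in> C" using A by (auto simp: C_def)
  qed (auto simp: C_def)
  have dom: "Domain C = V"
  proof
    show "V \<subseteq> Domain C"
    proof
      fix f assume f: "f \<in> V"
      obtain P where P: "P \<in> R" "\<And>w. w \<in> R \<Longrightarrow> ip H (f - P) w = 0"
        by (rule projection[OF RV R0 _ _ _ f]) (blast intro: Radd Rscl Rclosed)+
      then obtain G where "(P, G) \<in> K" by (auto simp: R_def)
      then have "(f, G) \<in> C" using f P KV by (auto simp: C_def)
      then show "f \<in> Domain C" by auto
    qed
  qed (auto simp: C_def)
  have contr: "nrm h \<le> nrm f" if fh: "(f, h) \<in> C" for f h
  proof -
    obtain P where P: "(P, h) \<in> K" "\<forall>w\<in>R. ip H (f - P) w = 0" using fh by (auto simp: C_def)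
    have V: "f \<in> V" "P \<in> V" using fh KV[OF P(1)] by (auto simp: C_def)
    have "ip H (f - P) P = 0" using P by (auto simp: R_def)
    then have "(nrm ((f - P) + P))\<^sup>2 = (nrm (f - P))\<^sup>2 + (nrm P)\<^sup>2"
      using nrm_sq_add[of "f - P" P] V by simp
    then have "(nrm P)\<^sup>2 \<le> (nrm f)\<^sup>2" by simp
    then have "nrm P \<le> nrm f" using V nrm_nonneg[of f] by (rule_tac power2_le_imp_le) auto
    then show ?thesis using Kle[OF P(1)] by simp
  qed
  have "E \<subseteq> C"
  proof
    fix x assume x: "x \<in> E"
    obtain f h where fh: "x = (f, h)" by force
    have "(f, h) \<in> K" using x fh EL LK by auto
    moreover have "\<forall>w\<in>R. ip H (f - f) w = 0" using RV by auto
    ultimately show "x \<in> C" using KV fh by (auto simp: C_def)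
  qed
  then show ?thesis using op dom contr unfolding contraction_op_def by blast
qed

end

section \<open>The semigroup of a positive self-adjoint operator\<close>

lemma tendsto_at_right_zeroI:
  fixes \<phi> :: "real \<Rightarrow> real"
  assumes "\<And>e. e > 0 \<Longrightarrow> \<exists>d>0. \<forall>t. 0 < t \<and> t < d \<longrightarrow> \<bar>\<phi> t\<bar> < e"
  shows "(\<phi> \<longlongrightarrow> 0) (at_right 0)"
  using assms by (fastforce simp: tendsto_iff eventually_at_right_field)

locale positive_self_adjoint = hilbert +
  fixes A :: "'a operator"
  assumes sa: "self_adjoint H A" and pos: "positive_op H A"
begin

section \<open>Symmetry, closedness and the resolvent\<close>

lemma A_op: "is_operator H A"
  using sa by (simp add: self_adjoint_def)

lemmas AD = is_operatorD[OF A_op]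

lemma A_dense: "f \<in> V \<Longrightarrow> e > 0 \<Longrightarrow> \<exists>u v. (u, v) \<in> A \<and> nrm (f - u) < e"
  using sa unfolding self_adjoint_def densely_defined_def by (fastforce simp: fun_diff_def)

text \<open>The inclusion of the adjoint in \<open>A\<close>, as a rule. Closedness, the existence
  of resolvents and the identification of the generator rest on it.\<close>

lemma A_adjI:
  assumes "f \<in> V" "h \<in> V" "\<And>u v. (u, v) \<in> A \<Longrightarrow> ip H v f = ip H u h"
  shows "(f, h) \<in> A"
proof -
  have "(f, h) \<in> adjoint_op H A" using assms by (auto simp: adjoint_op_def)
  then show ?thesis using sa by (simp add: self_adjoint_def)
qed

lemma A_sym: assumes "(f, h) \<in> A" "(u, v) \<in> A" shows "ip H v f = ip H u h"
proof -
  have "(f, h) \<in> adjoint_op H A" using assms(1) sa by (simp add: self_adjoint_def)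
  then show ?thesis using assms(2) by (auto simp: adjoint_op_def)
qed

lemma A_pos: "(f, h) \<in> A \<Longrightarrow> 0 \<le> Re (ip H h f)"
  using pos by (auto simp: positive_op_def)

text \<open>Adjoint graphs are closed: the identity that defines them passes to limits by continuity
  of the inner product.\<close>

lemma A_closed:
  assumes "\<And>k. (F k, G k) \<in> A" "f \<in> V" "g \<in> V" "(\<lambda>k. nrm (F k - f)) \<longlonglongrightarrow> 0" "(\<lambda>k. nrm (G k - g)) \<longlonglongrightarrow> 0"
  shows "(f, g) \<in> A"
proof (rule A_adjI)
  fix u v assume uv: "(u, v) \<in> A"
  note V = AD(1)[OF uv] AD(2)[OF uv] AD(1)[OF assms(1)] AD(2)[OF assms(1)]
  have "(\<lambda>k. ip H v (F k)) \<longlonglongrightarrow> ip H v f" by (rule tendsto_ip) (use V assms in auto)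
  moreover have "(\<lambda>k. ip H u (G k)) \<longlonglongrightarrow> ip H u g" by (rule tendsto_ip) (use V assms in auto)
  moreover have "ip H v (F k) = ip H u (G k)" for k by (rule A_sym[OF assms(1) uv])
  ultimately show "ip H v f = ip H u g" using LIMSEQ_unique by simp
qed (use assms in auto)

text \<open>In the expansion of the squared norm of \<open>u + h A u\<close> the cross term is
  nonnegative by positivity. The first bound makes resolvents contractions; both together make the
  range of \<open>1 + h A\<close> closed.\<close>

lemma resolvent_bound:
  assumes uv: "(u, v) \<in> A" and h: "h \<ge> 0"
  shows "nrm u \<le> nrm (u + scl (complex_of_real h) v)" "h * nrm v \<le> nrm (u + scl (complex_of_real h) v)"
proof -
  note V = AD(1)[OF uv] AD(2)[OF uv]
  have "0 \<le> h * Re (ip H u v)" using A_pos[OF uv] ip_cnj[OF V] h by simp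
  then have *: "(nrm u)\<^sup>2 + (h * nrm v)\<^sup>2 \<le> (nrm (u + scl (complex_of_real h) v))\<^sup>2"
    using V h by (simp add: nrm_sq_add nrm_scl ip_simps)
  have "(nrm u)\<^sup>2 \<le> (nrm (u + scl (complex_of_real h) v))\<^sup>2" "(h * nrm v)\<^sup>2 \<le> (nrm (u + scl (complex_of_real h) v))\<^sup>2"
    using * zero_le_power2[of "h * nrm v"] zero_le_power2[of "nrm u"] by linarith+
  then show "nrm u \<le> nrm (u + scl (complex_of_real h) v)" "h * nrm v \<le> nrm (u + scl (complex_of_real h) v)"
    using V nrm_nonneg[of "u + scl (complex_of_real h) v"] by (blast intro: power2_le_imp_le)+
qed

text \<open>The range of \<open>1 + h A\<close>, taken modulo null vectors, is closed, and a vector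
  orthogonal to it would be an eigenvector of \<open>A\<close> for \<open>- 1 / h\<close>.
  Positivity leaves only null vectors.\<close>

lemma resolvent_exists:
  assumes h: "h > 0" and f: "f \<in> V"
  shows "\<exists>u v. (u, v) \<in> A \<and> nrm (f - (u + scl (complex_of_real h) v)) = 0"
proof -
  let ?s = "scl (complex_of_real h)"
  define R where "R = {w \<in> V. \<exists>u v. (u, v) \<in> A \<and> nrm (w - (u + ?s v)) = 0}"
  obtain P where P: "P \<in> R" "\<And>w. w \<in> R \<Longrightarrow> ip H (f - P) w = 0"
  proof (rule projection[of R f])
    show "0 \<in> R" using AD(3) by (auto simp: R_def intro!: exI[of _ 0])
    show "f + g \<in> R" if fg: "f \<in> R" "g \<in> R" for f g
    proof -
      obtain u v u' v' where *: "(u, v) \<in> A" "nrm (f - (u + ?s v)) = 0" "(u', v') \<in> A" "nrm (g - (u' + ?s v')) = 0"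
        using fg by (auto simp: R_def)
      have V: "f \<in> V" "g \<in> V" using fg by (auto simp: R_def)
      have "nrm ((f - (u + ?s v)) + (g - (u' + ?s v'))) \<le> 0"
        using * V AD(1,2)[OF *(1)] AD(1,2)[OF *(3)] by (intro order_trans[OF nrm_triangle]) auto
      moreover have "(f - (u + ?s v)) + (g - (u' + ?s v')) = (f + g) - ((u + u') + ?s (v + v'))"
        by (simp add: scl.scale_right_distrib)
      ultimately have "nrm ((f + g) - ((u + u') + ?s (v + v'))) = 0"
        using V AD(1,2)[OF *(1)] AD(1,2)[OF *(3)] by (intro antisym) auto
      then show ?thesis using AD(4)[OF *(1,3)] V unfolding R_def by blast
    qed
    show "scl c f \<in> R" if ff: "f \<in> R" for c f
    proof -
      obtain u v where *: "(u, v) \<in> A" "nrm (f - (u + ?s v)) = 0" using ff by (auto simp: R_def)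
      have V: "f \<in> V" using ff by (auto simp: R_def)
      have "nrm (scl c (f - (u + ?s v))) = 0" using * V AD(1,2)[OF *(1)] by (subst nrm_scl) auto
      then have "nrm (scl c f - (scl c u + ?s (scl c v))) = 0"
        by (simp add: scl.scale_right_distrib scl.scale_right_diff_distrib mult.commute)
      then show ?thesis using AD(5)[OF *(1)] V unfolding R_def by blast
    qed
    show "f \<in> R" if F: "\<And>k. F k \<in> R" "f \<in> V" "(\<lambda>k. nrm (F k - f)) \<longlonglongrightarrow> 0" for F f
    proof -
      have "\<exists>u v. (u, v) \<in> A \<and> nrm (F k - (u + ?s v)) = 0" for k using F(1) by (auto simp: R_def)
      then obtain u v where uv: "\<And>k. (u k, v k) \<in> A" "\<And>k. nrm (F k - (u k + ?s (v k))) = 0" by metis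
      have V: "u k \<in> V" "v k \<in> V" "F k \<in> V" for k using AD(1,2)[OF uv(1)] F(1) by (auto simp: R_def)
      have eq: "nrm ((u m - u n) + ?s (v m - v n)) = nrm (F m - F n)" for m n
      proof (rule nrm_cong)
        have "nrm ((F n - (u n + ?s (v n))) - (F m - (u m + ?s (v m)))) \<le> 0"
          using V uv(2)[of m] uv(2)[of n] by (intro order_trans[OF nrm_triangle_diff]) auto
        moreover have "(F n - (u n + ?s (v n))) - (F m - (u m + ?s (v m))) = u m - u n + ?s (v m - v n) - (F m - F n)"
          by (simp add: scl.scale_right_diff_distrib)
        ultimately show "nrm (u m - u n + ?s (v m - v n) - (F m - F n)) = 0" using V by (intro antisym) auto
      qed (use V in auto)
      \<comment> \<open>Applied to differences, the two bounds make both the preimages and their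
        images under \<open>A\<close> Cauchy, so closedness of \<open>A\<close> applies.\<close>
      have cu: "nrm (u m - u n) \<le> nrm (F m - F n)" and cv: "h * nrm (v m - v n) \<le> nrm (F m - F n)" for m n
        using resolvent_bound[OF AD(8)[OF uv(1) uv(1)], of h m n] eq[of m n] h by auto
      have "\<exists>N. \<forall>m\<ge>N. \<forall>n\<ge>N. nrm (u m - u n) < e" if "e > 0" for e
        using limit_cauchy[OF V(3) F(2,3) that] cu by (meson order.strict_trans1)
      then obtain u0 where u0: "u0 \<in> V" "(\<lambda>k. nrm (u k - u0)) \<longlonglongrightarrow> 0" using complete[of u] V by blast
      have "\<exists>N. \<forall>m\<ge>N. \<forall>n\<ge>N. nrm (v m - v n) < e" if e: "e > 0" for e
      proof -
        obtain N where N: "\<forall>m\<ge>N. \<forall>n\<ge>N. nrm (F m - F n) < h * e" using limit_cauchy[OF V(3) F(2,3), of "h * e"] e h by auto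
        have "nrm (v m - v n) < e" if "m \<ge> N" "n \<ge> N" for m n
        proof -
          have "h * nrm (v m - v n) < h * e" using N that cv[of m n] by (meson order.strict_trans1)
          then show ?thesis using h by simp
        qed
        then show ?thesis by blast
      qed
      then obtain v0 where v0: "v0 \<in> V" "(\<lambda>k. nrm (v k - v0)) \<longlonglongrightarrow> 0" using complete[of v] V by blast
      have A: "(u0, v0) \<in> A" by (rule A_closed[OF uv(1) u0(1) v0(1) u0(2) v0(2)])
      have "(\<lambda>k. nrm (F k - (u0 + ?s v0))) \<longlonglongrightarrow> 0"
      proof (rule tendsto_sandwich[OF _ _ tendsto_const])
        show "\<forall>\<^sub>F k in sequentially. nrm (F k - (u0 + ?s v0)) \<le> nrm (u k - u0) + h * nrm (v k - v0)"
        proof (intro always_eventually allI)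
          fix k
          have "nrm (F k - (u0 + ?s v0)) \<le> nrm (F k - (u k + ?s (v k))) + nrm ((u k + ?s (v k)) - (u0 + ?s v0))"
            using V u0 v0 by (intro nrm_triangle3) auto
          also have "\<dots> = nrm ((u k - u0) + ?s (v k - v0))" using uv(2)[of k] by (simp add: algebra_simps)
          also have "\<dots> \<le> nrm (u k - u0) + nrm (?s (v k - v0))" using V u0 v0 by (intro nrm_triangle) auto
          also have "nrm (?s (v k - v0)) = h * nrm (v k - v0)" using V v0 h by (simp add: nrm_scl)
          finally show "nrm (F k - (u0 + ?s v0)) \<le> nrm (u k - u0) + h * nrm (v k - v0)" .
        qed
        show "\<forall>\<^sub>F k in sequentially. 0 \<le> nrm (F k - (u0 + ?s v0))" using V u0 v0 by auto
        show "(\<lambda>k. nrm (u k - u0) + h * nrm (v k - v0)) \<longlonglongrightarrow> 0"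
          using tendsto_add[OF u0(2) tendsto_mult_left[OF v0(2), of h]] by simp
      qed
      then have "nrm (f - (u0 + ?s v0)) = 0" by (intro limit_unique[OF V(3) F(2,3)]) (use u0 v0 in auto)
      then show ?thesis using A F(2) unfolding R_def by blast
    qed
    show "R \<subseteq> V" by (auto simp: R_def)
  qed (use f in auto)
  define z where "z = f - P"
  have PV: "P \<in> V" using P(1) by (simp add: R_def)
  have zV: "z \<in> V" using f PV by (simp add: z_def)
  \<comment> \<open>Orthogonality of \<open>z\<close> to all \<open>u + h A u\<close> reads
    \<open><A u, z> = <u, - z / h>\<close>.\<close>
  have "(z, scl (complex_of_real (- 1 / h)) z) \<in> A"
  proof (rule A_adjI)
    fix u v assume uv: "(u, v) \<in> A"
    note V = AD(1)[OF uv] AD(2)[OF uv]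
    have "nrm ((u + ?s v) - (u + ?s v)) = 0" by simp
    then have "u + ?s v \<in> R" using uv V unfolding R_def by blast
    then have "ip H z (u + ?s v) = 0" using P by (simp add: z_def)
    then have "ip H (u + ?s v) z = 0" using ip_cnj[of z "u + ?s v"] zV V by simp
    then have "ip H u z + complex_of_real h * ip H v z = 0" using V zV by (simp add: ip_simps)
    then show "ip H v z = ip H u (scl (complex_of_real (- 1 / h)) z)"
      using V zV h by (simp add: ip_simps field_simps add_eq_0_iff)
  qed (use zV in auto)
  from A_pos[OF this] have "0 \<le> - (nrm z)\<^sup>2 / h" using zV h by (simp add: ip_simps nrm_sq)
  then have "(nrm z)\<^sup>2 \<le> 0" using h by (simp add: divide_le_0_iff)
  then have z0: "nrm z = 0" by simp
  obtain u v where uv: "(u, v) \<in> A" "nrm (P - (u + ?s v)) = 0" using P(1) by (auto simp: R_def)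
  have "nrm (f - (u + ?s v)) = 0"
    by (rule heq_trans'[OF f PV _ _ uv(2)]) (use AD(1,2)[OF uv(1)] z0 in \<open>auto simp: z_def\<close>)
  then show ?thesis using uv by blast
qed

text \<open>
  This is \<open>(1 + h A)\<^sup>-\<^sup>1\<close>, with values in the representatives \<open>W\<close> to make it a linear map.  The
  case \<open>h = 0\<close> is separate because the condition would divide by zero.
\<close>

definition resolvent :: "real \<Rightarrow> ('a \<Rightarrow> complex) \<Rightarrow> 'a \<Rightarrow> complex" where
  "resolvent h f = (if h = 0 then q f else THE w. w \<in> W \<and> (w, scl (complex_of_real (1 / h)) (f - w)) \<in> A)"

lemma resolvent_spec:
  assumes h: "h > 0" and f: "f \<in> V"
  shows "resolvent h f \<in> W \<and> (resolvent h f, scl (complex_of_real (1 / h)) (f - resolvent h f)) \<in> A"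
    and "w \<in> W \<Longrightarrow> (w, scl (complex_of_real (1 / h)) (f - w)) \<in> A \<Longrightarrow> resolvent h f = w"
proof -
  let ?P = "\<lambda>w. w \<in> W \<and> (w, scl (complex_of_real (1 / h)) (f - w)) \<in> A"
  obtain u v where uv: "(u, v) \<in> A" "nrm (f - (u + scl (complex_of_real h) v)) = 0"
    using resolvent_exists[OF h f] by blast
  note V = AD(1,2)[OF uv(1)]
  have "nrm (f - (q u + scl (complex_of_real h) v)) = 0"
    by (rule heq_trans'[OF f _ _ uv(2)]) (use V nrm_q in auto)
  then have "nrm (scl (complex_of_real (- 1 / h)) (f - (q u + scl (complex_of_real h) v))) = 0"
    using V f h by (subst nrm_scl) auto
  moreover have "scl (complex_of_real (- 1 / h)) (f - (q u + scl (complex_of_real h) v)) = v - scl (complex_of_real (1 / h)) (f - q u)"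
    using h by (simp add: scl.scale_right_diff_distrib scl.scale_right_distrib)
  ultimately have "nrm (v - scl (complex_of_real (1 / h)) (f - q u)) = 0" by simp
  then have ex: "?P (q u)" using AD(7)[OF uv(1)] V f nrm_q by auto
  \<comment> \<open>The difference of two solutions satisfies the eigenvalue equation for
    \<open>- 1 / h\<close>, so it is null, and in \<open>W\<close> null means zero.\<close>
  have un: "w = w'" if "?P w" "?P w'" for w w'
  proof -
    have d: "w - w' \<in> V" using that by auto
    have "(w - w', scl (complex_of_real (1 / h)) (f - w) - scl (complex_of_real (1 / h)) (f - w')) \<in> A"
      using that by (intro AD(8)) auto
    moreover have "scl (complex_of_real (1 / h)) (f - w) - scl (complex_of_real (1 / h)) (f - w') = scl (complex_of_real (- 1 / h)) (w - w')"
      by (simp add: scl.scale_right_diff_distrib)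
    ultimately have "0 \<le> Re (ip H (scl (complex_of_real (- 1 / h)) (w - w')) (w - w'))" using A_pos by simp
    then have "0 \<le> - (nrm (w - w'))\<^sup>2 / h" using d h by (simp add: ip_scl_left ip_minus_left nrm_sq)
    then have "(nrm (w - w'))\<^sup>2 \<le> 0" using h by (simp add: divide_le_0_iff)
    then have "nrm (w - w') = 0" by simp
    then show ?thesis using W_eqI that by blast
  qed
  have "resolvent h f = (THE w. ?P w)" using h by (simp add: resolvent_def)
  then show "?P (resolvent h f)" "w \<in> W \<Longrightarrow> (w, scl (complex_of_real (1 / h)) (f - w)) \<in> A \<Longrightarrow> resolvent h f = w"
    using theI[of ?P, OF ex] un ex by (metis (no_types, lifting))+
qed

lemma resolvent_zero [simp]: "resolvent 0 f = q f" by (simp add: resolvent_def)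

lemma resolvent_W [simp, intro]: "h \<ge> 0 \<Longrightarrow> f \<in> V \<Longrightarrow> resolvent h f \<in> W"
  using resolvent_spec(1)[of h f] by (cases "h = 0") auto

lemma resolvent_V [simp, intro]: "h \<ge> 0 \<Longrightarrow> f \<in> V \<Longrightarrow> resolvent h f \<in> V"
  by blast

lemma resolvent_add: assumes "h \<ge> 0" "f \<in> V" "g \<in> V" shows "resolvent h (f + g) = resolvent h f + resolvent h g"
proof (cases "h = 0")
  case False
  then have h: "h > 0" using assms by simp
  show ?thesis
    using AD(4)[OF resolvent_spec(1)[OF h assms(2), THEN conjunct2] resolvent_spec(1)[OF h assms(3), THEN conjunct2]] assms
    by (intro resolvent_spec(2)[OF h]) (auto simp: algebra_simps simp flip: scl.scale_right_distrib)
qed (auto simp: q_add)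

lemma resolvent_scl: assumes "h \<ge> 0" "f \<in> V" shows "resolvent h (scl c f) = scl c (resolvent h f)"
proof (cases "h = 0")
  case False
  then have h: "h > 0" using assms by simp
  show ?thesis
    using AD(5)[OF resolvent_spec(1)[OF h assms(2), THEN conjunct2], of c] assms
    by (intro resolvent_spec(2)[OF h]) (auto simp: scl.scale_right_diff_distrib mult.commute)
qed (auto simp: q_scl)

lemma resolvent_diff: assumes "h \<ge> 0" "f \<in> V" "g \<in> V" shows "resolvent h (f - g) = resolvent h f - resolvent h g"
  using resolvent_add[of h f "scl (-1) g"] resolvent_scl[of h g "-1"] assms by simp

lemma resolvent_decomp: assumes "h > 0" "f \<in> V" shows "resolvent h f + scl (complex_of_real h) (scl (complex_of_real (1 / h)) (f - resolvent h f)) = f"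
  using assms by simp

lemma resolvent_contr: assumes "h \<ge> 0" "f \<in> V" shows "nrm (resolvent h f) \<le> nrm f"
proof (cases "h = 0")
  case False
  then have h: "h > 0" using assms by simp
  show ?thesis using resolvent_bound(1)[OF resolvent_spec(1)[OF h assms(2), THEN conjunct2], of h] resolvent_decomp[OF h assms(2)] h by simp
qed (use assms in auto)

lemma resolvent_cong: assumes "h \<ge> 0" "f \<in> V" "g \<in> V" "nrm (f - g) = 0" shows "resolvent h f = resolvent h g"
  using resolvent_contr[of h "f - g"] assms nrm_nonneg[of "resolvent h (f - g)"] by (intro W_eqI) (auto simp: resolvent_diff intro: antisym)

text \<open>Writing \<open>f\<close> and \<open>g\<close> as \<open>1 + h A\<close> applied to their
  resolvents reduces the claim to the symmetry of \<open>A\<close>.\<close>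

lemma resolvent_sym: assumes "h \<ge> 0" "f \<in> V" "g \<in> V" shows "ip H (resolvent h f) g = ip H f (resolvent h g)"
proof (cases "h = 0")
  case True
  then show ?thesis
    using ip_cong_left[of f "q f" g] ip_cong_right[of g "q g" f] nrm_q assms by auto
next
  case False
  then have h: "h > 0" using assms by simp
  define v where "v = scl (complex_of_real (1 / h)) (f - resolvent h f)"
  define v' where "v' = scl (complex_of_real (1 / h)) (g - resolvent h g)"
  have A: "(resolvent h f, v) \<in> A" "(resolvent h g, v') \<in> A" using resolvent_spec(1) h assms by (auto simp: v_def v'_def)
  note V = AD(1,2)[OF A(1)] AD(1,2)[OF A(2)]
  have "f = resolvent h f + scl (complex_of_real h) v" "g = resolvent h g + scl (complex_of_real h) v'"
    using resolvent_decomp h assms by (auto simp: v_def v'_def)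
  then show ?thesis using A_sym[OF A(2,1)] V
    by (metis (no_types, lifting) complex_cnj_complex_of_real ip_add_left ip_add_right ip_scl_left ip_scl_right scale)
qed

text \<open>With \<open>y = (u - (1 + h A)^-1 u) / h\<close>, the image of the resolvent under
  \<open>A\<close>, one has \<open>h A y = v - y\<close>. So \<open>y\<close> solves the equation
  that defines the resolvent of \<open>v\<close>.\<close>

lemma resolvent_A: assumes h: "h \<ge> 0" and uv: "(u, v) \<in> A" shows "(resolvent h u, resolvent h v) \<in> A"
proof (cases "h = 0")
  case True
  then show ?thesis using AD(7)[OF uv] AD(1,2)[OF uv] nrm_q by auto
next
  case False
  then have h: "h > 0" using h by simp
  let ?s = "scl (complex_of_real (1 / h))"
  note V = AD(1,2)[OF uv]
  define y where "y = ?s (u - resolvent h u)"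
  have y: "(resolvent h u, y) \<in> A" using resolvent_spec(1)[OF h V(1)] by (simp add: y_def)
  then have yV: "y \<in> V" by (rule AD(2))
  have "(y, ?s (v - y)) \<in> A" unfolding y_def using AD(5)[OF AD(8)[OF uv y]] by (simp add: y_def)
  then have "(q y, ?s (v - q y)) \<in> A"
  proof (rule AD(7))
    have "nrm (?s (q y - y)) = 0" using nrm_q[OF yV] nrm_diff_commute[of y "q y"] yV by (subst nrm_scl) auto
    then show "nrm (?s (v - y) - ?s (v - q y)) = 0" by (simp flip: scl.scale_right_diff_distrib)
  qed (use yV V nrm_q in auto)
  then have "resolvent h v = q y" using resolvent_spec(2)[OF h V(2)] yV by blast
  then show ?thesis using AD(7)[OF y] nrm_q yV V h by auto
qed

text \<open>Applying one resolvent to the equation that defines the other keeps its form, since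
  resolvents are linear and commute with \<open>A\<close>.\<close>

lemma resolvent_comm: assumes "s \<ge> 0" "t \<ge> 0" "f \<in> V" shows "resolvent s (resolvent t f) = resolvent t (resolvent s f)"
proof (cases "s = 0")
  case True
  then show ?thesis using assms resolvent_cong[of t f "q f"] nrm_q by (auto simp: q_idem)
next
  case False
  then have s: "s > 0" using assms by simp
  have "(resolvent t (resolvent s f), resolvent t (scl (complex_of_real (1 / s)) (f - resolvent s f))) \<in> A"
    using resolvent_A resolvent_spec(1)[OF s assms(3)] assms by blast
  then have "(resolvent t (resolvent s f), scl (complex_of_real (1 / s)) (resolvent t f - resolvent t (resolvent s f))) \<in> A"
    using assms s by (simp add: resolvent_scl resolvent_diff)
  then show ?thesis using assms s by (intro resolvent_spec(2)[OF s]) auto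
qed

lemma resolvent_inv: assumes "h \<ge> 0" "(u, v) \<in> A" "u \<in> W" shows "resolvent h (u + scl (complex_of_real h) v) = u"
proof (cases "h = 0")
  case False
  then have h: "h > 0" using assms by simp
  then show ?thesis using AD(1,2)[OF assms(2)] assms by (intro resolvent_spec(2)[OF h]) auto
qed (use assms in \<open>auto simp: q_idem\<close>)

lemma resolvent_residual: assumes h: "h > 0" and uv: "(u, v) \<in> A"
  shows "nrm (u - (resolvent h u + scl (complex_of_real h) (resolvent h v))) = 0"
proof -
  note V = AD(1,2)[OF uv]
  have "nrm (scl (complex_of_real (1 / h)) (u - resolvent h u) - resolvent h v) = 0"
    using AD(6)[OF resolvent_spec(1)[OF h V(1), THEN conjunct2] resolvent_A[OF _ uv]] h by simp
  then have "nrm (scl (complex_of_real h) (scl (complex_of_real (1 / h)) (u - resolvent h u) - resolvent h v)) = 0"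
    using V h by (subst nrm_scl) auto
  then show ?thesis using h by (simp add: scl.scale_right_diff_distrib algebra_simps)
qed

lemma resolvent_est: assumes h: "h \<ge> 0" and uv: "(u, v) \<in> A" shows "nrm (u - resolvent h u) \<le> h * nrm v"
proof (cases "h = 0")
  case True
  then show ?thesis using nrm_q AD(1)[OF uv] by simp
next
  case False
  then have h: "h > 0" using h by simp
  note V = AD(1,2)[OF uv]
  have "nrm (u - resolvent h u) = nrm (scl (complex_of_real h) (resolvent h v))"
    using resolvent_residual[OF h uv] V h by (intro nrm_cong) (auto simp: algebra_simps)
  also have "\<dots> \<le> h * nrm v" using V h resolvent_contr by (simp add: nrm_scl)
  finally show ?thesis .
qed

text \<open>The difference equals \<open>a b (1 + a A)\<^sup>-\<^sup>1 (1 + b A)\<^sup>-\<^sup>1 (1 + (a + b) A)\<^sup>-\<^sup>1 A\<^sup>2 f\<close>.\<close>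

lemma resolvent_est2:
  assumes a: "a \<ge> 0" and b: "b \<ge> 0" and f: "(f, f1) \<in> A" "(f1, f2) \<in> A"
  shows "nrm (resolvent (a + b) f - resolvent a (resolvent b f)) \<le> a * b * nrm f2"
proof (cases "a + b = 0")
  case True
  then have "a = 0" "b = 0" using a b by auto
  then show ?thesis using AD(1)[OF f(1)] by (simp add: q_idem)
next
  case False
  then have ab: "a + b > 0" using a b by simp
  define u u1 u2 where "u = resolvent (a + b) f" and "u1 = resolvent (a + b) f1" and "u2 = resolvent (a + b) f2"
  have A: "(u, u1) \<in> A" "(u1, u2) \<in> A" using resolvent_A f ab by (auto simp: u_def u1_def u2_def)
  note V = AD(1)[OF f(1)] AD(1,2)[OF f(2)]
  have W: "u \<in> W" "u1 \<in> W" "u2 \<in> W" using V ab by (auto simp: u_def u1_def u2_def)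
  then have uV: "u \<in> V" "u1 \<in> V" "u2 \<in> V" by auto
  let ?s = "\<lambda>x. scl (complex_of_real x)"
  have "(u + ?s b u1, u1 + ?s b u2) \<in> A" using AD(4)[OF A(1) AD(5)[OF A(2)]] by simp
  then have "resolvent a (u + ?s b u1 + ?s a (u1 + ?s b u2)) = u + ?s b u1" using W a by (intro resolvent_inv) auto
  \<comment> \<open>This is \<open>(1 + a A)(1 + b A) u\<close>. Its part
    \<open>u + (a + b) A u\<close> is a version of \<open>f\<close>, and \<open>a b A^2 u\<close> is
    the error.\<close>
  moreover have "u + ?s b u1 + ?s a (u1 + ?s b u2) = (u + ?s (a + b) u1) + ?s (a * b) u2"
    by (simp add: scl.scale_right_distrib scl.scale_left_distrib algebra_simps)
  ultimately have "resolvent b (resolvent a ((u + ?s (a + b) u1) + ?s (a * b) u2)) = u"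
    using resolvent_inv[OF b A(1) W(1)] by simp
  then have *: "resolvent b (resolvent a (u + ?s (a + b) u1)) + ?s (a * b) (resolvent b (resolvent a u2)) = u"
    using uV a b by (simp add: resolvent_add resolvent_scl)
  have "resolvent a (u + ?s (a + b) u1) = resolvent a f"
  proof (rule resolvent_cong[OF a])
    show "nrm (u + ?s (a + b) u1 - f) = 0"
      using resolvent_residual[OF ab f(1)] nrm_diff_commute[of f "u + ?s (a + b) u1"] V uV by (simp add: u_def u1_def)
  qed (use uV V in auto)
  then have "u - resolvent a (resolvent b f) = ?s (a * b) (resolvent b (resolvent a u2))" using * resolvent_comm[OF a b V(1)] by (metis add_diff_cancel_left')
  then have "nrm (u - resolvent a (resolvent b f)) = a * b * nrm (resolvent b (resolvent a u2))" using uV a b by (simp add: nrm_scl norm_mult)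
  also have "\<dots> \<le> a * b * nrm f2"
    using resolvent_contr[of b "resolvent a u2"] resolvent_contr[of a u2] resolvent_contr[of "a + b" f2] V uV a b
    by (intro mult_left_mono) (auto simp: u2_def)
  finally show ?thesis by (simp add: u_def)
qed

text \<open>Records what the telescoping of powers uses: invariance of the space, contractivity and
  compatibility with differences. The identity and all resolvents qualify.\<close>

definition cmap :: "(('a \<Rightarrow> complex) \<Rightarrow> 'a \<Rightarrow> complex) \<Rightarrow> bool" where
  "cmap P \<longleftrightarrow> (\<forall>f\<in>V. P f \<in> V \<and> nrm (P f) \<le> nrm f) \<and> (\<forall>f\<in>V. \<forall>g\<in>V. P (f - g) = P f - P g)"

lemma cmapD: assumes "cmap P" shows "f \<in> V \<Longrightarrow> P f \<in> V" "f \<in> V \<Longrightarrow> nrm (P f) \<le> nrm f"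
  "f \<in> V \<Longrightarrow> g \<in> V \<Longrightarrow> P (f - g) = P f - P g"
  using assms by (auto simp: cmap_def)

lemma cmap_resolvent: "h \<ge> 0 \<Longrightarrow> cmap (resolvent h)"
  by (auto simp: cmap_def resolvent_contr resolvent_diff)

lemma cmap_id: "cmap (\<lambda>f. f)" by (auto simp: cmap_def)

lemma cmap_comp: assumes "cmap P" "cmap Q" shows "cmap (\<lambda>f. P (Q f))"
proof -
  have "nrm (P (Q f)) \<le> nrm f" if "f \<in> V" for f
    using cmapD(2)[OF assms(1), of "Q f"] cmapD(1,2)[OF assms(2) that] by simp
  then show ?thesis using cmapD(1,3)[OF assms(1)] cmapD(1,3)[OF assms(2)] by (simp add: cmap_def)
qed

lemma cmap_pow: "cmap P \<Longrightarrow> cmap (P ^^ n)"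
proof (induction n)
  case (Suc n)
  then show ?case using cmap_comp[of P "P ^^ n"] by (simp add: o_def)
qed (auto simp: cmap_def)

lemma funpow_commute_on:
  assumes "cmap P" "cmap Q" "\<And>f. f \<in> V \<Longrightarrow> P (Q f) = Q (P f)" "f \<in> V"
  shows "P ((Q ^^ n) f) = (Q ^^ n) (P f)"
proof (induction n)
  case (Suc n)
  then show ?case using assms(3)[of "(Q ^^ n) f"] cmapD(1)[OF cmap_pow[OF assms(2)] assms(4)] by simp
qed auto

text \<open>For commuting maps \<open>P^(n+1) - Q^(n+1) = P (P^n - Q^n) + Q^n (P - Q)\<close>, so by
  contractivity each further power costs one copy of the one-step error.\<close>

lemma power_diff_bound:
  assumes P: "cmap P" and Q: "cmap Q" and c: "\<And>f. f \<in> V \<Longrightarrow> P (Q f) = Q (P f)" and f: "f \<in> V"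
  shows "nrm ((P ^^ n) f - (Q ^^ n) f) \<le> real n * nrm (P f - Q f)"
proof (induction n)
  case (Suc n)
  have V: "(P ^^ n) f \<in> V" "(Q ^^ n) f \<in> V" "P f \<in> V" "Q f \<in> V"
    using cmapD(1) cmap_pow P Q f by blast+
  have eq: "(P ^^ Suc n) f - (Q ^^ Suc n) f = P ((P ^^ n) f - (Q ^^ n) f) + (Q ^^ n) (P f - Q f)"
    using V cmapD(3)[OF P] cmapD(3)[OF cmap_pow[OF Q]] funpow_commute_on[OF P Q c f] funpow_swap1[of Q n f] by simp
  have "nrm ((P ^^ Suc n) f - (Q ^^ Suc n) f) \<le> nrm (P ((P ^^ n) f - (Q ^^ n) f)) + nrm ((Q ^^ n) (P f - Q f))"
    unfolding eq using V cmapD(1)[OF P] cmapD(1)[OF cmap_pow[OF Q]] by (intro nrm_triangle) auto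
  also have "\<dots> \<le> real n * nrm (P f - Q f) + nrm (P f - Q f)"
    using V cmapD(2)[OF P, of "(P ^^ n) f - (Q ^^ n) f"] cmapD(2)[OF cmap_pow[OF Q], of "P f - Q f" n] Suc by simp
  finally show ?case by (simp add: algebra_simps)
qed auto

lemma resolvent_dense: assumes f: "f \<in> V" and e: "e > 0" shows "\<exists>d>0. \<forall>h. 0 < h \<and> h < d \<longrightarrow> nrm (f - resolvent h f) < e"
proof -
  obtain u v where uv: "(u, v) \<in> A" "nrm (f - u) < e / 4" using A_dense[OF f, of "e / 4"] e by auto
  note V = AD(1,2)[OF uv(1)]
  \<comment> \<open>The summand \<open>1\<close> avoids a division by zero when \<open>v\<close> is
    null.\<close>
  define d where "d = e / (2 * (nrm v + 1))"
  have vp: "nrm v + 1 > 0" using V by (simp add: add_nonneg_pos)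
  have d: "d > 0" using e vp by (simp add: d_def)
  have "nrm (f - resolvent h f) < e" if h: "0 < h" "h < d" for h
  proof -
    have "h * nrm v \<le> d * (nrm v + 1)" using h V by (intro mult_mono) auto
    also have "\<dots> = e / 2" using vp by (simp add: d_def divide_simps)
    finally have 1: "nrm (u - resolvent h u) \<le> e / 2" using resolvent_est[OF _ uv(1), of h] h by linarith
    have 2: "nrm (resolvent h u - resolvent h f) < e / 4"
      using resolvent_contr[of h "u - f"] h V f uv(2) nrm_diff_commute[of u f] by (simp add: resolvent_diff)
    have "nrm (f - resolvent h f) \<le> nrm (f - u) + nrm (u - resolvent h f)" using V f h by (intro nrm_triangle3) auto
    also have "nrm (u - resolvent h f) \<le> nrm (u - resolvent h u) + nrm (resolvent h u - resolvent h f)" using V f h by (intro nrm_triangle3) auto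
    finally show ?thesis using 1 2 uv(2) by linarith
  qed
  then show ?thesis using d by blast
qed

text \<open>A resolvent maps the domain of \<open>A\<close> into that of \<open>A^2\<close>, and for
  small \<open>h\<close> it moves a vector little.\<close>

lemma A2_dense: assumes f: "f \<in> V" and e: "e > 0"
  shows "\<exists>u u1 u2. (u, u1) \<in> A \<and> (u1, u2) \<in> A \<and> nrm (f - u) < e"
proof -
  obtain g v where gv: "(g, v) \<in> A" "nrm (f - g) < e / 2" using A_dense[OF f, of "e / 2"] e by auto
  note V = AD(1,2)[OF gv(1)]
  obtain d where d: "d > 0" "\<And>h. 0 < h \<and> h < d \<Longrightarrow> nrm (g - resolvent h g) < e / 2" using resolvent_dense[OF V(1), of "e / 2"] e by auto
  define h where "h = d / 2"
  have h: "0 < h" "h < d" using d by (auto simp: h_def)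
  have "(resolvent h g, resolvent h v) \<in> A" using resolvent_A[OF _ gv(1)] h by simp
  moreover have "(resolvent h v, scl (complex_of_real (1 / h)) (v - resolvent h v)) \<in> A" using resolvent_spec(1)[OF h(1) V(2)] by simp
  moreover have "nrm (f - resolvent h g) < e" using nrm_triangle3[of f g "resolvent h g"] d(2)[of h] h gv(2) f V by simp
  ultimately show ?thesis by blast
qed

section \<open>The dyadic Euler scheme\<close>

definition euler :: "nat \<Rightarrow> real \<Rightarrow> ('a \<Rightarrow> complex) \<Rightarrow> 'a \<Rightarrow> complex" where
  "euler k t = (resolvent (t / 2 ^ k)) ^^ (2 ^ k)"

lemma cmap_euler: "t \<ge> 0 \<Longrightarrow> cmap (euler k t)"
  unfolding euler_def by (intro cmap_pow cmap_resolvent) simp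

lemma euler_V: "t \<ge> 0 \<Longrightarrow> f \<in> V \<Longrightarrow> euler k t f \<in> V"
  by (rule cmapD(1)[OF cmap_euler])

lemma euler_contr: "t \<ge> 0 \<Longrightarrow> f \<in> V \<Longrightarrow> nrm (euler k t f) \<le> nrm f"
  by (rule cmapD(2)[OF cmap_euler])

lemma euler_diff: "t \<ge> 0 \<Longrightarrow> f \<in> V \<Longrightarrow> g \<in> V \<Longrightarrow> euler k t (f - g) = euler k t f - euler k t g"
  by (rule cmapD(3)[OF cmap_euler])

lemma euler_lin:
  assumes t: "t \<ge> 0" and f: "f \<in> V"
  shows "g \<in> V \<Longrightarrow> euler k t (f + g) = euler k t f + euler k t g" "euler k t (scl c f) = scl c (euler k t f)"
proof -
  have h: "t / 2 ^ k \<ge> 0" using t by simp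
  have V: "(resolvent (t / 2 ^ k) ^^ n) f \<in> V" if "f \<in> V" for n f using cmapD(1)[OF cmap_pow[OF cmap_resolvent[OF h]] that] .
  have "(resolvent (t / 2 ^ k) ^^ n) (f + g) = (resolvent (t / 2 ^ k) ^^ n) f + (resolvent (t / 2 ^ k) ^^ n) g" if "g \<in> V" for n
    by (induction n) (auto simp: resolvent_add[OF h] V f that)
  then show "g \<in> V \<Longrightarrow> euler k t (f + g) = euler k t f + euler k t g" by (simp add: euler_def)
  have "(resolvent (t / 2 ^ k) ^^ n) (scl c f) = scl c ((resolvent (t / 2 ^ k) ^^ n) f)" for n
    by (induction n) (auto simp: resolvent_scl[OF h] V f)
  then show "euler k t (scl c f) = scl c (euler k t f)" by (simp add: euler_def)
qed

lemma euler_sym: assumes t: "t \<ge> 0" and f: "f \<in> V" and g: "g \<in> V" shows "ip H (euler k t f) g = ip H f (euler k t g)"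
proof -
  have h: "t / 2 ^ k \<ge> 0" using t by simp
  have V: "(resolvent (t / 2 ^ k) ^^ n) f \<in> V" if "f \<in> V" for n f using cmapD(1)[OF cmap_pow[OF cmap_resolvent[OF h]] that] .
  have "ip H ((resolvent (t / 2 ^ k) ^^ n) f) g = ip H f ((resolvent (t / 2 ^ k) ^^ n) g)" if "g \<in> V" for n g
    using that
  proof (induction n arbitrary: g)
    case (Suc n)
    then show ?case using resolvent_sym[OF h V[OF f] Suc.prems] Suc.IH[of "resolvent (t / 2 ^ k) g"] h
      by (simp add: funpow_swap1)
  qed auto
  then show ?thesis using g by (simp add: euler_def)
qed

text \<open>One step of length \<open>2 h\<close> and two of length \<open>h\<close> differ by at
  most \<open>h^2\<close> times the norm of \<open>A^2 f\<close>. There are \<open>2^k\<close> such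
  steps with \<open>h = t / 2^(k+1)\<close>, and \<open>2^k h^2 = t^2 / 4 / 2^k\<close>.\<close>

lemma euler_step:
  assumes t: "t \<ge> 0" and f: "(f, f1) \<in> A" "(f1, f2) \<in> A"
  shows "nrm (euler k t f - euler (Suc k) t f) \<le> t\<^sup>2 / 4 / 2 ^ k * nrm f2"
proof -
  define h where "h = t / 2 ^ Suc k"
  have h: "h \<ge> 0" "h + h = t / 2 ^ k" using t by (auto simp: h_def field_simps)
  note V = AD(1)[OF f(1)] AD(1,2)[OF f(2)]
  have "(resolvent h ^^ 2) ^^ (2 ^ k) = resolvent h ^^ (2 ^ Suc k)" by (simp add: funpow_mult mult.commute)
  moreover have "resolvent h ^^ 2 = (\<lambda>f. resolvent h (resolvent h f))" by (simp add: numeral_2_eq_2 o_def)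
  ultimately have euler: "euler (Suc k) t = (\<lambda>f. resolvent h (resolvent h f)) ^^ (2 ^ k)" by (simp add: euler_def h_def)
  have comm: "resolvent (h + h) (resolvent h (resolvent h f)) = resolvent h (resolvent h (resolvent (h + h) f))" if "f \<in> V" for f
    using resolvent_comm[OF add_nonneg_nonneg[OF h(1) h(1)] h(1) that] resolvent_comm[OF add_nonneg_nonneg[OF h(1) h(1)] h(1) resolvent_V[OF h(1) that]]
    by (simp only:)
  have "nrm ((resolvent (h + h) ^^ (2 ^ k)) f - ((\<lambda>f. resolvent h (resolvent h f)) ^^ (2 ^ k)) f) \<le> real (2 ^ k) * nrm (resolvent (h + h) f - resolvent h (resolvent h f))"
    by (rule power_diff_bound[OF cmap_resolvent cmap_comp[OF cmap_resolvent cmap_resolvent] comm]) (use h(1) V in simp_all)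
  also have "\<dots> \<le> real (2 ^ k) * (h * h * nrm f2)" using resolvent_est2[OF h(1) h(1) f] by (intro mult_left_mono) auto
  also have "\<dots> = t\<^sup>2 / 4 / 2 ^ k * nrm f2" by (simp add: h_def power2_eq_square field_simps)
  finally have "nrm ((resolvent (t / 2 ^ k) ^^ (2 ^ k)) f - euler (Suc k) t f) \<le> t\<^sup>2 / 4 / 2 ^ k * nrm f2" unfolding euler h(2) .
  then show ?thesis by (simp add: euler_def[of k])
qed

text \<open>Since \<open>1 / 4 / 2^j = 1 / 2 (1 / 2^j - 1 / 2^(j+1))\<close>, the step errors
  telescope; the difference of powers in the bound makes the induction exact.\<close>

lemma euler_cauchy:
  assumes t: "t \<ge> 0" and f: "(f, f1) \<in> A" "(f1, f2) \<in> A"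
  shows "nrm (euler m t f - euler (m + n) t f) \<le> t\<^sup>2 / 2 * (1 / 2 ^ m - 1 / 2 ^ (m + n)) * nrm f2"
proof (induction n)
  case (Suc n)
  note V = AD(1)[OF f(1)] euler_V[OF t AD(1)[OF f(1)]]
  have "nrm (euler m t f - euler (m + Suc n) t f) \<le> nrm (euler m t f - euler (m + n) t f) + nrm (euler (m + n) t f - euler (m + Suc n) t f)"
    using V by (intro nrm_triangle3) auto
  also have "\<dots> \<le> t\<^sup>2 / 2 * (1 / 2 ^ m - 1 / 2 ^ (m + n)) * nrm f2 + t\<^sup>2 / 4 / 2 ^ (m + n) * nrm f2"
    using euler_step[OF t f, of "m + n"] Suc by (intro add_mono) auto
  also have "\<dots> = t\<^sup>2 / 2 * (1 / 2 ^ m - 1 / 2 ^ (m + Suc n)) * nrm f2" by (simp add: field_simps)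
  finally show ?case .
qed auto

lemma euler_cauchy':
  assumes t: "t \<ge> 0" and f: "(f, f1) \<in> A" "(f1, f2) \<in> A" and mn: "m \<le> n"
  shows "nrm (euler m t f - euler n t f) \<le> t\<^sup>2 / 2 / 2 ^ m * nrm f2"
proof -
  have "nrm (euler m t f - euler n t f) \<le> t\<^sup>2 / 2 * (1 / 2 ^ m - 1 / 2 ^ n) * nrm f2"
    using euler_cauchy[OF t f, of m "n - m"] mn by simp
  also have "\<dots> \<le> t\<^sup>2 / 2 * (1 / 2 ^ m) * nrm f2"
    using AD(2)[OF f(2)] by (intro mult_right_mono mult_left_mono) auto
  finally show ?thesis by simp
qed

text \<open>The Cauchy estimate holds on the dense domain of \<open>A^2\<close> and passes to
  \<open>f\<close> because all the schemes are contractions.\<close>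

lemma euler_convergent_cauchy:
  assumes t: "t \<ge> 0" and f: "f \<in> V" and e: "e > 0"
  shows "\<exists>N. \<forall>m\<ge>N. \<forall>n\<ge>N. nrm (euler m t f - euler n t f) < e"
proof -
  obtain u u1 u2 where u: "(u, u1) \<in> A" "(u1, u2) \<in> A" "nrm (f - u) < e / 4"
    using A2_dense[OF f, of "e / 4"] e by auto
  note V = AD(1)[OF u(1)] AD(2)[OF u(2)]
  have "(\<lambda>m. t\<^sup>2 / 2 * nrm u2 * (1 / 2) ^ m) \<longlonglongrightarrow> t\<^sup>2 / 2 * nrm u2 * 0"
    by (intro tendsto_intros LIMSEQ_power_zero) simp
  then have "\<forall>\<^sub>F m in sequentially. t\<^sup>2 / 2 * nrm u2 * (1 / 2) ^ m < e / 2"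
    using e by (intro order_tendstoD(2)[of _ 0]) auto
  then obtain N where N: "\<And>m. m \<ge> N \<Longrightarrow> t\<^sup>2 / 2 * nrm u2 * (1 / 2) ^ m < e / 2" by (auto simp: eventually_sequentially)
  have main: "nrm (euler m t f - euler n t f) < e" if mn: "m \<ge> N" "m \<le> n" for m n
  proof -
    have 1: "nrm (euler m t u - euler n t u) < e / 2"
    proof -
      have "nrm (euler m t u - euler n t u) \<le> t\<^sup>2 / 2 * nrm u2 * (1 / 2) ^ m"
        using euler_cauchy'[OF t u(1,2) mn(2)] by (simp add: power_divide field_simps)
      then show ?thesis using N[OF mn(1)] by linarith
    qed
    have 2: "nrm (euler k t f - euler k t u) < e / 4" for k
      using euler_contr[OF t, of "f - u" k] u(3) V f by (simp add: euler_diff t)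
    have "nrm (euler m t f - euler n t f) \<le> nrm (euler m t f - euler m t u) + nrm (euler m t u - euler n t f)"
      using euler_V[OF t] V f by (intro nrm_triangle3) auto
    also have "nrm (euler m t u - euler n t f) \<le> nrm (euler m t u - euler n t u) + nrm (euler n t u - euler n t f)"
      using euler_V[OF t] V f by (intro nrm_triangle3) auto
    finally show ?thesis using 1 2[of m] 2[of n] nrm_diff_commute[of "euler n t u" "euler n t f"] euler_V[OF t] V f by simp
  qed
  have "nrm (euler m t f - euler n t f) < e" if "m \<ge> N" "n \<ge> N" for m n
    using main[of m n] main[of n m] that nrm_diff_commute[of "euler m t f" "euler n t f"] euler_V[OF t f] by (cases "m \<le> n") auto
  then show ?thesis by blast
qed

text \<open>As for the resolvent, the limit is taken in \<open>W\<close>: there it is unique as a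
  function, and linearity holds as an equation between functions.\<close>

definition evol :: "real \<Rightarrow> ('a \<Rightarrow> complex) \<Rightarrow> 'a \<Rightarrow> complex" where
  "evol t f = (THE w. w \<in> W \<and> (\<lambda>k. nrm (euler k t f - w)) \<longlonglongrightarrow> 0)"

lemma evol_spec:
  assumes t: "t \<ge> 0" and f: "f \<in> V"
  shows "evol t f \<in> W \<and> (\<lambda>k. nrm (euler k t f - evol t f)) \<longlonglongrightarrow> 0"
    and "w \<in> V \<Longrightarrow> (\<lambda>k. nrm (euler k t f - w)) \<longlonglongrightarrow> 0 \<Longrightarrow> evol t f = q w"
proof -
  let ?P = "\<lambda>w. w \<in> W \<and> (\<lambda>k. nrm (euler k t f - w)) \<longlonglongrightarrow> 0"
  note V = euler_V[OF t f]
  have qP: "?P (q w)" if w: "w \<in> V" "(\<lambda>k. nrm (euler k t f - w)) \<longlonglongrightarrow> 0" for w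
  proof -
    have "nrm (euler k t f - q w) = nrm (euler k t f - w)" for k
      using V w nrm_q[OF w(1)] by (intro nrm_cong) auto
    then show ?thesis using w by auto
  qed
  have un: "w = w'" if "?P w" "?P w'" for w w'
    using limit_unique[of "\<lambda>k. euler k t f" w w'] V that by (intro W_eqI) auto
  obtain w where "w \<in> V" "(\<lambda>k. nrm (euler k t f - w)) \<longlonglongrightarrow> 0"
    using complete[of "\<lambda>k. euler k t f"] V euler_convergent_cauchy[OF t f] by blast
  then have ex: "?P (q w)" by (rule qP)
  show P: "?P (evol t f)" unfolding evol_def by (rule theI[of ?P, OF ex]) (use un ex in blast)
  show "evol t f = q w" if "w \<in> V" "(\<lambda>k. nrm (euler k t f - w)) \<longlonglongrightarrow> 0" for w
    using un[OF P qP] that by blast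
qed

lemma evol_W [simp, intro]: "t \<ge> 0 \<Longrightarrow> f \<in> V \<Longrightarrow> evol t f \<in> W"
  and evol_lim: "t \<ge> 0 \<Longrightarrow> f \<in> V \<Longrightarrow> (\<lambda>k. nrm (euler k t f - evol t f)) \<longlonglongrightarrow> 0"
  using evol_spec(1) by auto

lemma evol_V [simp, intro]: "t \<ge> 0 \<Longrightarrow> f \<in> V \<Longrightarrow> evol t f \<in> V" by blast

lemma evol_eqI: "t \<ge> 0 \<Longrightarrow> f \<in> V \<Longrightarrow> w \<in> W \<Longrightarrow> (\<lambda>k. nrm (euler k t f - w)) \<longlonglongrightarrow> 0 \<Longrightarrow> evol t f = w"
  using evol_spec(2)[of t f w] by (auto simp: q_idem)

section \<open>Linearity, contractivity and symmetry of the limit\<close>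

lemma evol_add: assumes t: "t \<ge> 0" and f: "f \<in> V" and g: "g \<in> V" shows "evol t (f + g) = evol t f + evol t g"
proof (rule evol_eqI[OF t])
  show "(\<lambda>k. nrm (euler k t (f + g) - (evol t f + evol t g))) \<longlonglongrightarrow> 0"
  proof (rule tendsto_sandwich[OF _ _ tendsto_const])
    show "\<forall>\<^sub>F k in sequentially. nrm (euler k t (f + g) - (evol t f + evol t g)) \<le> nrm (euler k t f - evol t f) + nrm (euler k t g - evol t g)"
    proof (intro always_eventually allI)
      fix k
      show "nrm (euler k t (f + g) - (evol t f + evol t g)) \<le> nrm (euler k t f - evol t f) + nrm (euler k t g - evol t g)"
        using nrm_triangle[of "euler k t f - evol t f" "euler k t g - evol t g"] t f g euler_V[OF t, of _ k] by (simp add: euler_lin algebra_simps)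
    qed
    show "\<forall>\<^sub>F k in sequentially. 0 \<le> nrm (euler k t (f + g) - (evol t f + evol t g))" using t f g euler_V[OF t] by auto
    show "(\<lambda>k. nrm (euler k t f - evol t f) + nrm (euler k t g - evol t g)) \<longlonglongrightarrow> 0"
      using tendsto_add[OF evol_lim[OF t f] evol_lim[OF t g]] by simp
  qed
qed (use t f g in auto)

lemma evol_scl: assumes t: "t \<ge> 0" and f: "f \<in> V" shows "evol t (scl c f) = scl c (evol t f)"
proof (rule evol_eqI[OF t])
  have "nrm (euler k t (scl c f) - scl c (evol t f)) = cmod c * nrm (euler k t f - evol t f)" for k
    using nrm_scl[of "euler k t f - evol t f" c] euler_V[OF t f, of k] t f by (simp add: euler_lin scl.scale_right_diff_distrib)
  then show "(\<lambda>k. nrm (euler k t (scl c f) - scl c (evol t f))) \<longlonglongrightarrow> 0"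
    using tendsto_mult_left[OF evol_lim[OF t f], of "cmod c"] by simp
qed (use t f in auto)

lemma evol_diff: "t \<ge> 0 \<Longrightarrow> f \<in> V \<Longrightarrow> g \<in> V \<Longrightarrow> evol t (f - g) = evol t f - evol t g"
  using evol_add[of t f "scl (-1) g"] evol_scl[of t g "-1"] by simp

lemma evol_contr: assumes t: "t \<ge> 0" and f: "f \<in> V" shows "nrm (evol t f) \<le> nrm f"
  using tendsto_nrm[OF euler_V[OF t f] _ evol_lim[OF t f]] euler_contr[OF t f] evol_V[OF t f] by (intro LIMSEQ_le_const2) auto

lemma evol_cong: assumes t: "t \<ge> 0" and f: "f \<in> V" "g \<in> V" "nrm (f - g) = 0" shows "evol t f = evol t g"
  using evol_contr[OF t, of "f - g"] f t by (intro W_eqI) (auto simp: evol_diff intro: antisym)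

lemma evol_sym: assumes t: "t \<ge> 0" and f: "f \<in> V" and g: "g \<in> V" shows "ip H (evol t f) g = ip H f (evol t g)"
proof (rule LIMSEQ_unique)
  show "(\<lambda>k. ip H (euler k t f) g) \<longlonglongrightarrow> ip H (evol t f) g"
    using assms euler_V[OF t f] evol_lim[OF t f] by (intro tendsto_ip) auto
  show "(\<lambda>k. ip H (euler k t f) g) \<longlonglongrightarrow> ip H f (evol t g)"
    unfolding euler_sym[OF t f g] using assms euler_V[OF t g] evol_lim[OF t g] by (intro tendsto_ip) auto
qed

text \<open>The scheme with \<open>k = 0\<close> is one resolvent step, so the Cauchy estimate from
  index \<open>0\<close> passes to the limit. Being quadratic in \<open>t\<close>, the bound
  survives the division by \<open>t\<close> in the generator.\<close>

lemma evol_est: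
  assumes t: "t \<ge> 0" and f: "(f, f1) \<in> A" "(f1, f2) \<in> A"
  shows "nrm (resolvent t f - evol t f) \<le> t\<^sup>2 / 2 * nrm f2"
proof -
  note V = AD(1)[OF f(1)]
  have "(\<lambda>k. nrm (resolvent t f - euler k t f)) \<longlonglongrightarrow> nrm (resolvent t f - evol t f)"
  proof (rule tendsto_nrm)
    have "nrm (resolvent t f - euler k t f - (resolvent t f - evol t f)) = nrm (euler k t f - evol t f)" for k
      using nrm_minus[of "euler k t f - evol t f"] euler_V[OF t V, of k] t V by simp
    then show "(\<lambda>k. nrm (resolvent t f - euler k t f - (resolvent t f - evol t f))) \<longlonglongrightarrow> 0" using evol_lim[OF t V] by simp
  qed (use V t euler_V in auto)
  moreover have "nrm (resolvent t f - euler k t f) \<le> t\<^sup>2 / 2 * nrm f2" for k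
    using euler_cauchy'[OF t f, of 0 k] by (simp add: euler_def)
  ultimately show ?thesis by (meson LIMSEQ_le_const2)
qed

lemma evol_diff_est: assumes t: "t \<ge> 0" and f: "(f, f1) \<in> A" shows "nrm (f - evol t f) \<le> t * nrm f1"
proof -
  note V = AD(1)[OF f]
  have "(\<lambda>k. nrm (f - euler k t f)) \<longlonglongrightarrow> nrm (f - evol t f)"
  proof (rule tendsto_nrm)
    have "nrm (f - euler k t f - (f - evol t f)) = nrm (euler k t f - evol t f)" for k
      using nrm_minus[of "euler k t f - evol t f"] euler_V[OF t V, of k] t V by simp
    then show "(\<lambda>k. nrm (f - euler k t f - (f - evol t f))) \<longlonglongrightarrow> 0" using evol_lim[OF t V] by simp
  qed (use V t euler_V in auto)
  moreover have "nrm (f - euler k t f) \<le> t * nrm f1" for k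
  proof -
    \<comment> \<open>The identity is its own power, so the estimate for powers compares it with the
      scheme; \<open>2^k\<close> steps of length \<open>t / 2^k\<close> give a bound free of
      \<open>k\<close>.\<close>
    have "nrm (((\<lambda>f. f) ^^ (2 ^ k)) f - euler k t f) \<le> real (2 ^ k) * nrm (f - resolvent (t / 2 ^ k) f)"
      unfolding euler_def using t V by (intro power_diff_bound cmap_id cmap_resolvent) auto
    also have "\<dots> \<le> real (2 ^ k) * (t / 2 ^ k * nrm f1)"
      using resolvent_est[OF _ f, of "t / 2 ^ k"] t by (intro mult_left_mono) auto
    also have "\<dots> = t * nrm f1" by simp
    also have "((\<lambda>f. f) ^^ (2 ^ k)) f = f" by (simp flip: id_def)
    finally show ?thesis .
  qed
  ultimately show ?thesis by (meson LIMSEQ_le_const2)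
qed

lemma evol_zero: assumes f: "f \<in> V" shows "evol 0 f = q f"
proof (rule evol_eqI)
  have "(q ^^ Suc n) f = q f" for n using f by (induction n) (auto simp: q_idem)
  then have "(q ^^ (2 ^ k)) f = q f" for k by (metis Suc_pred zero_less_numeral zero_less_power)
  moreover have "resolvent 0 = q" by (simp add: fun_eq_iff)
  ultimately show "(\<lambda>k. nrm (euler k 0 f - q f)) \<longlonglongrightarrow> 0" by (simp add: euler_def)
qed (use f in auto)

text \<open>At each dyadic step \<open>resolvent_est2\<close> with \<open>a = t / 2^k\<close> and
  \<open>b = s / 2^k\<close> costs \<open>a b\<close> times the norm of \<open>A^2 u\<close>. The
  \<open>2^k\<close> steps sum to \<open>t s / 2^k\<close> times that norm, which tends to
  \<open>0\<close>. Density extends the identity from the domain of \<open>A^2\<close>.\<close>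

lemma evol_evol: assumes s: "s \<ge> 0" and t: "t \<ge> 0" and f: "f \<in> V" shows "evol t (evol s f) = evol (t + s) f"
proof (rule W_eqI)
  have ts: "t + s \<ge> 0" using s t by simp
  have main: "nrm (evol t (evol s u) - evol (t + s) u) = 0" if u: "(u, u1) \<in> A" "(u1, u2) \<in> A" for u u1 u2
  proof -
    note V = AD(1)[OF u(1)]
    have *: "nrm (euler k (t + s) u - euler k t (euler k s u)) \<le> t * s * nrm u2 * (1 / 2) ^ k" for k
    proof -
      define a b where "a = t / 2 ^ k" and "b = s / 2 ^ k"
      have ab: "a \<ge> 0" "b \<ge> 0" "a + b = (t + s) / 2 ^ k" using s t by (auto simp: a_def b_def add_divide_distrib)
      \<comment> \<open>Interleaving the commuting resolvents turns the product of the two schemes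
        into a power of one two-step map.\<close>
      have pow: "(resolvent a ^^ n) ((resolvent b ^^ n) u) = ((\<lambda>f. resolvent a (resolvent b f)) ^^ n) u" for n
      proof (induction n)
        case (Suc n)
        have "(resolvent a ^^ Suc n) ((resolvent b ^^ Suc n) u) = resolvent a ((resolvent a ^^ n) (resolvent b ((resolvent b ^^ n) u)))" by simp
        also have "(resolvent a ^^ n) (resolvent b ((resolvent b ^^ n) u)) = resolvent b ((resolvent a ^^ n) ((resolvent b ^^ n) u))"
          using funpow_commute_on[OF cmap_resolvent cmap_resolvent, of b a "(resolvent b ^^ n) u" n] ab V cmapD(1)[OF cmap_pow[OF cmap_resolvent]] resolvent_comm by simp
        finally show ?case using Suc by simp
      qed simp
      have comm: "resolvent (a + b) (resolvent a (resolvent b f)) = resolvent a (resolvent b (resolvent (a + b) f))" if "f \<in> V" for f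
        using resolvent_comm[OF add_nonneg_nonneg[OF ab(1,2)] ab(2) that] resolvent_comm[OF add_nonneg_nonneg[OF ab(1,2)] ab(1) resolvent_V[OF ab(2) that]]
        by (simp only:)
      have "nrm ((resolvent (a + b) ^^ (2 ^ k)) u - ((\<lambda>f. resolvent a (resolvent b f)) ^^ (2 ^ k)) u) \<le> real (2 ^ k) * nrm (resolvent (a + b) u - resolvent a (resolvent b u))"
        by (rule power_diff_bound[OF cmap_resolvent cmap_comp[OF cmap_resolvent cmap_resolvent] comm]) (use ab(1,2) V in simp_all)
      also have "\<dots> \<le> real (2 ^ k) * (a * b * nrm u2)" using resolvent_est2[OF ab(1,2) u] by (intro mult_left_mono) auto
      also have "\<dots> = t * s * nrm u2 * (1 / 2) ^ k" by (simp add: a_def b_def power_divide field_simps)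
      finally show ?thesis by (simp add: euler_def pow ab(3) flip: a_def b_def)
    qed
    have V': "euler k (t + s) u \<in> V" "euler k t (euler k s u) \<in> V" "euler k s u \<in> V" "euler k t (evol s u) \<in> V" "evol t (evol s u) \<in> V" "evol s u \<in> V" for k
      using euler_V V s t by auto
    have "(\<lambda>k. nrm (euler k (t + s) u - evol t (evol s u))) \<longlonglongrightarrow> 0"
    proof (rule tendsto_sandwich[OF _ _ tendsto_const])
      show "\<forall>\<^sub>F k in sequentially. nrm (euler k (t + s) u - evol t (evol s u)) \<le>
        t * s * nrm u2 * (1 / 2) ^ k + (nrm (euler k s u - evol s u) + nrm (euler k t (evol s u) - evol t (evol s u)))"
      proof (intro always_eventually allI)
        fix k
        have "nrm (euler k t (euler k s u) - evol t (evol s u)) \<le> nrm (euler k t (euler k s u) - euler k t (evol s u)) + nrm (euler k t (evol s u) - evol t (evol s u))"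
          using V' by (intro nrm_triangle3) auto
        moreover have "nrm (euler k t (euler k s u) - euler k t (evol s u)) \<le> nrm (euler k s u - evol s u)"
          using euler_contr[OF t, of "euler k s u - evol s u" k] V' by (simp add: euler_diff t)
        moreover have "nrm (euler k (t + s) u - evol t (evol s u)) \<le> nrm (euler k (t + s) u - euler k t (euler k s u)) + nrm (euler k t (euler k s u) - evol t (evol s u))"
          using V' by (intro nrm_triangle3) auto
        ultimately show "nrm (euler k (t + s) u - evol t (evol s u)) \<le>
          t * s * nrm u2 * (1 / 2) ^ k + (nrm (euler k s u - evol s u) + nrm (euler k t (evol s u) - evol t (evol s u)))" using *[of k] by linarith
      qed
      show "\<forall>\<^sub>F k in sequentially. 0 \<le> nrm (euler k (t + s) u - evol t (evol s u))" using V' by auto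
      have "(\<lambda>k. t * s * nrm u2 * (1 / 2) ^ k + (nrm (euler k s u - evol s u) + nrm (euler k t (evol s u) - evol t (evol s u)))) \<longlonglongrightarrow> t * s * nrm u2 * 0 + (0 + 0)"
        using evol_lim[OF s V] evol_lim[OF t V'(6)] by (intro tendsto_intros LIMSEQ_power_zero) auto
      then show "(\<lambda>k. t * s * nrm u2 * (1 / 2) ^ k + (nrm (euler k s u - evol s u) + nrm (euler k t (evol s u) - evol t (evol s u)))) \<longlonglongrightarrow> 0" by simp
    qed
    then have "evol (t + s) u = evol t (evol s u)" using V' V s t ts by (intro evol_eqI) auto
    then show ?thesis by simp
  qed
  have "nrm (evol t (evol s f) - evol (t + s) f) \<le> 0"
  proof (rule field_le_epsilon)
    fix e :: real assume e: "e > 0"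
    obtain u u1 u2 where u: "(u, u1) \<in> A" "(u1, u2) \<in> A" "nrm (f - u) < e / 2"
      using A2_dense[OF f, of "e / 2"] e by auto
    have uV: "u \<in> V" using AD(1)[OF u(1)] .
    have "evol t (evol s f) - evol (t + s) f - (evol t (evol s u) - evol (t + s) u) = evol t (evol s (f - u)) - evol (t + s) (f - u)"
      using f uV s t ts by (simp add: evol_diff)
    moreover have "nrm (evol t (evol s (f - u)) - evol (t + s) (f - u)) \<le> nrm (evol t (evol s (f - u))) + nrm (evol (t + s) (f - u))"
      using f uV s t ts by (intro nrm_triangle_diff) auto
    moreover have "nrm (evol t (evol s (f - u))) \<le> nrm (f - u)" "nrm (evol (t + s) (f - u)) \<le> nrm (f - u)"
      using evol_contr[OF t, of "evol s (f - u)"] evol_contr[OF s, of "f - u"] evol_contr[OF ts, of "f - u"] f uV s t by auto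
    moreover have "nrm (evol t (evol s f) - evol (t + s) f) = nrm (evol t (evol s f) - evol (t + s) f - (evol t (evol s u) - evol (t + s) u))"
      using main[OF u(1,2)] f uV s t ts by (intro nrm_cong) auto
    ultimately show "nrm (evol t (evol s f) - evol (t + s) f) \<le> 0 + e" using u(3) by simp
  qed
  then show "nrm (evol t (evol s f) - evol (t + s) f) = 0" using f s t by (intro antisym) auto
qed (use assms in auto)

text \<open>Comparing \<open>q h\<close> instead of \<open>h\<close> with \<open>evol t f\<close>
  closes the graph under changes of \<open>h\<close> by null vectors.\<close>

definition evol_op :: "real \<Rightarrow> 'a operator" where
  "evol_op t = {(f, h). f \<in> V \<and> h \<in> V \<and> q h = evol t f}"

lemma evol_op_T: "t \<ge> 0 \<Longrightarrow> f \<in> V \<Longrightarrow> (f, evol t f) \<in> evol_op t"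
  by (auto simp: evol_op_def q_idem)

lemma evol_op_contraction: assumes t: "t \<ge> 0" shows "contraction_op H (evol_op t)"
proof -
  have "is_operator H (evol_op t)"
  proof (rule is_operatorI)
    fix f f' h h' assume *: "(f, h) \<in> evol_op t" "f' \<in> V" "h' \<in> V" "nrm (f - f') = 0" "nrm (h - h') = 0"
    then show "(f', h') \<in> evol_op t" using evol_cong[OF t, of f f'] q_eqI[of h h'] by (auto simp: evol_op_def)
  next
    show "(0, 0) \<in> evol_op t" using evol_scl[OF t, of 0 0] q_scl[of 0 0] by (auto simp: evol_op_def)
  qed (use t in \<open>auto simp: evol_op_def evol_add q_add evol_scl q_scl q_eq_iff[symmetric]\<close>)
  moreover have "Domain (evol_op t) = V" using evol_op_T[OF t] by (auto simp: evol_op_def)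
  moreover have "nrm h \<le> nrm f" if "(f, h) \<in> evol_op t" for f h
    using that evol_contr[OF t, of f] nrm_q_eq[of h] by (auto simp: evol_op_def)
  ultimately show ?thesis by (auto simp: contraction_op_def)
qed

lemma nrm_evol_op_diff: "(f, h) \<in> evol_op t \<Longrightarrow> t \<ge> 0 \<Longrightarrow> nrm (h - evol t f) = 0"
  using q_eq_iff[of h "evol t f"] by (auto simp: evol_op_def q_idem)

lemma evol_continuous: assumes f: "f \<in> V" shows "((\<lambda>t. nrm (evol t f - f)) \<longlongrightarrow> 0) (at_right 0)"
proof (rule tendsto_at_right_zeroI)
  fix e :: real assume e: "e > 0"
  obtain u v where uv: "(u, v) \<in> A" "nrm (f - u) < e / 4" using A_dense[OF f, of "e / 4"] e by auto
  note V = AD(1,2)[OF uv(1)]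
  have vp: "nrm v + 1 > 0" using V by (simp add: add_nonneg_pos)
  define d where "d = e / (2 * (nrm v + 1))"
  have d: "d > 0" using e vp by (simp add: d_def)
  have "\<bar>nrm (evol t f - f)\<bar> < e" if h: "0 < t \<and> t < d" for t
  proof -
    have t: "t \<ge> 0" using h by simp
    have "t * nrm v \<le> d * (nrm v + 1)" using h V by (intro mult_mono) auto
    also have "\<dots> = e / 2" using vp by (simp add: d_def divide_simps)
    finally have 1: "nrm (u - evol t u) \<le> e / 2" using evol_diff_est[OF t uv(1)] by linarith
    have 2: "nrm (evol t f - evol t u) < e / 4"
      using evol_contr[of t "f - u"] t V f uv(2) by (simp add: evol_diff)
    have "nrm (evol t f - f) \<le> nrm (evol t f - evol t u) + nrm (evol t u - f)" using V f t by (intro nrm_triangle3) auto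
    also have "nrm (evol t u - f) \<le> nrm (evol t u - u) + nrm (u - f)" using V f t by (intro nrm_triangle3) auto
    finally show ?thesis using 1 2 uv(2) nrm_diff_commute[of u f] nrm_diff_commute[of u "evol t u"] V f t by simp
  qed
  then show "\<exists>d>0. \<forall>t. 0 < t \<and> t < d \<longrightarrow> \<bar>nrm (evol t f - f)\<bar> < e" using d by blast
qed

lemma evol_op_semigroup: "contraction_semigroup H evol_op"
proof -
  have "evol_op 0 = {(f, h). heq H f h}" by (auto simp: evol_op_def heq_q evol_zero)
  moreover have "evol_op (s + t) = evol_op t O evol_op s" if s: "s \<ge> 0" and t: "t \<ge> 0" for s t
  proof (intro set_eqI iffI)
    fix x assume "x \<in> evol_op (s + t)"
    then obtain f h where x: "x = (f, h)" "f \<in> V" "h \<in> V" "q h = evol (s + t) f" by (auto simp: evol_op_def)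
    have "(f, evol t f) \<in> evol_op t" using evol_op_T t x by auto
    moreover have "(evol t f, h) \<in> evol_op s" using x evol_evol[OF t s x(2)] t by (auto simp: evol_op_def)
    ultimately show "x \<in> evol_op t O evol_op s" unfolding x(1) by (rule relcompI)
  next
    fix x assume "x \<in> evol_op t O evol_op s"
    then obtain f g h where x: "x = (f, h)" "(f, g) \<in> evol_op t" "(g, h) \<in> evol_op s" by auto
    then have V: "f \<in> V" "g \<in> V" "h \<in> V" by (auto simp: evol_op_def)
    have "evol s g = evol s (evol t f)" using nrm_evol_op_diff[OF x(2) t] V t by (intro evol_cong[OF s]) auto
    then show "x \<in> evol_op (s + t)" using x V evol_evol[OF t s V(1)] by (auto simp: evol_op_def)
  qed
  moreover have "\<exists>u. (\<forall>t>0. (f, u t) \<in> evol_op t) \<and> ((\<lambda>t. hnorm H (\<lambda>i. u t i - f i)) \<longlongrightarrow> 0) (at_right 0)" if "f \<in> V" for f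
    using evol_continuous[OF that] evol_op_T that by (intro exI[of _ "\<lambda>t. evol t f"]) (auto simp: fun_diff_def)
  ultimately show ?thesis using evol_op_contraction unfolding contraction_semigroup_def by blast
qed

lemma generator_quotient:
  "(\<lambda>i. (f i - u i) / complex_of_real t - h i) = scl (complex_of_real (1 / t)) (f - u) - (h :: 'a \<Rightarrow> complex)"
  by (simp add: scl_def fun_eq_iff minus_apply)

text \<open>\<open>f\<close> is replaced by \<open>g = (1 + h A)^-1 f\<close>, which lies in the
  domain of \<open>A^2\<close> while \<open>A g\<close> stays close to \<open>A f\<close>. For
  \<open>g\<close> the difference quotient of the resolvent step is \<open>(1 + t A)^-1 A g\<close>
  modulo null vectors, and the semigroup differs from that step by order \<open>t^2\<close>.\<close>

lemma A_in_generator: assumes f: "(f, f1) \<in> A"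
  shows "((\<lambda>t. nrm (scl (complex_of_real (1 / t)) (f - evol t f) - f1)) \<longlongrightarrow> 0) (at_right 0)"
proof (rule tendsto_at_right_zeroI)
  fix e :: real assume e: "e > 0"
  note V = AD(1,2)[OF f]
  obtain d where d: "d > 0" "\<And>h. 0 < h \<and> h < d \<Longrightarrow> nrm (f1 - resolvent h f1) < e / 4" using resolvent_dense[OF V(2), of "e / 4"] e by auto
  define h where "h = d / 2"
  have h: "0 < h" "nrm (f1 - resolvent h f1) < e / 4" using d(1) d(2)[of h] by (auto simp: h_def)
  define g g1 g2 where "g = resolvent h f" and "g1 = resolvent h f1" and "g2 = scl (complex_of_real (1 / h)) (f1 - resolvent h f1)"
  have g: "(g, g1) \<in> A" "(g1, g2) \<in> A" using resolvent_A[OF _ f] resolvent_spec(1)[OF h(1) V(2)] h by (auto simp: g_def g1_def g2_def)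
  note gV = AD(1)[OF g(1)] AD(1,2)[OF g(2)]
  have gp: "nrm g2 + 1 > 0" using gV by (simp add: add_nonneg_pos)
  \<comment> \<open>For \<open>t < d'\<close> the quantity \<open>t * nrm g2\<close> stays below
    \<open>e / 4\<close>. It bounds the error of the resolvent step after division by
    \<open>t\<close> as well as the distance from \<open>resolvent t g1\<close> to
    \<open>g1\<close>.\<close>
  define d' where "d' = e / (4 * (nrm g2 + 1))"
  have d': "d' > 0" using e gp by (simp add: d'_def)
  have "\<bar>nrm (scl (complex_of_real (1 / t)) (f - evol t f) - f1)\<bar> < e" if "0 < t \<and> t < d'" for t
  proof -
    have t: "t \<ge> 0" "t > 0" "t < d'" using that by auto
    let ?s = "scl (complex_of_real (1 / t))"
    have J1: "nrm (?s (g - resolvent t g) - resolvent t g1) = 0"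
    proof -
      have "nrm (?s (g - (resolvent t g + scl (complex_of_real t) (resolvent t g1)))) = 0"
        using resolvent_residual[OF t(2) g(1)] gV t by (subst nrm_scl) auto
      then show ?thesis using t by (simp add: scl.scale_right_diff_distrib scl.scale_right_distrib algebra_simps)
    qed
    have 1: "nrm (?s ((f - g) - evol t (f - g))) \<le> e / 4"
    proof -
      have "nrm ((f - g) - evol t (f - g)) \<le> t * nrm (f1 - g1)" by (rule evol_diff_est[OF t(1) AD(8)[OF f g(1)]])
      also have "\<dots> \<le> t * (e / 4)" using h(2) t by (intro mult_left_mono) (auto simp: g1_def)
      finally show ?thesis using t V gV by (subst nrm_scl) (auto simp: norm_divide divide_simps mult.commute)
    qed
    have tg: "t * nrm g2 < e / 4"
    proof -
      have "t * nrm g2 \<le> t * (nrm g2 + 1)" using t by simp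
      also have "\<dots> < d' * (nrm g2 + 1)" using t gp by (intro mult_strict_right_mono) auto
      also have "\<dots> = e / 4" using gp by (simp add: d'_def divide_simps)
      finally show ?thesis .
    qed
    have 2: "nrm (?s (resolvent t g - evol t g)) < e / 4"
    proof -
      have "nrm (?s (resolvent t g - evol t g)) = nrm (resolvent t g - evol t g) / t" using t gV by (simp add: nrm_scl norm_divide)
      also have "\<dots> \<le> (t\<^sup>2 / 2 * nrm g2) / t" using evol_est[OF t(1) g] t by (intro divide_right_mono) auto
      also have "\<dots> = t * nrm g2 / 2" using t by (simp add: power2_eq_square)
      finally show ?thesis using tg e t gV mult_nonneg_nonneg[of t "nrm g2"] by simp
    qed
    have 3: "nrm (resolvent t g1 - g1) < e / 4"
      using resolvent_est[OF t(1) g(2)] tg nrm_diff_commute[of g1 "resolvent t g1"] t gV by simp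
    have 4: "nrm (g1 - f1) < e / 4" using h(2) nrm_diff_commute[of f1 g1] V gV by (simp add: g1_def)
    \<comment> \<open>The summands are, in order: a null vector, the cost of replacing
      \<open>f\<close> by \<open>g\<close>, the error of one resolvent step, and the moves from
      \<open>resolvent t g1\<close> to \<open>g1\<close> and from \<open>g1\<close> to
      \<open>f1\<close>.\<close>
    have eq: "?s (f - evol t f) - f1 = (?s (g - resolvent t g) - resolvent t g1) + (?s ((f - g) - evol t (f - g)) + (?s (resolvent t g - evol t g) + ((resolvent t g1 - g1) + (g1 - f1))))"
      using t V gV by (simp add: evol_diff scl.scale_right_diff_distrib)
    have "nrm (?s (f - evol t f) - f1) \<le> nrm (?s (g - resolvent t g) - resolvent t g1) + (nrm (?s ((f - g) - evol t (f - g))) + (nrm (?s (resolvent t g - evol t g)) + (nrm (resolvent t g1 - g1) + nrm (g1 - f1))))"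
      unfolding eq using t V gV by (intro order_trans[OF nrm_triangle add_left_mono]) auto
    then show ?thesis using J1 1 2 3 4 nrm_nonneg[of "?s (f - evol t f) - f1"] t V by simp
  qed
  then show "\<exists>d>0. \<forall>t. 0 < t \<and> t < d \<longrightarrow> \<bar>nrm (scl (complex_of_real (1 / t)) (f - evol t f) - f1)\<bar> < e" using d' by blast
qed

lemma evol_op_generator: "generator H evol_op = A"
proof (intro set_eqI iffI)
  fix x assume "x \<in> A"
  then obtain f f1 where x: "x = (f, f1)" "(f, f1) \<in> A" by (metis surj_pair)
  have "\<forall>t>0. (f, evol t f) \<in> evol_op t" using evol_op_T AD(1)[OF x(2)] by auto
  then show "x \<in> generator H evol_op"
    using A_in_generator[OF x(2)] AD(1,2)[OF x(2)] by (auto simp: generator_def x(1) generator_quotient intro!: exI[of _ "\<lambda>t. evol t f"])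
next
  fix x assume "x \<in> generator H evol_op"
  then obtain f h u where x: "x = (f, h)" "f \<in> V" "h \<in> V" "\<forall>t>0. (f, u t) \<in> evol_op t"
    "((\<lambda>t. nrm (scl (complex_of_real (1 / t)) (f - u t) - h)) \<longlongrightarrow> 0) (at_right 0)"
    by (auto simp: generator_def generator_quotient)
  have "(f, h) \<in> A"
  proof (rule A_adjI[OF x(2,3)])
    \<comment> \<open>the generator is symmetric to \<open>A\<close>, hence contained in the adjoint of \<open>A\<close>\<close>
    fix g g1 assume g: "(g, g1) \<in> A"
    note V = AD(1,2)[OF g]
    define t where "t n = 1 / real (Suc n)" for n
    have t: "t n > 0" "t n \<ge> 0" for n by (auto simp: t_def)
    have tl: "filterlim t (at_right 0) sequentially"
      unfolding filterlim_at using LIMSEQ_inverse_real_of_nat t(1) by (auto simp: t_def[abs_def] inverse_eq_divide)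
    have uV: "u (t n) \<in> V" for n using x(4) t by (auto simp: evol_op_def)
    have l1: "(\<lambda>n. nrm (scl (complex_of_real (1 / t n)) (f - u (t n)) - h)) \<longlonglongrightarrow> 0"
      using filterlim_compose[OF x(5) tl] .
    have l2: "(\<lambda>n. nrm (scl (complex_of_real (1 / t n)) (g - evol (t n) g) - g1)) \<longlonglongrightarrow> 0"
      using filterlim_compose[OF A_in_generator[OF g] tl] .
    have L1: "(\<lambda>n. ip H g (scl (complex_of_real (1 / t n)) (f - u (t n)))) \<longlonglongrightarrow> ip H g h"
      using x V uV l1 by (intro tendsto_ip) auto
    have L2: "(\<lambda>n. ip H (scl (complex_of_real (1 / t n)) (g - evol (t n) g)) f) \<longlonglongrightarrow> ip H g1 f"
      using x V t l2 by (intro tendsto_ip) auto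
    have "ip H (scl (complex_of_real (1 / t n)) (g - evol (t n) g)) f = ip H g (scl (complex_of_real (1 / t n)) (f - u (t n)))" for n
    proof -
      have "ip H (evol (t n) g) f = ip H g (evol (t n) f)" using evol_sym t V x by auto
      also have "\<dots> = ip H g (u (t n))"
        using nrm_evol_op_diff[of f "u (t n)" "t n"] x t V uV by (intro ip_cong_right[symmetric]) auto
      finally show ?thesis using t V x uV by (simp add: ip_simps)
    qed
    then show "ip H g1 f = ip H g h" using LIMSEQ_unique[OF L1] L2 by simp
  qed
  then show "x \<in> A" using x by simp
qed

theorem hille_yosida: "\<exists>T. contraction_semigroup H T \<and> generator H T = A"
  using evol_op_semigroup evol_op_generator by blast

end

section \<open>The space of square integrable functions\<close>

lemma L2_vecs: "f \<in> vecs (L2 M) \<longleftrightarrow> f \<in> borel_measurable M \<and> integrable M (\<lambda>x. (norm (f x))\<^sup>2)"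
  by (simp add: L2_def)

lemma L2_ip: "ip (L2 M) f g = (\<integral>x. f x * cnj (g x) \<partial>M)"
  by (simp add: L2_def)

lemma L2_vecsI_nn:
  assumes "f \<in> borel_measurable M" "(\<integral>\<^sup>+x. ennreal ((norm (f x))\<^sup>2) \<partial>M) < \<infinity>"
  shows "f \<in> vecs (L2 M)"
  unfolding L2_vecs using assms by (auto intro!: integrableI_bounded)

lemma borel_measurable_cnj [measurable (raw)]:
  "f \<in> borel_measurable M \<Longrightarrow> (\<lambda>x. cnj (f x)) \<in> borel_measurable M"
  by (rule borel_measurable_continuous_on[where f = cnj]) (auto intro: continuous_intros)

lemma L2_integrable_ip:
  assumes f: "f \<in> vecs (L2 M)" and g: "g \<in> vecs (L2 M)"
  shows "integrable M (\<lambda>x. f x * cnj (g x))"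
proof (rule Bochner_Integration.integrable_bound)
  show "integrable M (\<lambda>x. (norm (f x))\<^sup>2 + (norm (g x))\<^sup>2)" using f g by (simp add: L2_vecs)
  have [measurable]: "f \<in> borel_measurable M" "g \<in> borel_measurable M" using f g by (simp_all add: L2_vecs)
  show "(\<lambda>x. f x * cnj (g x)) \<in> borel_measurable M" by measurable
  have "norm (f x * cnj (g x)) \<le> norm ((norm (f x))\<^sup>2 + (norm (g x))\<^sup>2)" for x
  proof -
    have "2 * norm (f x) * norm (g x) \<le> (norm (f x))\<^sup>2 + (norm (g x))\<^sup>2" by (rule sum_squares_bound)
    moreover have "0 \<le> norm (f x) * norm (g x)" by simp
    moreover have "norm (f x * cnj (g x)) = norm (f x) * norm (g x)" by (simp add: norm_mult)
    ultimately have "norm (f x * cnj (g x)) \<le> (norm (f x))\<^sup>2 + (norm (g x))\<^sup>2" by linarith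
    then show ?thesis by simp
  qed
  then show "AE x in M. norm (f x * cnj (g x)) \<le> norm ((norm (f x))\<^sup>2 + (norm (g x))\<^sup>2)" by simp
qed

lemma norm_add_sq_le: "(norm (a + b :: complex))\<^sup>2 \<le> 2 * (norm a)\<^sup>2 + 2 * (norm b)\<^sup>2"
proof -
  have "(norm (a + b))\<^sup>2 \<le> (norm a + norm b)\<^sup>2" by (intro power_mono norm_triangle_ineq) simp
  also have "\<dots> \<le> 2 * (norm a)\<^sup>2 + 2 * (norm b)\<^sup>2"
    using sum_squares_bound[of "norm a" "norm b"] by (simp add: power2_sum)
  finally show ?thesis .
qed

lemma L2_nrm_sq: "f \<in> vecs (L2 M) \<Longrightarrow> (hnorm (L2 M) f)\<^sup>2 = (\<integral>x. (norm (f x))\<^sup>2 \<partial>M)"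
proof -
  have "(\<integral>x. f x * cnj (f x) \<partial>M) = complex_of_real (\<integral>x. (norm (f x))\<^sup>2 \<partial>M)"
    by (simp add: complex_norm_square[symmetric] del: of_real_power flip: integral_complex_of_real)
  then show ?thesis by (simp add: hnorm_def L2_ip)
qed

lemma L2_nrm_nn: "f \<in> vecs (L2 M) \<Longrightarrow> ennreal ((hnorm (L2 M) f)\<^sup>2) = (\<integral>\<^sup>+x. ennreal ((norm (f x))\<^sup>2) \<partial>M)"
  by (subst nn_integral_eq_integral) (auto simp: L2_nrm_sq L2_vecs)

lemma semi_inner_L2: "semi_inner (L2 M)"
proof
  show "0 \<in> vecs (L2 M)" by (simp add: L2_vecs zero_fun_def)
  fix f g :: "'a \<Rightarrow> complex" and c assume f: "f \<in> vecs (L2 M)"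
  show "scl c f \<in> vecs (L2 M)" using f unfolding L2_vecs scl_def by (auto simp: norm_mult power_mult_distrib intro!: borel_measurable_times)
  have "(\<integral>x. f x * cnj (f x) \<partial>M) = complex_of_real (\<integral>x. (norm (f x))\<^sup>2 \<partial>M)"
    by (simp add: complex_norm_square[symmetric] del: of_real_power flip: integral_complex_of_real)
  then show "0 \<le> Re (ip (L2 M) f f)" by (simp add: L2_ip)
  assume g: "g \<in> vecs (L2 M)"
  have "integrable M (\<lambda>x. (norm (f x + g x))\<^sup>2)"
  proof (rule Bochner_Integration.integrable_bound)
    show "integrable M (\<lambda>x. 2 * (norm (f x))\<^sup>2 + 2 * (norm (g x))\<^sup>2)" using f g by (simp add: L2_vecs)
    have [measurable]: "f \<in> borel_measurable M" "g \<in> borel_measurable M" using f g by (simp_all add: L2_vecs)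
    show "(\<lambda>x. (norm (f x + g x))\<^sup>2) \<in> borel_measurable M" by measurable
  qed (use norm_add_sq_le in auto)
  then show "f + g \<in> vecs (L2 M)" using f g unfolding L2_vecs plus_fun_def by (auto intro: borel_measurable_add)
  show "ip (L2 M) (scl c f) g = c * ip (L2 M) f g" by (simp add: L2_ip scl_def mult.assoc)
  show "ip (L2 M) g f = cnj (ip (L2 M) f g)"
    unfolding L2_ip by (subst Bochner_Integration.integral_cnj[symmetric]) (simp add: mult.commute)
  fix h assume h: "h \<in> vecs (L2 M)"
  show "ip (L2 M) (f + g) h = ip (L2 M) f h + ip (L2 M) g h"
    using L2_integrable_ip[OF f h] L2_integrable_ip[OF g h] by (simp add: L2_ip plus_fun_apply distrib_right)
qed

lemma L2_null_iff: "f \<in> vecs (L2 M) \<Longrightarrow> hnorm (L2 M) f = 0 \<longleftrightarrow> (AE x in M. f x = 0)"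
proof -
  assume f: "f \<in> vecs (L2 M)"
  have "hnorm (L2 M) f = 0 \<longleftrightarrow> (hnorm (L2 M) f)\<^sup>2 = 0" by simp
  also have "\<dots> \<longleftrightarrow> (AE x in M. f x = 0)"
    using f by (subst L2_nrm_sq[OF f], subst integral_nonneg_eq_0_iff_AE) (auto simp: L2_vecs)
  finally show ?thesis .
qed

text \<open>
  The limit is stated as a pointwise one, since pointwise limits visibly preserve the symmetry
  required of the vectors of the Fock space.
\<close>

lemma (in sigma_finite_measure) L2_complete:
  fixes F :: "nat \<Rightarrow> 'a \<Rightarrow> complex"
  assumes F: "\<And>k. F k \<in> vecs (L2 M)"
    and C: "\<And>e. e > 0 \<Longrightarrow> \<exists>N. \<forall>m\<ge>N. \<forall>n\<ge>N. hnorm (L2 M) (F m - F n) < e"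
  shows "\<exists>k. (\<lambda>x. lim (\<lambda>i. F (k i) x)) \<in> vecs (L2 M) \<and>
    (\<lambda>n. hnorm (L2 M) (F n - (\<lambda>x. lim (\<lambda>i. F (k i) x)))) \<longlonglongrightarrow> 0"
proof -
  interpret semi_inner "L2 M" by (rule semi_inner_L2)
  show ?thesis
  proof -
    have Fm [measurable]: "F k \<in> borel_measurable M" for k using F by (simp add: L2_vecs)
    \<comment> \<open>A strictly positive integrable \<open>p\<close> exists by sigma-finiteness.
      Its square root serves as the weight \<open>r\<close>, and being nonzero everywhere it can be
      divided out again.\<close>
    obtain p where p [measurable]: "p \<in> borel_measurable M" and p0: "\<And>x. p x > (0::real)" and pi: "integrable M p"
    proof (rule obtain_positive_integrable_function)
      fix f :: "'a \<Rightarrow> real"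
      assume "f \<in> borel_measurable M" "\<And>x. 0 < f x" "integrable M f"
      then show thesis by (rule that)
    qed
    define r where "r x = complex_of_real (sqrt (p x))" for x
    have r0: "r x \<noteq> 0" for x using p0[of x] by (simp add: r_def)
    have cr: "cnj (r x) = r x" for x by (simp add: r_def)
    have r: "r \<in> vecs (L2 M)" using pi p0 by (auto simp: L2_vecs r_def[abs_def] less_imp_le)
    define s where "s n x = F n x * r x" for n x
    have si: "integrable M (s n)" for n
      using L2_integrable_ip[OF F[of n] r] by (simp add: s_def[abs_def] cr)
    \<comment> \<open>multiplied by a positive square integrable weight, the sequence is Cauchy in \<open>L\<^sup>1\<close>\<close>
    have "\<exists>N. \<forall>i\<ge>N. \<forall>j\<ge>N. (LINT x|M. norm (s i x - s j x)) < e" if e: "e > 0" for e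
    proof -
      have rp: "nrm r + 1 > 0" using nrm_nonneg[OF r] by linarith
      obtain N where N: "\<forall>m\<ge>N. \<forall>n\<ge>N. nrm (F m - F n) < e / (nrm r + 1)" using C[of "e / (nrm r + 1)"] e rp by auto
      have "(LINT x|M. norm (s i x - s j x)) < e" if ij: "i \<ge> N" "j \<ge> N" for i j
      proof -
        \<comment> \<open>The absolute value turns the weighted distance into an inner product with
          \<open>r\<close>, to which Cauchy-Schwarz applies.\<close>
        define h where "h x = complex_of_real (norm (F i x - F j x))" for x
        have d: "F i - F j \<in> vecs (L2 M)" using F by auto
        have h: "h \<in> vecs (L2 M)" using d by (auto simp: L2_vecs h_def[abs_def] fun_diff_def)
        have hn: "nrm h = nrm (F i - F j)"
        proof -
          have "(nrm h)\<^sup>2 = (nrm (F i - F j))\<^sup>2"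
            unfolding L2_nrm_sq[OF h] L2_nrm_sq[OF d] by (simp add: h_def minus_apply)
          then show ?thesis using nrm_nonneg[OF h] nrm_nonneg[OF d] by (simp add: power2_eq_iff_nonneg)
        qed
        have "(LINT x|M. norm (s i x - s j x)) = Re (ip (L2 M) h r)"
        proof -
          have "ip (L2 M) h r = (LINT x|M. complex_of_real (norm (s i x - s j x)))"
            unfolding L2_ip
          proof (intro Bochner_Integration.integral_cong refl)
            fix x
            have "norm (r x) = sqrt (p x)" using p0[of x] by (simp add: r_def)
            then have "complex_of_real (norm (s i x - s j x)) = h x * complex_of_real (sqrt (p x))"
              by (simp add: s_def h_def norm_mult flip: left_diff_distrib)
            then show "h x * cnj (r x) = complex_of_real (norm (s i x - s j x))" by (simp add: r_def)
          qed
          then show ?thesis by simp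
        qed
        also have "\<dots> \<le> nrm h * nrm r" by (rule Re_ip_le[OF h r])
        also have "\<dots> \<le> e / (nrm r + 1) * nrm r"
          unfolding hn using N ij nrm_nonneg[OF r] by (intro mult_right_mono) (auto intro: less_imp_le)
        also have "\<dots> < e" using rp e by (simp add: field_simps)
        finally show ?thesis .
      qed
      then show ?thesis by blast
    qed
    then obtain k where k: "strict_mono k" "AE x in M. Cauchy (\<lambda>i. s (k i) x)"
      using cauchy_L1_AE_cauchy_subseq[of M s, OF si] by blast
    define f where "f x = lim (\<lambda>i. F (k i) x)" for x
    have fm [measurable]: "f \<in> borel_measurable M" unfolding f_def by (rule borel_measurable_lim_metric) simp
    have fl: "AE x in M. (\<lambda>i. F (k i) x) \<longlonglongrightarrow> f x"
      using k(2)
    proof eventually_elim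
      case (elim x)
      then obtain l where l: "(\<lambda>i. s (k i) x) \<longlonglongrightarrow> l" using Cauchy_convergent convergent_def by blast
      have "(\<lambda>i. s (k i) x / r x) \<longlonglongrightarrow> l / r x" using l r0 by (intro tendsto_intros) auto
      then have "convergent (\<lambda>i. F (k i) x)" using r0 by (auto simp: s_def convergent_def)
      then show ?case by (simp add: f_def convergent_LIMSEQ_iff)
    qed
    \<comment> \<open>Fatou's lemma along the subsequence carries the Cauchy bound to the pointwise
      limit. The index \<open>N\<close> still serves because \<open>k i\<close> is at least
      \<open>i\<close>.\<close>
    have key: "(\<integral>\<^sup>+x. ennreal ((norm ((f - F n) x))\<^sup>2) \<partial>M) \<le> ennreal (e\<^sup>2)"
      if N: "\<forall>m\<ge>N. \<forall>n\<ge>N. nrm (F m - F n) < e" and n: "n \<ge> N" and e: "e > 0" for N n e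
    proof -
      have "(\<integral>\<^sup>+x. ennreal ((norm ((f - F n) x))\<^sup>2) \<partial>M) = (\<integral>\<^sup>+x. liminf (\<lambda>i. ennreal ((norm ((F (k i) - F n) x))\<^sup>2)) \<partial>M)"
      proof (rule nn_integral_cong_AE)
        show "AE x in M. ennreal ((norm ((f - F n) x))\<^sup>2) = liminf (\<lambda>i. ennreal ((norm ((F (k i) - F n) x))\<^sup>2))"
          using fl
        proof eventually_elim
          case (elim x)
          then have "(\<lambda>i. ennreal ((norm ((F (k i) - F n) x))\<^sup>2)) \<longlonglongrightarrow> ennreal ((norm ((f - F n) x))\<^sup>2)"
            unfolding minus_apply by (intro tendsto_intros)
          then show ?case using lim_imp_Liminf[OF sequentially_bot] by force
        qed
      qed
      also have "\<dots> \<le> liminf (\<lambda>i. \<integral>\<^sup>+x. ennreal ((norm ((F (k i) - F n) x))\<^sup>2) \<partial>M)"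
        by (rule nn_integral_liminf) (simp add: minus_apply)
      also have "\<dots> = liminf (\<lambda>i. ennreal ((nrm (F (k i) - F n))\<^sup>2))"
        using F by (simp add: L2_nrm_nn)
      also have "\<dots> \<le> limsup (\<lambda>i. ennreal ((nrm (F (k i) - F n))\<^sup>2))" by (rule Liminf_le_Limsup) simp
      also have "\<dots> \<le> ennreal (e\<^sup>2)"
      proof (rule Limsup_bounded)
        show "\<forall>\<^sub>F i in sequentially. ennreal ((nrm (F (k i) - F n))\<^sup>2) \<le> ennreal (e\<^sup>2)"
          unfolding eventually_sequentially
        proof (intro exI allI impI)
          fix i assume "i \<ge> N"
          then have "k i \<ge> N" using seq_suble[OF k(1), of i] by simp
          then have "nrm (F (k i) - F n) < e" using N n by blast
          then show "ennreal ((nrm (F (k i) - F n))\<^sup>2) \<le> ennreal (e\<^sup>2)"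
            using F nrm_nonneg[of "F (k i) - F n"] by (intro ennreal_leI power_mono) auto
        qed
      qed
      finally show ?thesis .
    qed
    have fV: "f \<in> vecs (L2 M)"
    proof -
      obtain N where N: "\<forall>m\<ge>N. \<forall>n\<ge>N. nrm (F m - F n) < 1" using C[of 1] by auto
      have "f - F N \<in> vecs (L2 M)"
        using key[OF N, of N] by (intro L2_vecsI_nn) (auto simp: fun_diff_def intro: le_less_trans)
      then have "(f - F N) + F N \<in> vecs (L2 M)" using F by (intro add) auto
      then show ?thesis by simp
    qed
    have "(\<lambda>k. nrm (F k - f)) \<longlonglongrightarrow> 0"
    proof (rule LIMSEQ_I)
      fix e :: real assume e: "e > 0"
      then obtain N where N: "\<forall>m\<ge>N. \<forall>n\<ge>N. nrm (F m - F n) < e / 2" using C[of "e / 2"] by auto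
      have "norm (nrm (F n - f) - 0) < e" if "n \<ge> N" for n
      proof -
        have d: "f - F n \<in> vecs (L2 M)" using fV F by auto
        have "ennreal ((nrm (f - F n))\<^sup>2) \<le> ennreal ((e / 2)\<^sup>2)"
          using key[OF N that] e by (simp add: L2_nrm_nn[OF d])
        then have "(nrm (f - F n))\<^sup>2 \<le> (e / 2)\<^sup>2" using e by (simp add: ennreal_le_iff)
        then have "nrm (f - F n) \<le> e / 2" using e by (rule power2_le_imp_le[OF _ less_imp_le[OF half_gt_zero]])
        then show ?thesis using nrm_diff_commute[OF fV F[of n]] nrm_nonneg[OF d] e by simp
      qed
      then show "\<exists>no. \<forall>n\<ge>no. norm (nrm (F n - f) - 0) < e" by (intro exI[of _ N]) simp
    qed
    then show ?thesis using fV unfolding f_def by blast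
  qed
qed

lemma (in sigma_finite_measure) hilbert_L2: "hilbert (L2 M)"
proof -
  interpret semi_inner "L2 M" by (rule semi_inner_L2)
  show ?thesis by standard (use L2_complete in blast)
qed

section \<open>The Fock space\<close>

definition sector :: "(nat \<times> (nat \<Rightarrow> 'm) \<Rightarrow> complex) \<Rightarrow> nat \<Rightarrow> (nat \<Rightarrow> 'm) \<Rightarrow> complex" where
  "sector g n = (\<lambda>x. g (n, x))"

lemma sector_simps:
  "sector (g + h) n = sector g n + sector h n" "sector (g - h) n = sector g n - sector h n"
  "sector (scl c g) n = scl c (sector g n)" "sector 0 n = 0"
  by (auto simp: sector_def fun_eq_iff plus_fun_apply minus_apply scl_def zero_fun_apply)

lemma sector_sum: "sector (sum F I) n = (\<Sum>k\<in>I. sector (F k) n)"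
  by (induction I rule: infinite_finite_induct) (auto simp: sector_simps)

lemma Re_fact_mult: "Re (fact n * z) = fact n * Re z"
proof -
  have "(fact n :: complex) = complex_of_real (fact n)" by simp
  then show ?thesis by (simp del: of_real_fact)
qed

locale fock_space = sigma_finite_measure \<mu> for \<mu> :: "'m measure"
begin

abbreviation "LL n \<equiv> L2 (PiM {..<n} (\<lambda>_::nat. \<mu>))"

sublocale P: product_sigma_finite "\<lambda>_::nat. \<mu>" ..

lemma sigma_finite_P: "sigma_finite_measure (PiM {..<n} (\<lambda>_::nat. \<mu>))"
  by (rule P.sigma_finite) simp

sublocale L: hilbert "LL n" for n
  by (rule sigma_finite_measure.hilbert_L2[OF sigma_finite_P])

definition perm_inv :: "(nat \<times> (nat \<Rightarrow> 'm) \<Rightarrow> complex) \<Rightarrow> nat \<Rightarrow> bool" where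
  "perm_inv g n \<longleftrightarrow> (AE x in PiM {..<n} (\<lambda>_. \<mu>). \<forall>\<sigma>. \<sigma> permutes {..<n} \<longrightarrow> g (n, x \<circ> \<sigma>) = g (n, x))"

lemma fock_vecs: "g \<in> vecs (fock \<mu>) \<longleftrightarrow> (\<forall>n. sector g n \<in> vecs (LL n)) \<and> (\<forall>n. perm_inv g n) \<and>
    summable (\<lambda>n. fact n * (hnorm (LL n) (sector g n))\<^sup>2)"
  by (simp add: fock_def perm_inv_def sector_def)

lemma fock_ip: "ip (fock \<mu>) g h = (\<Sum>n. fact n * ip (LL n) (sector g n) (sector h n))"
  by (simp add: fock_def sector_def)

lemma perm_inv_add: assumes "perm_inv g n" "perm_inv h n" shows "perm_inv (g + h) n"
  using assms unfolding perm_inv_def by eventually_elim (simp add: plus_fun_apply)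

lemma perm_inv_scl: assumes "perm_inv g n" shows "perm_inv (scl c g) n"
  using assms unfolding perm_inv_def by eventually_elim (simp add: scl_def)

lemma sector_mem [simp, intro]: "g \<in> vecs (fock \<mu>) \<Longrightarrow> sector g n \<in> vecs (LL n)"
  by (simp add: fock_vecs)

lemma fock_summable_norm: "g \<in> vecs (fock \<mu>) \<Longrightarrow> summable (\<lambda>n. fact n * (hnorm (LL n) (sector g n))\<^sup>2)"
  by (simp add: fock_vecs)

lemma fock_summable_ip:
  assumes g: "g \<in> vecs (fock \<mu>)" and h: "h \<in> vecs (fock \<mu>)"
  shows "summable (\<lambda>n. fact n * ip (LL n) (sector g n) (sector h n))"
proof (rule summable_comparison_test')
  show "summable (\<lambda>n. fact n * (hnorm (LL n) (sector g n))\<^sup>2 + fact n * (hnorm (LL n) (sector h n))\<^sup>2)"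
    by (intro summable_add fock_summable_norm g h)
  fix n
  have "norm (fact n * ip (LL n) (sector g n) (sector h n)) \<le> fact n * (hnorm (LL n) (sector g n) * hnorm (LL n) (sector h n))"
    using L.cauchy_schwarz[of "sector g n" n "sector h n"] g h by (simp add: norm_mult)
  also have "\<dots> \<le> fact n * ((hnorm (LL n) (sector g n))\<^sup>2 + (hnorm (LL n) (sector h n))\<^sup>2)"
  proof (rule mult_left_mono)
    have "0 \<le> hnorm (LL n) (sector g n) * hnorm (LL n) (sector h n)" using g h by (intro mult_nonneg_nonneg) auto
    then show "hnorm (LL n) (sector g n) * hnorm (LL n) (sector h n) \<le> (hnorm (LL n) (sector g n))\<^sup>2 + (hnorm (LL n) (sector h n))\<^sup>2"
      using sum_squares_bound[of "hnorm (LL n) (sector g n)" "hnorm (LL n) (sector h n)"] by linarith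
  qed simp
  finally show "norm (fact n * ip (LL n) (sector g n) (sector h n)) \<le>
    fact n * (hnorm (LL n) (sector g n))\<^sup>2 + fact n * (hnorm (LL n) (sector h n))\<^sup>2" by (simp add: distrib_left)
qed

lemma fock_semi_inner: "semi_inner (fock \<mu>)"
proof
  show "0 \<in> vecs (fock \<mu>)" by (simp add: fock_vecs sector_simps perm_inv_def zero_fun_apply)
  fix g h :: "nat \<times> (nat \<Rightarrow> 'm) \<Rightarrow> complex" and c assume g: "g \<in> vecs (fock \<mu>)"
  have "summable (\<lambda>n. (cmod c)\<^sup>2 * (fact n * (hnorm (LL n) (sector g n))\<^sup>2))"
    by (intro summable_mult fock_summable_norm g)
  then show "scl c g \<in> vecs (fock \<mu>)"
    using g by (simp add: fock_vecs sector_simps perm_inv_scl L.nrm_scl power_mult_distrib mult.left_commute)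
  have "Re (fact n * ip (LL n) (sector g n) (sector g n)) = fact n * (hnorm (LL n) (sector g n))\<^sup>2" for n
    using L.nrm_sq[of "sector g n" n] g by (simp add: Re_fact_mult)
  then have "Re (ip (fock \<mu>) g g) = (\<Sum>n. fact n * (hnorm (LL n) (sector g n))\<^sup>2)"
    unfolding fock_ip using Re_suminf[OF fock_summable_ip[OF g g]] by simp
  then show "0 \<le> Re (ip (fock \<mu>) g g)"
    using suminf_nonneg[OF fock_summable_norm[OF g]] by simp
  assume h: "h \<in> vecs (fock \<mu>)"
  have "summable (\<lambda>n. 2 * (fact n * (hnorm (LL n) (sector g n))\<^sup>2) + 2 * (fact n * (hnorm (LL n) (sector h n))\<^sup>2))"
    by (intro summable_mult summable_add fock_summable_norm g h)
  moreover have "norm (fact n * (hnorm (LL n) (sector (g + h) n))\<^sup>2) \<le>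
      2 * (fact n * (hnorm (LL n) (sector g n))\<^sup>2) + 2 * (fact n * (hnorm (LL n) (sector h n))\<^sup>2)" for n
  proof -
    let ?a = "hnorm (LL n) (sector g n)" and ?b = "hnorm (LL n) (sector h n)"
    have "(hnorm (LL n) (sector (g + h) n))\<^sup>2 \<le> (?a + ?b)\<^sup>2"
      unfolding sector_simps using g h by (intro power_mono L.nrm_triangle) auto
    also have "\<dots> \<le> 2 * ?a\<^sup>2 + 2 * ?b\<^sup>2" using sum_squares_bound[of ?a ?b] by (simp add: power2_sum)
    finally have "fact n * (hnorm (LL n) (sector (g + h) n))\<^sup>2 \<le> fact n * (2 * ?a\<^sup>2 + 2 * ?b\<^sup>2)" by (intro mult_left_mono) auto
    then show ?thesis by (simp add: algebra_simps)
  qed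
  ultimately have "summable (\<lambda>n. fact n * (hnorm (LL n) (sector (g + h) n))\<^sup>2)"
    by (rule summable_comparison_test')
  then show "g + h \<in> vecs (fock \<mu>)" using g h unfolding fock_vecs by (auto simp: sector_simps perm_inv_add)
  show "ip (fock \<mu>) (scl c g) h = c * ip (fock \<mu>) g h"
    unfolding fock_ip using suminf_mult[OF fock_summable_ip[OF g h], of c] g h
    by (simp add: sector_simps L.ip_scl_left mult.left_commute)
  show "ip (fock \<mu>) h g = cnj (ip (fock \<mu>) g h)"
  proof -
    have "(\<lambda>n. cnj (fact n * ip (LL n) (sector g n) (sector h n))) sums cnj (ip (fock \<mu>) g h)"
      unfolding fock_ip by (subst sums_cnj) (rule summable_sums[OF fock_summable_ip[OF g h]])
    moreover have "cnj (fact n * ip (LL n) (sector g n) (sector h n)) = fact n * ip (LL n) (sector h n) (sector g n)" for n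
      using L.ip_cnj[of "sector g n" n "sector h n"] g h by simp
    ultimately show ?thesis by (simp add: fock_ip sums_iff)
  qed
  fix k assume k: "k \<in> vecs (fock \<mu>)"
  show "ip (fock \<mu>) (g + h) k = ip (fock \<mu>) g k + ip (fock \<mu>) h k"
    unfolding fock_ip using g h k
    by (subst suminf_add[OF fock_summable_ip[OF g k] fock_summable_ip[OF h k]])
      (simp add: sector_simps L.ip_add_left distrib_left)
qed

lemma fock_nrm_sq:
  assumes g: "g \<in> vecs (fock \<mu>)"
  shows "(hnorm (fock \<mu>) g)\<^sup>2 = (\<Sum>n. fact n * (hnorm (LL n) (sector g n))\<^sup>2)"
proof -
  interpret F: semi_inner "fock \<mu>" by (rule fock_semi_inner)
  have "Re (fact n * ip (LL n) (sector g n) (sector g n)) = fact n * (hnorm (LL n) (sector g n))\<^sup>2" for n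
    using L.nrm_sq[of "sector g n" n] g by (simp add: Re_fact_mult)
  then show ?thesis
    unfolding F.nrm_sq[OF g] fock_ip using Re_suminf[OF fock_summable_ip[OF g g]] by simp
qed

lemma fock_term_le:
  assumes g: "g \<in> vecs (fock \<mu>)"
  shows "hnorm (LL n) (sector g n) \<le> hnorm (fock \<mu>) g"
proof -
  interpret F: semi_inner "fock \<mu>" by (rule fock_semi_inner)
  have "(hnorm (LL n) (sector g n))\<^sup>2 \<le> fact n * (hnorm (LL n) (sector g n))\<^sup>2" by (simp add: mult_le_cancel_right1)
  also have "\<dots> \<le> (hnorm (fock \<mu>) g)\<^sup>2"
    unfolding fock_nrm_sq[OF g]
    using sum_le_suminf[OF fock_summable_norm[OF g], of "{n}"] by simp
  finally show ?thesis using F.nrm_nonneg[OF g] by (rule power2_le_imp_le)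
qed

lemma fock_vecs_bound:
  assumes "\<And>n. sector g n \<in> vecs (LL n)" "\<And>n. perm_inv g n"
    and "\<And>m. (\<Sum>n<m. fact n * (hnorm (LL n) (sector g n))\<^sup>2) \<le> e\<^sup>2" and e: "e \<ge> 0"
  shows "g \<in> vecs (fock \<mu>) \<and> hnorm (fock \<mu>) g \<le> e"
proof -
  have s: "summable (\<lambda>n. fact n * (hnorm (LL n) (sector g n))\<^sup>2)"
    using assms(3) by (intro summableI_nonneg_bounded) auto
  then have g: "g \<in> vecs (fock \<mu>)" using assms by (simp add: fock_vecs)
  have "(hnorm (fock \<mu>) g)\<^sup>2 \<le> e\<^sup>2"
    unfolding fock_nrm_sq[OF g] using assms(3) by (intro suminf_le_const[OF s])
  then show ?thesis using g e power2_le_imp_le by blast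
qed

text \<open>Limits are taken sector by sector. The norm is estimated on finite partial sums over the
  sectors, where limit and sum may be exchanged, and \<open>fock_vecs_bound\<close> recovers the
  full norm.\<close>

lemma fock_hilbert: "hilbert (fock \<mu>)"
proof -
  interpret F: semi_inner "fock \<mu>" by (rule fock_semi_inner)
  show ?thesis
  proof
    fix F :: "nat \<Rightarrow> nat \<times> (nat \<Rightarrow> 'm) \<Rightarrow> complex"
    assume FV: "\<And>k. F k \<in> vecs (fock \<mu>)" and C: "\<And>e. e > 0 \<Longrightarrow> \<exists>N. \<forall>m\<ge>N. \<forall>n\<ge>N. hnorm (fock \<mu>) (F m - F n) < e"
    have Cn: "\<exists>N. \<forall>i\<ge>N. \<forall>j\<ge>N. hnorm (LL n) (sector (F i) n - sector (F j) n) < e" if "e > 0" for n e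
      using C[OF that] fock_term_le[of "F _ - F _" n] FV unfolding sector_simps
      by (meson F.diff_mem order.strict_trans1)
    have "\<forall>n. \<exists>k. (\<lambda>x. lim (\<lambda>i. sector (F (k i)) n x)) \<in> vecs (LL n) \<and>
      (\<lambda>j. hnorm (LL n) (sector (F j) n - (\<lambda>x. lim (\<lambda>i. sector (F (k i)) n x)))) \<longlonglongrightarrow> 0"
      using sigma_finite_measure.L2_complete[OF sigma_finite_P, of "\<lambda>j. sector (F j) n" n for n] FV Cn by blast
    then obtain k where k: "\<And>n. (\<lambda>x. lim (\<lambda>i. sector (F (k n i)) n x)) \<in> vecs (LL n)"
      "\<And>n. (\<lambda>j. hnorm (LL n) (sector (F j) n - (\<lambda>x. lim (\<lambda>i. sector (F (k n i)) n x)))) \<longlonglongrightarrow> 0"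
      by metis
    \<comment> \<open>The subsequence may depend on the sector. As a pointwise limit,
      \<open>G\<close> inherits the symmetry of the \<open>F i\<close> outside a countable union of
      null sets.\<close>
    define G where "G = (\<lambda>(n, x). lim (\<lambda>i. sector (F (k n i)) n x))"
    have cG: "sector G n = (\<lambda>x. lim (\<lambda>i. sector (F (k n i)) n x))" for n by (simp add: G_def sector_def)
    have G: "sector G n \<in> vecs (LL n)" "(\<lambda>j. hnorm (LL n) (sector (F j) n - sector G n)) \<longlonglongrightarrow> 0" for n
      using k unfolding cG by auto
    have "perm_inv G n" for n
    proof -
      have "AE x in PiM {..<n} (\<lambda>_. \<mu>). \<forall>i. \<forall>\<sigma>. \<sigma> permutes {..<n} \<longrightarrow> F i (n, x \<circ> \<sigma>) = F i (n, x)"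
        using FV unfolding AE_all_countable by (auto simp: fock_vecs perm_inv_def)
      then show ?thesis unfolding perm_inv_def G_def by eventually_elim (auto simp: sector_def)
    qed
    moreover have "perm_inv (F i) n" for i n using FV by (simp add: fock_vecs)
    ultimately have symd: "perm_inv (F i - G) n" for i n
      using perm_inv_add[of "F i" n "scl (-1) G"] perm_inv_scl[of G n "-1"] by simp
    have main: "F i - G \<in> vecs (fock \<mu>) \<and> hnorm (fock \<mu>) (F i - G) \<le> e"
      if N: "\<forall>m\<ge>N. \<forall>n\<ge>N. hnorm (fock \<mu>) (F m - F n) < e" and i: "i \<ge> N" and e: "e > 0" for N i e
    proof (rule fock_vecs_bound)
      fix m
      have "(\<lambda>j. \<Sum>n<m. fact n * (hnorm (LL n) (sector (F i - F j) n))\<^sup>2) \<longlonglongrightarrow> (\<Sum>n<m. fact n * (hnorm (LL n) (sector (F i - G) n))\<^sup>2)"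
      proof (intro tendsto_intros)
        fix n
        show "(\<lambda>j. hnorm (LL n) (sector (F i - F j) n)) \<longlonglongrightarrow> hnorm (LL n) (sector (F i - G) n)"
        proof (rule L.tendsto_nrm)
          have "hnorm (LL n) (sector (F i - F j) n - sector (F i - G) n) = hnorm (LL n) (sector (F j) n - sector G n)" for j
            using L.nrm_diff_commute[of "sector (F j) n" n "sector G n"] FV G(1) by (simp add: sector_simps)
          then show "(\<lambda>j. hnorm (LL n) (sector (F i - F j) n - sector (F i - G) n)) \<longlonglongrightarrow> 0" using G(2) by simp
        qed (use FV G in \<open>auto simp: sector_simps\<close>)
      qed
      moreover have "(\<Sum>n<m. fact n * (hnorm (LL n) (sector (F i - F j) n))\<^sup>2) \<le> e\<^sup>2" if j: "j \<ge> N" for j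
      proof -
        have d: "F i - F j \<in> vecs (fock \<mu>)" using FV by auto
        have "(\<Sum>n<m. fact n * (hnorm (LL n) (sector (F i - F j) n))\<^sup>2) \<le> (hnorm (fock \<mu>) (F i - F j))\<^sup>2"
          unfolding fock_nrm_sq[OF d] by (intro sum_le_suminf fock_summable_norm d) auto
        also have "\<dots> \<le> e\<^sup>2" using N i j F.nrm_nonneg[OF d] by (intro power_mono) (auto intro: less_imp_le)
        finally show ?thesis .
      qed
      ultimately show "(\<Sum>n<m. fact n * (hnorm (LL n) (sector (F i - G) n))\<^sup>2) \<le> e\<^sup>2"
        by (meson LIMSEQ_le_const2)
    qed (use symd FV G e in \<open>auto simp: sector_simps\<close>)
    have GV: "G \<in> vecs (fock \<mu>)"
    proof -
      obtain N where "\<forall>m\<ge>N. \<forall>n\<ge>N. hnorm (fock \<mu>) (F m - F n) < 1" using C[of 1] by auto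
      then have "F N - G \<in> vecs (fock \<mu>)" using main[of N 1 N] by auto
      then have "F N - (F N - G) \<in> vecs (fock \<mu>)" using FV F.diff_mem by blast
      then show ?thesis by simp
    qed
    have "(\<lambda>k. hnorm (fock \<mu>) (F k - G)) \<longlonglongrightarrow> 0"
    proof (rule LIMSEQ_I)
      fix e :: real assume e: "e > 0"
      then obtain N where N: "\<forall>m\<ge>N. \<forall>n\<ge>N. hnorm (fock \<mu>) (F m - F n) < e / 2" using C[of "e / 2"] by auto
      have "norm (hnorm (fock \<mu>) (F i - G) - 0) < e" if "i \<ge> N" for i
        using main[OF N that] e F.nrm_nonneg[of "F i - G"] by simp
      then show "\<exists>no. \<forall>n\<ge>no. norm (hnorm (fock \<mu>) (F n - G) - 0) < e" by (intro exI[of _ N]) simp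
    qed
    then show "\<exists>f\<in>vecs (fock \<mu>). (\<lambda>k. hnorm (fock \<mu>) (F k - f)) \<longlonglongrightarrow> 0" using GV by blast
  qed
qed

sublocale F: hilbert "fock \<mu>" by (rule fock_hilbert)

sublocale M: hilbert "L2 \<mu>" by (rule hilbert_L2)

end

section \<open>Coherent states and second quantization\<close>

definition tens :: "(nat \<Rightarrow> 'm \<Rightarrow> complex) \<Rightarrow> nat \<Rightarrow> (nat \<Rightarrow> 'm) \<Rightarrow> complex" where
  "tens \<phi> n = (\<lambda>x. \<Prod>i<n. \<phi> i (x i))"

text \<open>The derivative of \<open>\<epsilon> \<mapsto> e(f + \<epsilon> g)\<close> at \<open>0\<close>.\<close>

definition dcoh :: "('m \<Rightarrow> complex) \<Rightarrow> ('m \<Rightarrow> complex) \<Rightarrow> nat \<times> (nat \<Rightarrow> 'm) \<Rightarrow> complex" where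
  "dcoh f g = (\<lambda>(n, x). (\<Sum>i<n. \<Prod>j<n. (if j = i then g else f) (x j)) / fact n)"

lemma sum_fun_apply: "(sum F I) x = (\<Sum>i\<in>I. F i x)"
  for F :: "'i \<Rightarrow> 'b \<Rightarrow> complex"
  by (induction I rule: infinite_finite_induct) (auto simp: plus_fun_apply zero_fun_apply)

text \<open>The factors \<open>a j\<close> are exchanged for \<open>b j\<close> one at a time; in
  the \<open>i\<close>-th summand the slots below \<open>i\<close> have been exchanged
  already.\<close>

lemma prod_diff_telescope:
  fixes a b :: "nat \<Rightarrow> complex"
  shows "(\<Prod>j<n. a j) - (\<Prod>j<n. b j) = (\<Sum>i<n. \<Prod>j<n. if j < i then b j else if j = i then a j - b j else a j)"
proof (induction n)
  case (Suc n)
  have "(\<Sum>i<Suc n. \<Prod>j<Suc n. if j < i then b j else if j = i then a j - b j else a j) =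
      (\<Sum>i<n. (\<Prod>j<n. if j < i then b j else if j = i then a j - b j else a j) * a n) + (\<Prod>j<n. b j) * (a n - b n)"
    by simp
  also have "(\<Sum>i<n. (\<Prod>j<n. if j < i then b j else if j = i then a j - b j else a j) * a n) = ((\<Prod>j<n. a j) - (\<Prod>j<n. b j)) * a n"
    by (simp add: Suc sum_distrib_right)
  finally show ?case by (simp add: algebra_simps)
qed simp

lemma tens_diff_telescope:
  "tens a n - tens b n = (\<Sum>i<n. tens (\<lambda>j. if j < i then b j else if j = i then a j - b j else a j) n)"
proof
  fix x
  show "(tens a n - tens b n) x = (\<Sum>i<n. tens (\<lambda>j. if j < i then b j else if j = i then a j - b j else a j) n) x"
    using prod_diff_telescope[of "\<lambda>j. a j (x j)" n "\<lambda>j. b j (x j)"]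
    by (simp add: tens_def sum_fun_apply minus_apply if_distribR cong: if_cong)
qed

lemma tens_slot_scl:
  assumes "i < n" "\<phi> i = scl c (\<psi> i)" "\<And>j. j < n \<Longrightarrow> j \<noteq> i \<Longrightarrow> \<phi> j = \<psi> j"
  shows "tens \<phi> n = scl c (tens \<psi> n)"
proof
  fix x
  have "(\<Prod>j\<in>{..<n} - {i}. \<phi> j (x j)) = (\<Prod>j\<in>{..<n} - {i}. \<psi> j (x j))"
    using assms(3) by (intro prod.cong) auto
  then show "tens \<phi> n x = scl c (tens \<psi> n) x"
    using assms(1,2) by (simp add: tens_def scl_def prod.remove[of _ i])
qed

lemma sector_coherent: "sector (fock_coherent f) n = scl (1 / fact n) (tens (\<lambda>_. f) n)"
  by (simp add: sector_def fock_coherent_def scl_def tens_def)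

lemma sector_dcoh: "sector (dcoh f g) n = scl (1 / fact n) (\<Sum>i<n. tens (\<lambda>j. if j = i then g else f) n)"
  by (simp add: sector_def dcoh_def scl_def tens_def sum_fun_apply)

lemma partial_exp_le: "x \<ge> 0 \<Longrightarrow> (\<Sum>n<m. x ^ n / fact n) \<le> exp (x :: real)"
  unfolding exp_def using sum_le_suminf[OF summable_exp_generic[of x], of "{..<m}"]
  by (simp add: divide_inverse_commute)

section \<open>Tensor products, coherent states and their derivatives\<close>

context fock_space
begin

lemma tens_mem:
  assumes \<phi>: "\<And>i. i < n \<Longrightarrow> \<phi> i \<in> vecs (L2 \<mu>)"
  shows "tens \<phi> n \<in> vecs (LL n)"
  unfolding L2_vecs
proof
  have m: "\<phi> i \<in> borel_measurable \<mu>" "integrable \<mu> (\<lambda>x. (norm (\<phi> i x))\<^sup>2)" if "i < n" for i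
    using \<phi>[OF that] by (simp_all add: L2_vecs)
  show "tens \<phi> n \<in> borel_measurable (PiM {..<n} (\<lambda>_. \<mu>))"
    unfolding tens_def
  proof (rule borel_measurable_prod)
    fix i assume "i \<in> {..<n}"
    then show "(\<lambda>x. \<phi> i (x i)) \<in> borel_measurable (PiM {..<n} (\<lambda>_. \<mu>))"
      using m(1) by (intro measurable_compose[OF measurable_component_singleton[of i]]) auto
  qed
  have "(norm (tens \<phi> n x))\<^sup>2 = (\<Prod>i<n. (norm (\<phi> i (x i)))\<^sup>2)" for x
    by (simp add: tens_def prod_norm[symmetric] prod_power_distrib)
  then show "integrable (PiM {..<n} (\<lambda>_. \<mu>)) (\<lambda>x. (norm (tens \<phi> n x))\<^sup>2)"
    using P.product_integrable_prod[of "{..<n}" "\<lambda>i x. (norm (\<phi> i x))\<^sup>2"] m(2) by simp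
qed

lemma tens_ip:
  assumes \<phi>: "\<And>i. i < n \<Longrightarrow> \<phi> i \<in> vecs (L2 \<mu>)" and \<psi>: "\<And>i. i < n \<Longrightarrow> \<psi> i \<in> vecs (L2 \<mu>)"
  shows "ip (LL n) (tens \<phi> n) (tens \<psi> n) = (\<Prod>i<n. ip (L2 \<mu>) (\<phi> i) (\<psi> i))"
  unfolding L2_ip tens_def cnj_prod prod.distrib[symmetric]
  using P.product_integral_prod[of "{..<n}" "\<lambda>i x. \<phi> i x * cnj (\<psi> i x)"] L2_integrable_ip[OF \<phi> \<psi>] by simp

lemma tens_nrm:
  assumes \<phi>: "\<And>i. i < n \<Longrightarrow> \<phi> i \<in> vecs (L2 \<mu>)"
  shows "hnorm (LL n) (tens \<phi> n) = (\<Prod>i<n. hnorm (L2 \<mu>) (\<phi> i))"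
proof -
  have "complex_of_real ((hnorm (LL n) (tens \<phi> n))\<^sup>2) = (\<Prod>i<n. complex_of_real ((hnorm (L2 \<mu>) (\<phi> i))\<^sup>2))"
    using L.ip_self[OF tens_mem[OF \<phi>]] tens_ip[OF \<phi> \<phi>] M.ip_self[OF \<phi>] by (simp del: of_real_power)
  then have "(hnorm (LL n) (tens \<phi> n))\<^sup>2 = (\<Prod>i<n. hnorm (L2 \<mu>) (\<phi> i))\<^sup>2"
    by (simp del: of_real_power add: prod_power_distrib flip: of_real_prod)
  then show ?thesis
    using L.nrm_nonneg[OF tens_mem[OF \<phi>]] \<phi>
    by (subst (asm) power2_eq_iff_nonneg) (auto intro!: prod_nonneg)
qed

lemma tens_slot_bound:
  assumes "\<And>j. j < n \<Longrightarrow> \<phi> j \<in> vecs (L2 \<mu>)" "\<And>j. j < n \<Longrightarrow> j \<noteq> i \<Longrightarrow> hnorm (L2 \<mu>) (\<phi> j) \<le> B" "i < n" "B \<ge> 1"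
  shows "hnorm (LL n) (tens \<phi> n) \<le> B ^ n * hnorm (L2 \<mu>) (\<phi> i)"
proof -
  have "hnorm (LL n) (tens \<phi> n) = hnorm (L2 \<mu>) (\<phi> i) * (\<Prod>j\<in>{..<n} - {i}. hnorm (L2 \<mu>) (\<phi> j))"
    using assms by (simp add: tens_nrm prod.remove[of _ i])
  also have "\<dots> \<le> hnorm (L2 \<mu>) (\<phi> i) * (\<Prod>j\<in>{..<n} - {i}. B)"
    using assms by (intro mult_left_mono prod_mono) auto
  also have "\<dots> \<le> hnorm (L2 \<mu>) (\<phi> i) * B ^ n"
    using assms by (intro mult_left_mono) (auto simp: power_increasing)
  finally show ?thesis by (simp add: mult.commute)
qed

lemma tens_diff_bound:
  assumes a: "\<And>j. j < n \<Longrightarrow> a j \<in> vecs (L2 \<mu>)" "\<And>j. j < n \<Longrightarrow> hnorm (L2 \<mu>) (a j) \<le> B"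
    and b: "\<And>j. j < n \<Longrightarrow> b j \<in> vecs (L2 \<mu>)" "\<And>j. j < n \<Longrightarrow> hnorm (L2 \<mu>) (b j) \<le> B" and B: "B \<ge> 1"
  shows "hnorm (LL n) (tens a n - tens b n) \<le> B ^ n * (\<Sum>i<n. hnorm (L2 \<mu>) (a i - b i))"
proof -
  let ?c = "\<lambda>i j. if j < i then b j else if j = i then a j - b j else a j"
  have c: "?c i j \<in> vecs (L2 \<mu>)" if "j < n" for i j using a b that by auto
  have "hnorm (LL n) (tens a n - tens b n) \<le> (\<Sum>i<n. hnorm (LL n) (tens (?c i) n))"
    unfolding tens_diff_telescope by (intro L.nrm_sum tens_mem c)
  also have "\<dots> \<le> (\<Sum>i<n. B ^ n * hnorm (L2 \<mu>) (?c i i))"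
    using c a b B by (intro sum_mono tens_slot_bound) auto
  finally show ?thesis by (simp add: sum_distrib_left)
qed

lemma coherent_sector_mem: "f \<in> vecs (L2 \<mu>) \<Longrightarrow> sector (fock_coherent f) n \<in> vecs (LL n)"
  unfolding sector_coherent by (intro L.scale tens_mem)

lemma perm_inv_coherent: "perm_inv (fock_coherent f) n"
proof -
  have "fock_coherent f (n, x \<circ> \<sigma>) = fock_coherent f (n, x)" if "\<sigma> permutes {..<n}" for x \<sigma>
    using prod.permute[OF that, of "\<lambda>i. f (x i)"] by (simp add: fock_coherent_def o_def)
  then show ?thesis by (simp add: perm_inv_def)
qed

lemma coherent_sector_nrm: "f \<in> vecs (L2 \<mu>) \<Longrightarrow> hnorm (LL n) (sector (fock_coherent f) n) = hnorm (L2 \<mu>) f ^ n / fact n"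
  unfolding sector_coherent by (simp add: L.nrm_scl tens_mem tens_nrm norm_divide)

lemma coherent_mem [simp, intro]: assumes f: "f \<in> vecs (L2 \<mu>)" shows "fock_coherent f \<in> vecs (fock \<mu>)"
proof -
  let ?N = "hnorm (L2 \<mu>) f"
  have "(\<Sum>n<m. fact n * (hnorm (LL n) (sector (fock_coherent f) n))\<^sup>2) \<le> (sqrt (exp (?N\<^sup>2)))\<^sup>2" for m
  proof -
    have "fact n * (hnorm (LL n) (sector (fock_coherent f) n))\<^sup>2 = (?N\<^sup>2) ^ n / fact n" for n
      by (simp add: coherent_sector_nrm[OF f] power_divide power2_eq_square power_mult_distrib)
    then show ?thesis using partial_exp_le[of "?N\<^sup>2" m] by simp
  qed
  from fock_vecs_bound[OF coherent_sector_mem[OF f] perm_inv_coherent this] show ?thesis by simp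
qed

text \<open>Permuting the coordinates moves the distinguished slot \<open>i\<close> to
  \<open>\<sigma> i\<close>, which the sum over all slots absorbs.\<close>

lemma perm_inv_dcoh: "perm_inv (dcoh f g) n"
proof -
  have "dcoh f g (n, x \<circ> \<sigma>) = dcoh f g (n, x)" if s: "\<sigma> permutes {..<n}" for x \<sigma>
  proof -
    have "(\<Sum>i<n. \<Prod>j<n. (if j = i then g else f) (x (\<sigma> j))) = (\<Sum>i<n. \<Prod>j<n. (if \<sigma> j = \<sigma> i then g else f) (x (\<sigma> j)))"
      using permutes_inj[OF s] by (simp add: inj_eq)
    also have "\<dots> = (\<Sum>i<n. \<Prod>j<n. (if j = \<sigma> i then g else f) (x j))"
      using prod.permute[OF s, of "\<lambda>j. (if j = \<sigma> i then g else f) (x j)" for i] by (simp add: o_def)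
    also have "\<dots> = (\<Sum>i<n. \<Prod>j<n. (if j = i then g else f) (x j))"
      using sum.permute[OF s, of "\<lambda>i. \<Prod>j<n. (if j = i then g else f) (x j)"] by (simp add: o_def)
    finally show ?thesis by (simp add: dcoh_def)
  qed
  then show ?thesis by (simp add: perm_inv_def)
qed

text \<open>Squaring turns \<open>n^2\<close> into \<open>n^4\<close>, and \<open>n < 2^n\<close>
  gives \<open>n^4 <= 16^n\<close>. This is the origin of the constant \<open>16\<close>.\<close>

lemma power_fact_bound:
  assumes B: "B \<ge> (1::real)" and d: "d \<ge> 0" and le: "x \<le> B ^ n * (real n)\<^sup>2 * d / fact n" and x: "x \<ge> 0"
  shows "fact n * x\<^sup>2 \<le> d\<^sup>2 * ((16 * B\<^sup>2) ^ n / fact n)"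
proof -
  have "x\<^sup>2 \<le> (B ^ n * (real n)\<^sup>2 * d / fact n)\<^sup>2" using le x by (intro power_mono)
  then have "fact n * x\<^sup>2 \<le> fact n * (B ^ n * (real n)\<^sup>2 * d / fact n)\<^sup>2" by (intro mult_left_mono) auto
  also have "\<dots> = d\<^sup>2 * ((B\<^sup>2) ^ n * (real n) ^ 4 / fact n)"
    by (simp add: power_divide power_mult_distrib power2_eq_square power4_eq_xxxx)
  also have "\<dots> \<le> d\<^sup>2 * ((B\<^sup>2) ^ n * 16 ^ n / fact n)"
  proof -
    have "real n ^ 4 \<le> (2 ^ n) ^ 4" using of_nat_less_two_power[of n] by (intro power_mono) (auto intro: less_imp_le)
    also have "(2 ^ n :: real) ^ 4 = (2 ^ 4) ^ n" by (simp only: power_mult[symmetric] mult.commute)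
    also have "(2 ^ 4 :: real) = 16" by simp
    finally show ?thesis by (intro mult_left_mono divide_right_mono) auto
  qed
  also have "\<dots> = d\<^sup>2 * ((16 * B\<^sup>2) ^ n / fact n)" by (simp add: power_mult_distrib mult.commute)
  finally show ?thesis .
qed

text \<open>The factor \<open>n^2\<close> leaves room for a sum over two slot indices. The norm
  bound is linear in \<open>d\<close>, so it tends to \<open>0\<close> along with the differences of
  the factors.\<close>

lemma fock_power_bound:
  assumes "\<And>n. sector g n \<in> vecs (LL n)" "\<And>n. perm_inv g n" and B: "B \<ge> 1" and d: "d \<ge> 0"
    and le: "\<And>n. hnorm (LL n) (sector g n) \<le> B ^ n * (real n)\<^sup>2 * d / fact n"
  shows "g \<in> vecs (fock \<mu>) \<and> hnorm (fock \<mu>) g \<le> d * sqrt (exp (16 * B\<^sup>2))"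
proof (rule fock_vecs_bound)
  fix m
  have "(\<Sum>n<m. fact n * (hnorm (LL n) (sector g n))\<^sup>2) \<le> (\<Sum>n<m. d\<^sup>2 * ((16 * B\<^sup>2) ^ n / fact n))"
    using le assms by (intro sum_mono power_fact_bound) auto
  also have "\<dots> \<le> d\<^sup>2 * exp (16 * B\<^sup>2)"
    unfolding sum_distrib_left[symmetric] by (intro mult_left_mono partial_exp_le) auto
  finally show "(\<Sum>n<m. fact n * (hnorm (LL n) (sector g n))\<^sup>2) \<le> (d * sqrt (exp (16 * B\<^sup>2)))\<^sup>2"
    by (simp add: power_mult_distrib)
qed (use assms in auto)

lemma dcoh_slot_mem: "f \<in> vecs (L2 \<mu>) \<Longrightarrow> g \<in> vecs (L2 \<mu>) \<Longrightarrow> tens (\<lambda>j. if j = i then g else f) n \<in> vecs (LL n)"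
  by (intro tens_mem) auto

lemma dcoh_sector_mem: "f \<in> vecs (L2 \<mu>) \<Longrightarrow> g \<in> vecs (L2 \<mu>) \<Longrightarrow> sector (dcoh f g) n \<in> vecs (LL n)"
  unfolding sector_dcoh by (intro L.scale L.sum_mem dcoh_slot_mem)

lemma dcoh_mem [simp, intro]: assumes f: "f \<in> vecs (L2 \<mu>)" and g: "g \<in> vecs (L2 \<mu>)" shows "dcoh f g \<in> vecs (fock \<mu>)"
proof -
  define B where "B = 1 + hnorm (L2 \<mu>) f + hnorm (L2 \<mu>) g"
  have B: "B \<ge> 1" "hnorm (L2 \<mu>) f \<le> B" "hnorm (L2 \<mu>) g \<le> B" using M.nrm_nonneg f g by (auto simp: B_def)
  have "hnorm (LL n) (sector (dcoh f g) n) \<le> B ^ n * (real n)\<^sup>2 * B / fact n" for n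
  proof -
    have "hnorm (LL n) (\<Sum>i<n. tens (\<lambda>j. if j = i then g else f) n) \<le> (\<Sum>i<n. hnorm (LL n) (tens (\<lambda>j. if j = i then g else f) n))"
      using f g by (intro L.nrm_sum dcoh_slot_mem)
    also have "\<dots> \<le> (\<Sum>i<n. B ^ n * hnorm (L2 \<mu>) g)"
      using f g B tens_slot_bound[of n "\<lambda>j. if j = i then g else f" i B for i] by (intro sum_mono) auto
    also have "\<dots> \<le> (\<Sum>i<n. B ^ n * B)" using B by (intro sum_mono mult_left_mono) auto
    also have "\<dots> = real n * (B ^ n * B)" by simp
    also have "\<dots> \<le> (real n)\<^sup>2 * (B ^ n * B)"
      using B by (intro mult_right_mono) (auto simp: power2_eq_square mult_le_cancel_left1 simp flip: of_nat_mult)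
    finally have "hnorm (LL n) (\<Sum>i<n. tens (\<lambda>j. if j = i then g else f) n) \<le> B ^ n * (real n)\<^sup>2 * B" by (simp add: ac_simps)
    then show ?thesis
      unfolding sector_dcoh using f g
      by (subst L.nrm_scl) (auto intro!: L.sum_mem dcoh_slot_mem divide_right_mono simp: norm_divide)
  qed
  then show ?thesis using fock_power_bound[of "dcoh f g" B B] B f g dcoh_sector_mem perm_inv_dcoh by auto
qed

text \<open>Telescoping \<open>e(f) - e(f')\<close> puts \<open>f'\<close> before the slot
  \<open>i\<close>, \<open>t g'\<close> into it and \<open>f\<close> after it. Divided by
  \<open>t\<close>, each of the \<open>n\<close> summands is compared with the corresponding one of
  \<open>dcoh f g\<close> at the cost of \<open>n\<close> differences of factors, whence
  \<open>n^2\<close>.\<close>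

lemma dcoh_est:
  assumes V: "f \<in> vecs (L2 \<mu>)" "f' \<in> vecs (L2 \<mu>)" "g \<in> vecs (L2 \<mu>)" "g' \<in> vecs (L2 \<mu>)"
    and t: "t \<noteq> 0" and eq: "f - f' = scl t g'"
    and B: "B \<ge> 1" "hnorm (L2 \<mu>) f \<le> B" "hnorm (L2 \<mu>) f' \<le> B" "hnorm (L2 \<mu>) g \<le> B" "hnorm (L2 \<mu>) g' \<le> B"
  shows "hnorm (fock \<mu>) (scl (1 / t) (fock_coherent f - fock_coherent f') - dcoh f g) \<le>
    (hnorm (L2 \<mu>) (f' - f) + hnorm (L2 \<mu>) (g' - g)) * sqrt (exp (16 * B\<^sup>2))" (is "hnorm _ ?G \<le> ?d * _")
proof -
  have "?G \<in> vecs (fock \<mu>)" using V by auto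
  then have G: "sector ?G n \<in> vecs (LL n)" "perm_inv ?G n" for n by (auto simp: fock_vecs)
  have "?d \<ge> 0" using V M.nrm_nonneg by auto
  have "hnorm (LL n) (sector ?G n) \<le> B ^ n * (real n)\<^sup>2 * ?d / fact n" for n
  proof -
    let ?\<alpha> = "\<lambda>i j. if j < i then f' else if j = i then g' else f"
    let ?\<beta> = "\<lambda>i j. if j = i then g else f"
    have "tens (\<lambda>_. f) n - tens (\<lambda>_. f') n = (\<Sum>i<n. scl t (tens (?\<alpha> i) n))"
      unfolding tens_diff_telescope using eq by (intro sum.cong refl tens_slot_scl) auto
    also have "\<dots> = scl t (\<Sum>i<n. tens (?\<alpha> i) n)" by (simp add: scl.scale_sum_right)
    finally have "sector ?G n = scl (1 / fact n) ((\<Sum>i<n. tens (?\<alpha> i) n) - (\<Sum>i<n. tens (?\<beta> i) n))"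
      using t by (simp add: sector_simps sector_coherent sector_dcoh flip: scl.scale_right_diff_distrib)
    also have "(\<Sum>i<n. tens (?\<alpha> i) n) - (\<Sum>i<n. tens (?\<beta> i) n) = (\<Sum>i<n. tens (?\<alpha> i) n - tens (?\<beta> i) n)"
      by (simp add: sum_subtractf)
    finally have s: "sector ?G n = scl (1 / fact n) (\<Sum>i<n. tens (?\<alpha> i) n - tens (?\<beta> i) n)" .
    have ab: "tens (?\<alpha> i) n \<in> vecs (LL n)" "tens (?\<beta> i) n \<in> vecs (LL n)" for i using V by (auto intro!: tens_mem)
    have "hnorm (LL n) (\<Sum>i<n. tens (?\<alpha> i) n - tens (?\<beta> i) n) \<le> (\<Sum>i<n. hnorm (LL n) (tens (?\<alpha> i) n - tens (?\<beta> i) n))"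
      using ab by (intro L.nrm_sum) auto
    also have "\<dots> \<le> (\<Sum>i<n. B ^ n * (\<Sum>j<n. hnorm (L2 \<mu>) (?\<alpha> i j - ?\<beta> i j)))"
      using V B by (intro sum_mono tens_diff_bound) auto
    also have "\<dots> \<le> (\<Sum>i<n. B ^ n * (\<Sum>j<n. ?d))"
      using V B by (intro sum_mono mult_left_mono) auto
    also have "\<dots> = B ^ n * (real n)\<^sup>2 * ?d" by (simp add: power2_eq_square)
    finally show ?thesis
      unfolding s using ab by (subst L.nrm_scl) (auto simp: norm_divide intro!: divide_right_mono)
  qed
  then show ?thesis using fock_power_bound[OF G B(1) \<open>?d \<ge> 0\<close>] by blast
qed

section \<open>Order of Gram matrices under entrywise powers\<close>

definition psd :: "nat \<Rightarrow> (nat \<Rightarrow> nat \<Rightarrow> complex) \<Rightarrow> bool" where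
  "psd N P \<longleftrightarrow> (\<forall>c. 0 \<le> Re (\<Sum>k<N. \<Sum>l<N. c k * cnj (c l) * P k l))"

lemma psd_add: "psd N P \<Longrightarrow> psd N Q \<Longrightarrow> psd N (\<lambda>k l. P k l + Q k l)"
  unfolding psd_def by (simp add: distrib_left sum.distrib)

text \<open>
  The Schur product theorem for a Gram matrix of square integrable functions: the quadratic form
  of the product is the integral over \<open>x\<close> of the form of \<open>P\<close> at the vector \<open>c k * f k x\<close>.
\<close>

lemma psd_mult_gram:
  assumes P: "psd N P" and f: "\<And>k. k < N \<Longrightarrow> f k \<in> vecs (L2 \<mu>)"
  shows "psd N (\<lambda>k l. P k l * ip (L2 \<mu>) (f k) (f l))"
  unfolding psd_def
proof
  fix c :: "nat \<Rightarrow> complex"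
  have i: "integrable \<mu> (\<lambda>x. c k * cnj (c l) * P k l * (f k x * cnj (f l x)))" if "k < N" "l < N" for k l
    using L2_integrable_ip[OF f[OF that(1)] f[OF that(2)]] by simp
  have "(\<Sum>k<N. \<Sum>l<N. c k * cnj (c l) * (P k l * ip (L2 \<mu>) (f k) (f l))) =
      (\<Sum>k<N. \<Sum>l<N. \<integral>x. c k * cnj (c l) * P k l * (f k x * cnj (f l x)) \<partial>\<mu>)"
    by (simp add: L2_ip mult.assoc)
  also have "\<dots> = (\<integral>x. (\<Sum>k<N. \<Sum>l<N. c k * cnj (c l) * P k l * (f k x * cnj (f l x))) \<partial>\<mu>)"
  proof -
    have "(\<integral>x. (\<Sum>k<N. \<Sum>l<N. c k * cnj (c l) * P k l * (f k x * cnj (f l x))) \<partial>\<mu>) =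
        (\<Sum>k<N. \<integral>x. (\<Sum>l<N. c k * cnj (c l) * P k l * (f k x * cnj (f l x))) \<partial>\<mu>)"
      by (intro Bochner_Integration.integral_sum Bochner_Integration.integrable_sum i) auto
    also have "\<dots> = (\<Sum>k<N. \<Sum>l<N. \<integral>x. c k * cnj (c l) * P k l * (f k x * cnj (f l x)) \<partial>\<mu>)"
      by (intro sum.cong refl Bochner_Integration.integral_sum i) auto
    finally show ?thesis by simp
  qed
  also have "\<dots> = (\<integral>x. (\<Sum>k<N. \<Sum>l<N. (c k * f k x) * cnj (c l * f l x) * P k l) \<partial>\<mu>)"
    by (simp add: ac_simps)
  finally have eq: "(\<Sum>k<N. \<Sum>l<N. c k * cnj (c l) * (P k l * ip (L2 \<mu>) (f k) (f l))) =
    (\<integral>x. (\<Sum>k<N. \<Sum>l<N. (c k * f k x) * cnj (c l * f l x) * P k l) \<partial>\<mu>)" .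
  have "integrable \<mu> (\<lambda>x. \<Sum>k<N. \<Sum>l<N. (c k * f k x) * cnj (c l * f l x) * P k l)"
    using i by (intro Bochner_Integration.integrable_sum) (auto simp: ac_simps)
  then have "Re (\<integral>x. (\<Sum>k<N. \<Sum>l<N. (c k * f k x) * cnj (c l * f l x) * P k l) \<partial>\<mu>) =
    (\<integral>x. Re (\<Sum>k<N. \<Sum>l<N. (c k * f k x) * cnj (c l * f l x) * P k l) \<partial>\<mu>)"
    by (rule integral_Re[symmetric])
  also have "0 \<le> \<dots>"
  proof (rule integral_nonneg_AE, rule AE_I2)
    fix x
    show "0 \<le> Re (\<Sum>k<N. \<Sum>l<N. (c k * f k x) * cnj (c l * f l x) * P k l)"
      using P[unfolded psd_def, rule_format, of "\<lambda>k. c k * f k x"] .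
  qed
  finally show "0 \<le> Re (\<Sum>k<N. \<Sum>l<N. c k * cnj (c l) * (P k l * ip (L2 \<mu>) (f k) (f l)))" unfolding eq .
qed

lemma psd_mult_gram_power:
  assumes P: "psd N P" and f: "\<And>k. k < N \<Longrightarrow> f k \<in> vecs (L2 \<mu>)"
  shows "psd N (\<lambda>k l. P k l * ip (L2 \<mu>) (f k) (f l) ^ n)"
proof (induction n)
  case (Suc n)
  then show ?case using psd_mult_gram[OF Suc f] by (simp add: mult_ac)
qed (use P in simp)

lemma nrm_sq_lincomb:
  fixes F :: "nat \<Rightarrow> 'a \<Rightarrow> complex"
  assumes "semi_inner H" "\<And>k. k < N \<Longrightarrow> F k \<in> vecs H"
  shows "(hnorm H (\<Sum>k<N. scl (c k) (F k)))\<^sup>2 = Re (\<Sum>k<N. \<Sum>l<N. c k * cnj (c l) * ip H (F k) (F l))"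
proof -
  interpret semi_inner H by fact
  have "ip H (\<Sum>k<N. scl (c k) (F k)) (\<Sum>k<N. scl (c k) (F k)) = (\<Sum>k<N. \<Sum>l<N. c k * cnj (c l) * ip H (F k) (F l))"
  proof -
    have "ip H (\<Sum>k<N. scl (c k) (F k)) (\<Sum>k<N. scl (c k) (F k)) = (\<Sum>k<N. ip H (scl (c k) (F k)) (\<Sum>k<N. scl (c k) (F k)))"
      using assms(2) by (intro ip_sum_left) auto
    also have "\<dots> = (\<Sum>k<N. \<Sum>l<N. ip H (scl (c k) (F k)) (scl (c l) (F l)))"
      using assms(2) by (intro sum.cong refl ip_sum_right) auto
    also have "\<dots> = (\<Sum>k<N. \<Sum>l<N. c k * cnj (c l) * ip H (F k) (F l))"
      using assms(2) by (intro sum.cong refl) (simp add: ip_scl_left ip_scl_right)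
    finally show ?thesis .
  qed
  moreover have "(\<Sum>k<N. scl (c k) (F k)) \<in> V" using assms(2) by auto
  ultimately show ?thesis by (simp only: nrm_sq)
qed

text \<open>Entrywise, \<open>a^(n+1) - b^(n+1) = (a - b) b^n + (a^n - b^n) a\<close>. Both summands
  are positive semidefinite: the first by the hypothesis and repeated Schur products, the second by
  induction and one more.\<close>

lemma gram_power_le:
  assumes f: "\<And>k. k < N \<Longrightarrow> f k \<in> vecs (L2 \<mu>)" and h: "\<And>k. k < N \<Longrightarrow> h k \<in> vecs (L2 \<mu>)"
    and le: "\<And>c. hnorm (L2 \<mu>) (\<Sum>k<N. scl (c k) (h k)) \<le> hnorm (L2 \<mu>) (\<Sum>k<N. scl (c k) (f k))"
  shows "psd N (\<lambda>k l. ip (L2 \<mu>) (f k) (f l) ^ n - ip (L2 \<mu>) (h k) (h l) ^ n)"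
proof (induction n)
  case 0
  show ?case by (simp add: psd_def)
next
  case (Suc n)
  have "psd N (\<lambda>k l. ip (L2 \<mu>) (f k) (f l) - ip (L2 \<mu>) (h k) (h l))"
    unfolding psd_def
  proof
    fix c :: "nat \<Rightarrow> complex"
    have "(hnorm (L2 \<mu>) (\<Sum>k<N. scl (c k) (h k)))\<^sup>2 \<le> (hnorm (L2 \<mu>) (\<Sum>k<N. scl (c k) (f k)))\<^sup>2"
      using le[of c] h by (intro power_mono M.nrm_nonneg) auto
    then show "0 \<le> Re (\<Sum>k<N. \<Sum>l<N. c k * cnj (c l) * (ip (L2 \<mu>) (f k) (f l) - ip (L2 \<mu>) (h k) (h l)))"
      using nrm_sq_lincomb[OF semi_inner_L2 f, where c = c] nrm_sq_lincomb[OF semi_inner_L2 h, where c = c]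
      by (simp add: right_diff_distrib sum_subtractf)
  qed
  then have "psd N (\<lambda>k l. (ip (L2 \<mu>) (f k) (f l) - ip (L2 \<mu>) (h k) (h l)) * ip (L2 \<mu>) (h k) (h l) ^ n)"
    by (rule psd_mult_gram_power) (rule h)
  moreover have "psd N (\<lambda>k l. (ip (L2 \<mu>) (f k) (f l) ^ n - ip (L2 \<mu>) (h k) (h l) ^ n) * ip (L2 \<mu>) (f k) (f l))"
    using Suc by (rule psd_mult_gram) (rule f)
  ultimately show ?case by (drule_tac psd_add) (assumption, simp add: algebra_simps)
qed

text \<open>Inner products of tensor powers are powers of inner products. So in the sector
  \<open>n\<close> the squared norms are quadratic forms of entrywise powers of Gram matrices, at
  the coefficients \<open>c k / fact n\<close>.\<close>

lemma lincomb_coherent_le: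
  fixes N :: nat
  assumes f: "\<And>k. k < N \<Longrightarrow> f k \<in> vecs (L2 \<mu>)" and h: "\<And>k. k < N \<Longrightarrow> h k \<in> vecs (L2 \<mu>)"
    and le: "\<And>c. hnorm (L2 \<mu>) (\<Sum>k<N. scl (c k) (h k)) \<le> hnorm (L2 \<mu>) (\<Sum>k<N. scl (c k) (f k))"
  shows "hnorm (fock \<mu>) (\<Sum>k<N. scl (c k) (fock_coherent (h k))) \<le> hnorm (fock \<mu>) (\<Sum>k<N. scl (c k) (fock_coherent (f k)))"
proof -
  let ?S = "\<lambda>f. \<Sum>k<N. scl (c k) (fock_coherent (f k))"
  have V: "?S f \<in> vecs (fock \<mu>)" "?S h \<in> vecs (fock \<mu>)" using f h by (auto intro!: F.sum_mem)
  have sq: "(hnorm (LL n) (sector (?S f) n))\<^sup>2 =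
      Re (\<Sum>k<N. \<Sum>l<N. (c k / fact n) * cnj (c l / fact n) * ip (L2 \<mu>) (f k) (f l) ^ n)"
    if f: "\<And>k. k < N \<Longrightarrow> f k \<in> vecs (L2 \<mu>)" for f n
  proof -
    have "sector (?S f) n = (\<Sum>k<N. scl (c k / fact n) (tens (\<lambda>_. f k) n))"
      by (simp add: sector_sum sector_simps sector_coherent)
    then show ?thesis
      using nrm_sq_lincomb[OF semi_inner_L2, of N "\<lambda>k. tens (\<lambda>_. f k) n" "PiM {..<n} (\<lambda>_. \<mu>)" "\<lambda>k. c k / fact n"] f
      by (simp add: tens_ip tens_mem)
  qed
  have le_n: "(hnorm (LL n) (sector (?S h) n))\<^sup>2 \<le> (hnorm (LL n) (sector (?S f) n))\<^sup>2" for n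
  proof -
    have "0 \<le> Re (\<Sum>k<N. \<Sum>l<N. (c k / fact n) * cnj (c l / fact n) * (ip (L2 \<mu>) (f k) (f l) ^ n - ip (L2 \<mu>) (h k) (h l) ^ n))"
      using gram_power_le[OF f h le, of n] unfolding psd_def by (rule allE)
    then show ?thesis
      by (simp only: sq[OF f] sq[OF h] right_diff_distrib sum_subtractf minus_complex.sel diff_ge_0_iff_ge)
  qed
  have "(hnorm (fock \<mu>) (?S h))\<^sup>2 \<le> (hnorm (fock \<mu>) (?S f))\<^sup>2"
    unfolding fock_nrm_sq[OF V(1)] fock_nrm_sq[OF V(2)]
    by (intro suminf_le fock_summable_norm V mult_left_mono le_n) auto
  then show ?thesis using F.nrm_nonneg[OF V(1)] by (rule power2_le_imp_le)
qed

lemma Exp_op_exists: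
  assumes B: "contraction_op (L2 \<mu>) B"
  shows "\<exists>C. contraction_op (fock \<mu>) C \<and> (\<forall>(f, h)\<in>B. (fock_coherent f, fock_coherent h) \<in> C)"
proof -
  have op: "is_operator (L2 \<mu>) B" and le: "\<And>f h. (f, h) \<in> B \<Longrightarrow> hnorm (L2 \<mu>) h \<le> hnorm (L2 \<mu>) f"
    using B by (auto simp: contraction_op_def)
  note BD = M.is_operatorD[OF op]
  \<comment> \<open>The graph of \<open>B\<close> contains all linear combinations of its pairs, so
    contractivity bounds every combination of the images. This is the order of the two Gram
    matrices.\<close>
  have lin: "((\<Sum>k<N. scl (c k) (f k)), (\<Sum>k<N. scl (c k) (h k))) \<in> B" if "\<And>k. k < N \<Longrightarrow> (f k, h k) \<in> B" for N :: nat and c f h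
    using that by (induction N) (auto intro!: BD(3-5))
  define E where "E = {(fock_coherent f, fock_coherent h) |f h. (f, h) \<in> B}"
  have "\<exists>C. contraction_op (fock \<mu>) C \<and> E \<subseteq> C"
  proof (rule F.contraction_extension)
    show "E \<subseteq> vecs (fock \<mu>) \<times> vecs (fock \<mu>)" using BD(1,2) by (auto simp: E_def)
    fix N :: nat and c :: "nat \<Rightarrow> complex" and a b :: "nat \<Rightarrow> nat \<times> (nat \<Rightarrow> 'm) \<Rightarrow> complex"
    assume "\<And>k. k < N \<Longrightarrow> (a k, b k) \<in> E"
    then have "\<forall>k\<in>{..<N}. \<exists>f h. (f, h) \<in> B \<and> a k = fock_coherent f \<and> b k = fock_coherent h" by (fastforce simp: E_def)
    then obtain f h where fh: "\<And>k. k < N \<Longrightarrow> (f k, h k) \<in> B" "\<And>k. k < N \<Longrightarrow> a k = fock_coherent (f k)"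
      "\<And>k. k < N \<Longrightarrow> b k = fock_coherent (h k)" by (metis lessThan_iff)
    have "hnorm (fock \<mu>) (\<Sum>k<N. scl (c k) (fock_coherent (h k))) \<le> hnorm (fock \<mu>) (\<Sum>k<N. scl (c k) (fock_coherent (f k)))"
      using BD(1,2) fh(1) le[OF lin[OF fh(1)]] by (intro lincomb_coherent_le) blast+
    then show "hnorm (fock \<mu>) (\<Sum>k<N. scl (c k) (b k)) \<le> hnorm (fock \<mu>) (\<Sum>k<N. scl (c k) (a k))"
      using fh(2,3) by simp
  qed
  then show ?thesis by (fastforce simp: E_def)
qed

lemma Exp_op_spec:
  assumes B: "contraction_op (L2 \<mu>) B"
  shows "contraction_op (fock \<mu>) (Exp_op \<mu> B)" "(f, h) \<in> B \<Longrightarrow> (fock_coherent f, fock_coherent h) \<in> Exp_op \<mu> B"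
  using someI_ex[OF Exp_op_exists[OF B]] unfolding Exp_op_def[symmetric] by auto

end

section \<open>Values of a generator modulo null vectors\<close>

context semi_inner
begin

lemma generator_iff:
  "(f, h) \<in> generator H T \<longleftrightarrow> f \<in> V \<and> h \<in> V \<and>
    (\<exists>u. (\<forall>t>0. (f, u t) \<in> T t) \<and> ((\<lambda>t. nrm (scl (1 / complex_of_real t) (f - u t) - h)) \<longlongrightarrow> 0) (at_right 0))"
proof -
  have "(\<lambda>i. (f i - u i) / complex_of_real t - h i) = scl (1 / complex_of_real t) (f - u) - h" for u and t :: real
    by (simp add: scl_def fun_eq_iff minus_apply)
  then show ?thesis by (simp add: generator_def)
qed

text \<open>Two versions of \<open>T t f\<close> differ by a null vector for every
  \<open>t > 0\<close>, so their difference quotients have the same limits.\<close>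

lemma generator_unique:
  assumes T: "\<And>t. t > 0 \<Longrightarrow> is_operator H (T t)"
    and h: "(f, h) \<in> generator H T" and h': "(f, h') \<in> generator H T"
  shows "nrm (h - h') = 0"
proof -
  obtain u where u: "\<forall>t>0. (f, u t) \<in> T t" "((\<lambda>t. nrm (scl (1 / complex_of_real t) (f - u t) - h)) \<longlongrightarrow> 0) (at_right 0)"
    using h unfolding generator_iff by blast
  obtain u' where u': "\<forall>t>0. (f, u' t) \<in> T t" "((\<lambda>t. nrm (scl (1 / complex_of_real t) (f - u' t) - h')) \<longlongrightarrow> 0) (at_right 0)"
    using h' unfolding generator_iff by blast
  have V: "f \<in> V" "h \<in> V" "h' \<in> V" using h h' by (auto simp: generator_iff)
  have "((\<lambda>t. nrm (scl (1 / complex_of_real t) (f - u t) - h) + nrm (scl (1 / complex_of_real t) (f - u' t) - h')) \<longlongrightarrow> 0 + 0) (at_right 0)"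
    by (intro tendsto_add u u')
  moreover have "\<forall>\<^sub>F t in at_right 0. nrm (h - h') \<le> nrm (scl (1 / complex_of_real t) (f - u t) - h) + nrm (scl (1 / complex_of_real t) (f - u' t) - h')"
    using eventually_at_right_less[of "0 :: real"]
  proof eventually_elim
    case (elim t)
    let ?a = "scl (1 / complex_of_real t) (f - u t)" and ?b = "scl (1 / complex_of_real t) (f - u' t)"
    have uV: "u t \<in> V" "u' t \<in> V" using is_operatorD(2)[OF T] u(1) u'(1) elim by blast+
    have "nrm (u t - u' t) = 0" using is_operatorD(6)[OF T] u(1) u'(1) elim by blast
    then have "nrm (scl (- 1 / complex_of_real t) (u t - u' t)) = 0" using uV by (subst nrm_scl) auto
    moreover have "scl (- 1 / complex_of_real t) (u t - u' t) = ?a - ?b"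
      by (simp add: scl.scale_right_diff_distrib)
    ultimately have ab: "nrm (?a - ?b) = 0" by simp
    have "nrm (h - h') \<le> nrm (h - ?a) + nrm (?a - h')" using uV V by (intro nrm_triangle3) auto
    also have "nrm (?a - h') \<le> nrm (?a - ?b) + nrm (?b - h')" using uV V by (intro nrm_triangle3) auto
    finally show ?case using ab nrm_diff_commute[of h ?a] uV V by simp
  qed
  ultimately have "nrm (h - h') \<le> 0 + 0" by (rule tendsto_lowerbound) simp
  then show ?thesis using V by (intro antisym) auto
qed

lemma generator_cong:
  assumes T: "\<And>t. t > 0 \<Longrightarrow> is_operator H (T t)"
    and h: "(f, h) \<in> generator H T" and f': "f' \<in> V" "nrm (f - f') = 0" and h': "h' \<in> V" "nrm (h - h') = 0"
  shows "(f', h') \<in> generator H T"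
proof -
  obtain u where u: "\<forall>t>0. (f, u t) \<in> T t" "((\<lambda>t. nrm (scl (1 / complex_of_real t) (f - u t) - h)) \<longlongrightarrow> 0) (at_right 0)"
    using h unfolding generator_iff by blast
  have V: "f \<in> V" "h \<in> V" using h by (auto simp: generator_iff)
  have uV: "u t \<in> V" if "t > 0" for t using is_operatorD(2)[OF T] u(1) that by blast
  have "(f', u t) \<in> T t" if "t > 0" for t
    using is_operatorD(7)[OF T[OF that], of f "u t" f' "u t"] u(1) f' uV that by simp
  moreover have "((\<lambda>t. nrm (scl (1 / complex_of_real t) (f' - u t) - h')) \<longlongrightarrow> 0) (at_right 0)"
  proof (rule Lim_transform_eventually[OF u(2)])
    show "\<forall>\<^sub>F t in at_right 0. nrm (scl (1 / complex_of_real t) (f - u t) - h) = nrm (scl (1 / complex_of_real t) (f' - u t) - h')"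
      using eventually_at_right_less[of "0 :: real"]
    proof eventually_elim
      case (elim t)
      let ?s = "scl (1 / complex_of_real t)"
      have "nrm ((?s (f - u t) - h) - (?s (f' - u t) - h')) \<le> nrm (?s (f - f')) + nrm (h - h')"
        using nrm_triangle_diff[of "?s (f - f')" "h - h'"] V f' h' by (simp add: scl.scale_right_diff_distrib algebra_simps)
      also have "\<dots> = 0" using f' h' V by (subst nrm_scl) auto
      finally show ?case using V f' h' uV[OF elim] by (intro nrm_cong antisym) auto
    qed
  qed
  ultimately show ?thesis unfolding generator_iff using f' h' by blast
qed

end

section \<open>The generator of the second quantized semigroup at coherent states\<close>

context fock_space
begin

lemma exp_semigroup_spec:
  assumes A: "self_adjoint (L2 \<mu>) A" "positive_op (L2 \<mu>) A"
  shows "contraction_semigroup (L2 \<mu>) (exp_semigroup (L2 \<mu>) A)" "generator (L2 \<mu>) (exp_semigroup (L2 \<mu>) A) = A"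
proof -
  interpret positive_self_adjoint "L2 \<mu>" A
    by (intro positive_self_adjoint.intro M.hilbert_axioms positive_self_adjoint_axioms.intro A)
  show "contraction_semigroup (L2 \<mu>) (exp_semigroup (L2 \<mu>) A)" "generator (L2 \<mu>) (exp_semigroup (L2 \<mu>) A) = A"
    using someI_ex[OF hille_yosida] unfolding exp_semigroup_def[symmetric] by auto
qed

context
  fixes A
  assumes A: "self_adjoint (L2 \<mu>) A" "positive_op (L2 \<mu>) A"
begin

lemma exp_semigroup_contraction: "t \<ge> 0 \<Longrightarrow> contraction_op (L2 \<mu>) (exp_semigroup (L2 \<mu>) A t)"
  using exp_semigroup_spec(1)[OF A] by (simp add: contraction_semigroup_def)

lemma Exp_semigroup_op: "t > 0 \<Longrightarrow> is_operator (fock \<mu>) (Exp_op \<mu> (exp_semigroup (L2 \<mu>) A t))"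
  using Exp_op_spec(1)[OF exp_semigroup_contraction, of t] by (simp add: contraction_op_def)

lemma dExp_op_unique:
  "(F, G) \<in> dExp_op \<mu> A \<Longrightarrow> (F, G') \<in> dExp_op \<mu> A \<Longrightarrow> hnorm (fock \<mu>) (G - G') = 0"
  unfolding dExp_op_def
  by (rule F.generator_unique[where T = "\<lambda>t. Exp_op \<mu> (exp_semigroup (L2 \<mu>) A t)", OF Exp_semigroup_op])

lemma dExp_op_cong:
  "(F, G) \<in> dExp_op \<mu> A \<Longrightarrow> F' \<in> vecs (fock \<mu>) \<Longrightarrow> hnorm (fock \<mu>) (F - F') = 0 \<Longrightarrow>
    G' \<in> vecs (fock \<mu>) \<Longrightarrow> hnorm (fock \<mu>) (G - G') = 0 \<Longrightarrow> (F', G') \<in> dExp_op \<mu> A"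
  unfolding dExp_op_def
  by (rule F.generator_cong[where T = "\<lambda>t. Exp_op \<mu> (exp_semigroup (L2 \<mu>) A t)", OF Exp_semigroup_op])

text \<open>The versions \<open>u t\<close> of the evolved \<open>f\<close> give versions
  \<open>e(u t)\<close> of the image of \<open>e(f)\<close>. Taken with the difference quotient
  \<open>g' t\<close>, the estimate \<open>dcoh_est\<close> bounds the error by a multiple of
  \<open>t * B\<close> plus the distance from \<open>g' t\<close> to \<open>g\<close>.\<close>

lemma dExp_op_coherent:
  assumes fg: "(f, g) \<in> A"
  shows "(fock_coherent f, dcoh f g) \<in> dExp_op \<mu> A"
proof -
  let ?S = "exp_semigroup (L2 \<mu>) A"
  have "(f, g) \<in> generator (L2 \<mu>) ?S" using fg exp_semigroup_spec(2)[OF A] by simp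
  then obtain u where V: "f \<in> vecs (L2 \<mu>)" "g \<in> vecs (L2 \<mu>)" and u: "\<forall>t>0. (f, u t) \<in> ?S t"
    and l: "((\<lambda>t. hnorm (L2 \<mu>) (scl (1 / complex_of_real t) (f - u t) - g)) \<longlongrightarrow> 0) (at_right 0)"
    unfolding M.generator_iff by blast
  have uV: "u t \<in> vecs (L2 \<mu>)" "hnorm (L2 \<mu>) (u t) \<le> hnorm (L2 \<mu>) f" if "t > 0" for t
    using exp_semigroup_contraction[of t] u that M.is_operatorD(2)[of "?S t" f "u t"] by (auto simp: contraction_op_def)
  define g' where "g' t = scl (1 / complex_of_real t) (f - u t)" for t
  have g'V: "g' t \<in> vecs (L2 \<mu>)" if "t > 0" for t using uV[OF that] V by (auto simp: g'_def)
  \<comment> \<open>One bound for \<open>f\<close>, \<open>u t\<close>, \<open>g\<close> and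
    \<open>g' t\<close>; the summand \<open>1\<close> covers \<open>g' t\<close>, which is closer
    than \<open>1\<close> to \<open>g\<close> for small \<open>t\<close>.\<close>
  define B where "B = 1 + hnorm (L2 \<mu>) f + hnorm (L2 \<mu>) g"
  have nn: "hnorm (L2 \<mu>) f \<ge> 0" "hnorm (L2 \<mu>) g \<ge> 0" using V by auto
  have ev: "\<forall>\<^sub>F t in at_right 0. t > 0 \<and> hnorm (L2 \<mu>) (g' t - g) < 1"
    using eventually_at_right_less[of "0 :: real"] order_tendstoD(2)[OF l, of 1] by (auto simp: g'_def intro: eventually_conj)
  have est: "\<forall>\<^sub>F t in at_right 0. hnorm (fock \<mu>) (scl (1 / complex_of_real t) (fock_coherent f - fock_coherent (u t)) - dcoh f g)
      \<le> (t * B + hnorm (L2 \<mu>) (g' t - g)) * sqrt (exp (16 * B\<^sup>2))"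
    using ev
  proof eventually_elim
    case (elim t)
    have t: "t > 0" and gb: "hnorm (L2 \<mu>) (g' t - g) < 1" using elim by auto
    have g'B: "hnorm (L2 \<mu>) (g' t) \<le> B"
      using M.nrm_diff_ge[OF g'V[OF t] V(2)] gb nn by (simp add: B_def)
    have eq: "f - u t = scl (complex_of_real t) (g' t)" using t by (simp add: g'_def)
    have "hnorm (L2 \<mu>) (u t - f) = t * hnorm (L2 \<mu>) (g' t)"
      using M.nrm_diff_commute[of "u t" f] uV[OF t] V g'V[OF t] t by (simp add: eq M.nrm_scl)
    also have "\<dots> \<le> t * B" using g'B t by simp
    finally have uf: "hnorm (L2 \<mu>) (u t - f) \<le> t * B" .
    have "hnorm (fock \<mu>) (scl (1 / complex_of_real t) (fock_coherent f - fock_coherent (u t)) - dcoh f g)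
      \<le> (hnorm (L2 \<mu>) (u t - f) + hnorm (L2 \<mu>) (g' t - g)) * sqrt (exp (16 * B\<^sup>2))"
      by (rule dcoh_est[OF V(1) uV(1)[OF t] V(2) g'V[OF t] _ eq])
        (use t nn uV(2)[OF t] g'B in \<open>auto simp: B_def\<close>)
    also have "\<dots> \<le> (t * B + hnorm (L2 \<mu>) (g' t - g)) * sqrt (exp (16 * B\<^sup>2))"
      using uf by (intro mult_right_mono) auto
    finally show ?case .
  qed
  have "((\<lambda>t. (t * B + hnorm (L2 \<mu>) (g' t - g)) * sqrt (exp (16 * B\<^sup>2))) \<longlongrightarrow> (0 * B + 0) * sqrt (exp (16 * B\<^sup>2))) (at_right 0)"
    using l by (intro tendsto_intros) (auto simp: g'_def)
  then have "((\<lambda>t. hnorm (fock \<mu>) (scl (1 / complex_of_real t) (fock_coherent f - fock_coherent (u t)) - dcoh f g)) \<longlongrightarrow> 0) (at_right 0)"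
  proof (intro tendsto_sandwich[OF _ est tendsto_const])
    show "\<forall>\<^sub>F t in at_right 0. 0 \<le> hnorm (fock \<mu>) (scl (1 / complex_of_real t) (fock_coherent f - fock_coherent (u t)) - dcoh f g)"
      using eventually_at_right_less[of "0 :: real"] by eventually_elim (use V uV in auto)
  qed simp
  moreover have "\<forall>t>0. (fock_coherent f, fock_coherent (u t)) \<in> Exp_op \<mu> (?S t)"
    using Exp_op_spec(2)[OF exp_semigroup_contraction] u by simp
  ultimately show ?thesis unfolding dExp_op_def F.generator_iff using V
    by (intro conjI exI[of _ "\<lambda>t. fock_coherent (u t)"]) auto
qed

end

end

section \<open>Mittag-Leffler coefficients\<close>

text \<open>On \<open>[1, 2]\<close> a minimum exists by compactness, and
  \<open>Gamma x = (x - 1) Gamma (x - 1)\<close> cannot fall below it for \<open>x > 2\<close>. This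
  bounds the Mittag-Leffler coefficients.\<close>

lemma Gamma_bounded_below: "\<exists>c>0. \<forall>x\<ge>(1::real). c \<le> Gamma x"
proof -
  have disj: "{1..2::real} \<inter> \<int>\<^sub>\<le>\<^sub>0 = {}" using nonpos_Ints_nonpos by force
  obtain y where y: "y \<in> {1..2::real}" "\<And>x. x \<in> {1..2} \<Longrightarrow> Gamma y \<le> Gamma x"
    using continuous_attains_inf[OF _ _ continuous_on_Gamma[OF disj]] by auto
  have "Gamma y \<le> Gamma x" if "1 \<le> x" "x \<le> real n + 2" for n x
    using that
  proof (induction n arbitrary: x)
    case (Suc n)
    show ?case
    proof (cases "x \<le> 2")
      case False
      have "x - 1 \<notin> \<int>\<^sub>\<le>\<^sub>0" using False nonpos_Ints_nonpos[of "x - 1"] by auto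
      then have "Gamma x = (x - 1) * Gamma (x - 1)" using Gamma_plus1[of "x - 1"] by simp
      also have "\<dots> \<ge> 1 * Gamma (x - 1)" using False by (intro mult_right_mono) auto
      finally show ?thesis using Suc.IH[of "x - 1"] Suc.prems False by simp
    qed (use y Suc in auto)
  qed (use y in auto)
  moreover have "\<exists>n. x \<le> real n + 2" for x using real_arch_simple[of x] by (metis add_increasing2 zero_le_numeral)
  ultimately have "Gamma y \<le> Gamma x" if "1 \<le> x" for x using that by blast
  then show ?thesis using y by (intro exI[of _ "Gamma y"]) auto
qed

text \<open>Bounded coefficients give a positive radius of convergence, so derivatives at
  \<open>0\<close> are read off the formal power series. The radius \<open>1 / 2\<close> is a
  convenient choice below \<open>1\<close>.\<close>

lemma ml_deriv0_eq:
  assumes \<alpha>: "\<alpha> > 0"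
  shows "ml_deriv0 \<alpha> n = fact n / Gamma (\<alpha> * real n + 1)"
proof -
  define F :: "real fps" where "F = Abs_fps (\<lambda>n. inverse (Gamma (\<alpha> * real n + 1)))"
  have mF: "mittag_leffler \<alpha> = eval_fps F"
    by (simp add: fun_eq_iff mittag_leffler_def eval_fps_def F_def)
  obtain c where c: "c > 0" "\<And>x. x \<ge> 1 \<Longrightarrow> c \<le> Gamma (x::real)" using Gamma_bounded_below by blast
  have "summable (\<lambda>n. fps_nth F n * (1 / 2) ^ n)"
  proof (rule summable_comparison_test')
    show "summable (\<lambda>n. inverse c * (1 / 2 :: real) ^ n)" by (intro summable_mult summable_geometric) simp
    fix n
    have "c \<le> Gamma (\<alpha> * real n + 1)" using \<alpha> by (intro c) simp
    then have "inverse (Gamma (\<alpha> * real n + 1)) \<le> inverse c" "0 < Gamma (\<alpha> * real n + 1)" using c(1) by (auto intro: le_imp_inverse_le)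
    then show "norm (fps_nth F n * (1 / 2) ^ n) \<le> inverse c * (1 / 2) ^ n"
      by (auto simp: F_def norm_mult norm_power intro!: mult_right_mono)
  qed
  then have "ereal (norm (1 / 2 :: real)) \<le> fps_conv_radius F"
    unfolding fps_conv_radius_def by (rule conv_radius_geI)
  then have r: "fps_conv_radius F \<ge> ereal (1 / 2)" by simp
  have rad: "fps_conv_radius ((fps_deriv ^^ k) F) \<ge> ereal (1 / 2)" for k
    by (induction k) (auto intro: r order_trans[OF _ fps_conv_radius_deriv])
  \<comment> \<open>Stated on a neighbourhood of \<open>0\<close> because differentiating once more
    needs the equality nearby, not only at \<open>0\<close>.\<close>
  have "(deriv ^^ k) (mittag_leffler \<alpha>) z = eval_fps ((fps_deriv ^^ k) F) z" if "\<bar>z\<bar> < 1 / 2" for k z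
    using that
  proof (induction k arbitrary: z)
    case 0
    then show ?case by (simp add: mF)
  next
    case (Suc k)
    have "(deriv ^^ Suc k) (mittag_leffler \<alpha>) z = deriv ((deriv ^^ k) (mittag_leffler \<alpha>)) z" by simp
    also have "\<dots> = deriv (eval_fps ((fps_deriv ^^ k) F)) z"
    proof (rule deriv_cong_ev)
      have "z \<in> {-1/2<..<1/2}" "open {-1/2<..<1/2::real}" using Suc.prems by auto
      then have "\<forall>\<^sub>F x in nhds z. x \<in> {-1/2<..<1/2}" by (rule eventually_nhds_in_open[rotated])
      then show "\<forall>\<^sub>F x in nhds z. (deriv ^^ k) (mittag_leffler \<alpha>) x = eval_fps ((fps_deriv ^^ k) F) x"
        by eventually_elim (use Suc.IH in auto)
    qed simp
    also have "\<dots> = eval_fps (fps_deriv ((fps_deriv ^^ k) F)) z"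
    proof (intro DERIV_imp_deriv has_field_derivative_eval_fps)
      have "ereal (norm z) < ereal (1 / 2)" using Suc.prems by simp
      then show "ereal (norm z) < fps_conv_radius ((fps_deriv ^^ k) F)" using rad[of k] by (rule less_le_trans)
    qed
    finally show ?case by (simp only: funpow.simps o_apply)
  qed
  from this[of 0 n] have "ml_deriv0 \<alpha> n = fact n * fps_nth F n"
    unfolding ml_deriv0_def eval_fps_at_0 fps_0th_higher_deriv by simp
  then show ?thesis by (simp add: F_def divide_inverse)
qed

lemma ml_deriv0_pos: "\<alpha> > 0 \<Longrightarrow> ml_deriv0 \<alpha> n > 0"
  by (simp add: ml_deriv0_eq add_nonneg_pos)

section \<open>Measures on configurations\<close>

lemma config_open_Pow: "{W. config_open W} \<subseteq> Pow finite_configs"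
  by (auto simp: config_open_def)

lemma space_config_borel [simp]: "space config_borel = finite_configs"
  unfolding config_borel_def by (rule space_measure_of[OF config_open_Pow])

lemma sets_config_borelI: "config_open W \<Longrightarrow> W \<in> sets config_borel"
  unfolding config_borel_def by (subst sets_measure_of[OF config_open_Pow]) auto

text \<open>On tuples with distinct coordinates the condition is a union of open boxes, one for each
  index set \<open>S\<close> of at least \<open>k\<close> coordinates required to lie in
  \<open>U\<close>. It counts from below because having exactly \<open>k\<close> points in
  \<open>U\<close> is in general not open.\<close>

lemma config_open_card:
  assumes U: "open (U :: 'm::topological_space set)"
  shows "config_open {\<eta>. finite \<eta> \<and> k \<le> card (\<eta> \<inter> U)}"
  unfolding config_open_def
proof (intro conjI allI)
  fix n
  let ?T = "tuples_distinct n :: (nat \<Rightarrow> 'm) set"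
  let ?X = "product_topology (\<lambda>_. euclidean :: 'm topology) {..<n}"
  define O' where "O' = (\<Union>S\<in>{S. S \<subseteq> {..<n} \<and> k \<le> card S}. PiE {..<n} (\<lambda>i. if i \<in> S then U else UNIV))"
  have "openin ?X O'"
    unfolding O'_def using U by (intro openin_Union) (auto simp: openin_PiE open_openin[symmetric])
  moreover have "{x \<in> ?T. x ` {..<n} \<in> {\<eta>. finite \<eta> \<and> k \<le> card (\<eta> \<inter> U)}} = ?T \<inter> O'"
  proof (intro set_eqI iffI)
    fix x assume "x \<in> {x \<in> ?T. x ` {..<n} \<in> {\<eta>. finite \<eta> \<and> k \<le> card (\<eta> \<inter> U)}}"
    then have x: "x \<in> ?T" "inj_on x {..<n}" "k \<le> card (x ` {..<n} \<inter> U)" by (auto simp: tuples_distinct_def)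
    have "x ` {..<n} \<inter> U = x ` {i\<in>{..<n}. x i \<in> U}" by auto
    also have "card \<dots> = card {i\<in>{..<n}. x i \<in> U}"
      using x(2) by (intro card_image) (auto intro: inj_on_subset)
    finally have "k \<le> card {i\<in>{..<n}. x i \<in> U}" using x(3) by simp
    then have "{i\<in>{..<n}. x i \<in> U} \<in> {S. S \<subseteq> {..<n} \<and> k \<le> card S}" by auto
    moreover have "x \<in> PiE {..<n} (\<lambda>i. if i \<in> {i\<in>{..<n}. x i \<in> U} then U else UNIV)"
      using x(1) by (auto simp: tuples_distinct_def PiE_iff)
    ultimately have "x \<in> O'" unfolding O'_def by (rule UN_I)
    then show "x \<in> ?T \<inter> O'" using x by auto
  next
    fix x assume "x \<in> ?T \<inter> O'"
    then obtain S where x: "x \<in> ?T" "inj_on x {..<n}" and S: "S \<subseteq> {..<n}" "k \<le> card S"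
      "x \<in> PiE {..<n} (\<lambda>i. if i \<in> S then U else UNIV)" by (auto simp: tuples_distinct_def O'_def)
    have "x i \<in> U" if "i \<in> S" for i using PiE_mem[OF S(3), of i] S(1) that by auto
    then have "x ` S \<subseteq> x ` {..<n} \<inter> U" using S(1) by blast
    then have "card (x ` S) \<le> card (x ` {..<n} \<inter> U)" by (intro card_mono) auto
    moreover have "card (x ` S) = card S" using x(2) S(1) by (intro card_image) (auto intro: inj_on_subset)
    ultimately show "x \<in> {x \<in> ?T. x ` {..<n} \<in> {\<eta>. finite \<eta> \<and> k \<le> card (\<eta> \<inter> U)}}" using S(2) x by auto
  qed
  ultimately show "openin (subtopology ?X ?T) {x \<in> ?T. x ` {..<n} \<in> {\<eta>. finite \<eta> \<and> k \<le> card (\<eta> \<inter> U)}}"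
    by (auto simp: openin_subtopology)
qed (auto simp: finite_configs_def)

lemma sum_indicator_card: "finite \<eta> \<Longrightarrow> (\<Sum>x\<in>\<eta>. indicator B x) = (of_nat (card (\<eta> \<inter> B)) :: ennreal)"
  by (simp add: indicator_def sum.If_cases)

text \<open>
  Measurability on configurations is reduced to the counting functions \<open>\<eta> \<mapsto> card (\<eta> \<inter> B)\<close>: the
  coherent state of a simple function is a polynomial in them.
\<close>

lemma measurable_count_ennreal:
  assumes B: "B \<in> sets (borel :: 'm::topological_space measure)"
  shows "(\<lambda>\<eta>. \<Sum>x\<in>\<eta>. indicator B x :: ennreal) \<in> borel_measurable config_borel"
proof -
  \<comment> \<open>Dynkin induction from the open sets. Extended nonnegative values let a countable
    disjoint union turn into a series of counts.\<close>
  have "Int_stable {S :: 'm set. open S}" by (auto simp: Int_stable_def)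
  moreover have "{S :: 'm set. open S} \<subseteq> Pow UNIV" by simp
  moreover have "B \<in> sigma_sets UNIV {S. open S}" using B by (simp add: sets_borel)
  ultimately show ?thesis
  proof (induction rule: sigma_sets_induct_disjoint)
    case (basic U)
    have eq: "(\<Sum>x\<in>\<eta>. indicator U x) = (of_nat (card (\<eta> \<inter> U)) :: ennreal)" if "\<eta> \<in> space config_borel" for \<eta>
      using that by (intro sum_indicator_card) (simp add: finite_configs_def)
    have ge: "{\<eta> \<in> space config_borel. k \<le> card (\<eta> \<inter> U)} \<in> sets config_borel" for k
      using sets_config_borelI[OF config_open_card[of U k]] basic by (simp add: finite_configs_def)
    have "(\<lambda>\<eta>. card (\<eta> \<inter> U)) \<in> measurable config_borel (count_space UNIV)"
    proof (subst measurable_count_space_eq2_countable, intro conjI ballI)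
      fix k
      have "(\<lambda>\<eta>. card (\<eta> \<inter> U)) -` {k} \<inter> space config_borel =
        {\<eta> \<in> space config_borel. k \<le> card (\<eta> \<inter> U)} - {\<eta> \<in> space config_borel. Suc k \<le> card (\<eta> \<inter> U)}" by auto
      then show "(\<lambda>\<eta>. card (\<eta> \<inter> U)) -` {k} \<inter> space config_borel \<in> sets config_borel" using ge by auto
    qed auto
    then have "(\<lambda>\<eta>. of_nat (card (\<eta> \<inter> U)) :: ennreal) \<in> borel_measurable config_borel"
      by (rule measurable_compose) simp
    then show ?case using eq by (subst measurable_cong) auto
  next
    case (compl A)
    have U: "(\<lambda>\<eta>. \<Sum>x\<in>\<eta>. indicator UNIV x :: ennreal) \<in> borel_measurable config_borel"
    proof -
      have ge: "{\<eta> \<in> space config_borel. k \<le> card \<eta>} \<in> sets config_borel" for k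
        using sets_config_borelI[OF config_open_card[of UNIV k]] by (simp add: finite_configs_def)
      have "card \<in> measurable config_borel (count_space UNIV)"
      proof (subst measurable_count_space_eq2_countable, intro conjI ballI)
        fix k
        have eq: "card -` {k} \<inter> space config_borel =
          {\<eta> \<in> space config_borel. k \<le> card \<eta>} - {\<eta> \<in> space config_borel. Suc k \<le> card \<eta>}" by auto
        show "card -` {k} \<inter> space config_borel \<in> sets config_borel" unfolding eq by (intro sets.Diff ge)
      qed auto
      then have "(\<lambda>\<eta>. of_nat (card \<eta>) :: ennreal) \<in> borel_measurable config_borel"
        by (rule measurable_compose) simp
      then show ?thesis by simp
    qed
    \<comment> \<open>Configurations are finite, so the subtraction of extended values is an honest
      one.\<close>
    have "(\<Sum>x\<in>\<eta>. indicator (UNIV - A) x :: ennreal) = (\<Sum>x\<in>\<eta>. indicator UNIV x) - (\<Sum>x\<in>\<eta>. indicator A x)"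
      if "\<eta> \<in> space config_borel" for \<eta>
    proof -
      have f: "finite \<eta>" using that by (simp add: finite_configs_def)
      have "card \<eta> = card (\<eta> \<inter> A) + card (\<eta> \<inter> (UNIV - A))"
        using f by (subst card_Un_disjoint[symmetric]) (auto intro: arg_cong[where f = card])
      then show ?thesis using f by (simp add: sum_indicator_card)
    qed
    then show ?case using borel_measurable_minus_ennreal[OF U compl.IH] by (subst measurable_cong) auto
  next
    case (union A)
    have "(\<Sum>x\<in>\<eta>. indicator (\<Union>i. A i) x :: ennreal) = (\<Sum>i. \<Sum>x\<in>\<eta>. indicator (A i) x)" for \<eta>
    proof -
      have "(\<Sum>x\<in>\<eta>. indicator (\<Union>i. A i) x :: ennreal) = (\<Sum>x\<in>\<eta>. \<Sum>i. indicator (A i) x)"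
        using union(1) by (simp add: suminf_indicator)
      also have "\<dots> = (\<Sum>i. \<Sum>x\<in>\<eta>. indicator (A i) x)" by (rule suminf_sum[symmetric]) (rule summableI)
      finally show ?thesis .
    qed
    then show ?case using union(3) by simp
  qed simp
qed

lemma measurable_card_Int:
  assumes B: "B \<in> sets (borel :: 'm::topological_space measure)"
  shows "(\<lambda>\<eta>. card (\<eta> \<inter> B)) \<in> measurable config_borel (count_space UNIV)"
proof (subst measurable_count_space_eq2_countable, intro conjI ballI)
  fix k
  have "(\<lambda>\<eta>. card (\<eta> \<inter> B)) -` {k} \<inter> space config_borel =
    (\<lambda>\<eta>. \<Sum>x\<in>\<eta>. indicator B x :: ennreal) -` {of_nat k} \<inter> space config_borel"
    by (auto simp: sum_indicator_card finite_configs_def)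
  then show "(\<lambda>\<eta>. card (\<eta> \<inter> B)) -` {k} \<inter> space config_borel \<in> sets config_borel"
    using measurable_sets[OF measurable_count_ennreal[OF B], of "{of_nat k}"] by (simp del: space_config_borel)
qed auto

lemma coherent_simple_measurable:
  assumes f: "simple_function (borel :: 'm::topological_space measure) f"
  shows "coherent f \<in> borel_measurable config_borel"
proof -
  have fin: "finite (range f)" using simple_functionD(1)[OF f] by simp
  have pre: "f -` {c} \<in> sets borel" for c using simple_functionD(2)[OF f, of "{c}"] by simp
  have "(\<lambda>\<eta>. \<Prod>c\<in>range f. c ^ card (\<eta> \<inter> f -` {c})) \<in> borel_measurable config_borel"
    by (intro borel_measurable_prod measurable_compose[OF measurable_card_Int[OF pre]]) auto
  moreover have "coherent f \<eta> = (\<Prod>c\<in>range f. c ^ card (\<eta> \<inter> f -` {c}))" if "\<eta> \<in> space config_borel" for \<eta>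
  proof -
    have \<eta>: "finite \<eta>" using that by (simp add: finite_configs_def)
    have "coherent f \<eta> = (\<Prod>c\<in>range f. \<Prod>x\<in>{x \<in> \<eta>. f x = c}. f x)"
      unfolding coherent_def by (rule prod.group[symmetric]) (use \<eta> fin in auto)
    also have "\<dots> = (\<Prod>c\<in>range f. \<Prod>x\<in>\<eta> \<inter> f -` {c}. c)"
      by (intro prod.cong refl) auto
    finally show ?thesis by simp
  qed
  ultimately show ?thesis by (subst measurable_cong) auto
qed

lemma coherent_measurable:
  assumes f: "f \<in> borel_measurable (borel :: 'm::topological_space measure)"
  shows "coherent f \<in> borel_measurable config_borel"
proof -
  obtain F where F: "\<And>i. simple_function borel (F i)" "\<And>x. (\<lambda>i. F i x) \<longlonglongrightarrow> f x"
    using borel_measurable_implies_sequence_metric[OF f, of 0] by auto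
  show ?thesis
  proof (rule borel_measurable_LIMSEQ_metric)
    show "coherent (F i) \<in> borel_measurable config_borel" for i by (rule coherent_simple_measurable[OF F(1)])
    show "(\<lambda>i. coherent (F i) \<eta>) \<longlonglongrightarrow> coherent f \<eta>" for \<eta>
      unfolding coherent_def by (intro tendsto_intros F(2))
  qed
qed

text \<open>The derivative of \<open>\<epsilon> \<mapsto> coherent (f + \<epsilon> g) \<eta>\<close> at \<open>0\<close>; as such it is measurable in \<open>\<eta>\<close>.\<close>

definition dcoherent :: "('m \<Rightarrow> complex) \<Rightarrow> ('m \<Rightarrow> complex) \<Rightarrow> 'm set \<Rightarrow> complex" where
  "dcoherent f g \<eta> = (\<Sum>x\<in>\<eta>. g x * coherent f (\<eta> - {x}))"

lemma dcoherent_measurable: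
  assumes f: "f \<in> borel_measurable (borel :: 'm::topological_space measure)" and g: "g \<in> borel_measurable borel"
  shows "dcoherent f g \<in> borel_measurable config_borel"
proof (rule borel_measurable_LIMSEQ_metric)
  define h where "h i = complex_of_real (inverse (real (Suc i)))" for i
  have h0: "h i \<noteq> 0" for i by (simp add: h_def del: of_nat_Suc)
  have hl: "h \<longlonglongrightarrow> 0"
    unfolding h_def[abs_def] using tendsto_of_real[OF LIMSEQ_inverse_real_of_nat, where 'a = complex]
    by (simp only: of_real_0)
  show "(\<lambda>\<eta>. (coherent (\<lambda>x. f x + h i * g x) \<eta> - coherent f \<eta>) / h i) \<in> borel_measurable config_borel" for i
    using f g by (intro borel_measurable_divide borel_measurable_diff coherent_measurable borel_measurable_add borel_measurable_times) auto
  show "(\<lambda>i. (coherent (\<lambda>x. f x + h i * g x) \<eta> - coherent f \<eta>) / h i) \<longlonglongrightarrow> dcoherent f g \<eta>" for \<eta>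
  proof -
    have "((\<lambda>u. \<Prod>x\<in>\<eta>. f x + u * g x) has_field_derivative (\<Sum>x\<in>\<eta>. g x * (\<Prod>y\<in>\<eta> - {x}. f y + 0 * g y))) (at 0)"
      by (intro has_field_derivative_prod) (auto intro!: derivative_eq_intros)
    then have "((\<lambda>u. (coherent (\<lambda>x. f x + u * g x) \<eta> - coherent f \<eta>) / u) \<longlongrightarrow> dcoherent f g \<eta>) (at 0)"
      by (simp add: has_field_derivative_iff coherent_def dcoherent_def)
    moreover have "filterlim h (at 0) sequentially"
      using hl h0 by (simp add: filterlim_at)
    ultimately show ?thesis by (rule filterlim_compose)
  qed
qed

text \<open>\<open>config_open\<close> speaks of a product topology on restricted tuples,
  \<open>PiM\<close> of a sigma-algebra. Both are compared on functions on all of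
  \<open>nat\<close>, where second countability identifies Borel sets with the product
  sigma-algebra; coordinates outside \<open>{..<n}\<close> are constantly
  \<open>undefined\<close>.\<close>

lemma openin_product_sets:
  assumes O: "openin (product_topology (\<lambda>_. euclidean :: 'm::second_countable_topology topology) {..<n::nat}) W"
  shows "W \<in> sets (PiM {..<n} (\<lambda>_. borel :: 'm measure))"
proof -
  let ?r = "\<lambda>y::nat \<Rightarrow> 'm. restrict y {..<n}"
  have sub: "W \<subseteq> PiE {..<n} (\<lambda>_. UNIV)" using openin_subset[OF O] by simp
  have "continuous_map euclidean (product_topology (\<lambda>_. euclidean) {..<n}) ?r"
    by (auto simp: continuous_map_componentwise)
  then have "open (?r -` W)" using O by (auto simp: continuous_map_def vimage_def)
  then have "?r -` W \<in> sets (PiM UNIV (\<lambda>_. borel))" by (simp add: sets_PiM_equal_borel)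
  moreover have "(\<lambda>x i. x i) \<in> measurable (PiM {..<n} (\<lambda>_. borel :: 'm measure)) (PiM UNIV (\<lambda>_. borel))"
  proof (rule measurable_PiM_single')
    fix i
    show "(\<lambda>x. x i) \<in> borel_measurable (PiM {..<n} (\<lambda>_. borel :: 'm measure))"
    proof (cases "i < n")
      case False
      then have "x i = undefined" if "x \<in> space (PiM {..<n} (\<lambda>_. borel :: 'm measure))" for x
        using that by (auto simp: space_PiM PiE_def extensional_def)
      then show ?thesis by (subst measurable_cong[where g = "\<lambda>_. undefined"]) auto
    qed simp
  qed auto
  ultimately have "(\<lambda>x i. x i) -` (?r -` W) \<inter> space (PiM {..<n} (\<lambda>_. borel :: 'm measure)) \<in> sets (PiM {..<n} (\<lambda>_. borel :: 'm measure))"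
    by (rule measurable_sets[rotated])
  moreover have "(\<lambda>x i. x i) -` (?r -` W) \<inter> space (PiM {..<n} (\<lambda>_. borel :: 'm measure)) = W"
    using sub by (auto simp: space_PiM PiE_restrict)
  ultimately show ?thesis by simp
qed

section \<open>Integration against the configuration measures\<close>

lemma suminf_ennreal_commute: "(\<Sum>n. \<Sum>i. f n i) = (\<Sum>i. \<Sum>n. f n i :: ennreal)"
proof -
  have "(\<Sum>n. \<Sum>i. f n i) = (\<integral>\<^sup>+n. (\<Sum>i. f n i) \<partial>count_space UNIV)" by (simp add: nn_integral_count_space_nat)
  also have "\<dots> = (\<Sum>i. \<integral>\<^sup>+n. f n i \<partial>count_space UNIV)" by (rule nn_integral_suminf) simp
  finally show ?thesis by (simp add: nn_integral_count_space_nat)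
qed

lemma nn_integral_weighted_sum:
  fixes w :: "nat \<Rightarrow> ennreal"
  assumes sN: "\<And>n. sets (N n) = sets M"
    and em: "\<And>B. B \<in> sets M \<Longrightarrow> emeasure M B = (\<Sum>n. w n * emeasure (N n) B)"
    and f: "f \<in> borel_measurable M"
  shows "(\<integral>\<^sup>+x. f x \<partial>M) = (\<Sum>n. w n * (\<integral>\<^sup>+x. f x \<partial>N n))"
  using f
proof (induction rule: borel_measurable_induct)
  case (cong f g)
  have "(\<integral>\<^sup>+x. f x \<partial>N n) = (\<integral>\<^sup>+x. g x \<partial>N n)" for n
    using cong(3) sets_eq_imp_space_eq[OF sN] by (intro nn_integral_cong) auto
  then show ?case using cong by (simp cong: nn_integral_cong)
next
  case (set A)
  then show ?case by (simp add: em sN)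
next
  case (mult u c)
  have "u \<in> borel_measurable (N n)" for n using mult measurable_cong_sets[OF sN refl] by blast
  then have "(\<integral>\<^sup>+x. c * u x \<partial>N n) = c * (\<integral>\<^sup>+x. u x \<partial>N n)" for n by (rule nn_integral_cmult)
  moreover have "(\<integral>\<^sup>+x. c * u x \<partial>M) = c * (\<integral>\<^sup>+x. u x \<partial>M)" using mult by (intro nn_integral_cmult) auto
  ultimately show ?case using mult by (simp add: mult.left_commute)
next
  case (add u v)
  have "u \<in> borel_measurable (N n)" "v \<in> borel_measurable (N n)" for n using add measurable_cong_sets[OF sN refl] by blast+
  then have "(\<integral>\<^sup>+x. v x + u x \<partial>N n) = (\<integral>\<^sup>+x. v x \<partial>N n) + (\<integral>\<^sup>+x. u x \<partial>N n)" for n by (intro nn_integral_add)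
  moreover have "(\<integral>\<^sup>+x. v x + u x \<partial>M) = (\<integral>\<^sup>+x. v x \<partial>M) + (\<integral>\<^sup>+x. u x \<partial>M)" using add by (intro nn_integral_add) auto
  ultimately show ?case using add by (simp add: distrib_left suminf_add)
next
  case (seq U)
  have UN: "U i \<in> borel_measurable (N n)" for n i using seq measurable_cong_sets[OF sN refl] by blast
  have eqN: "(\<integral>\<^sup>+x. (SUP i. U i) x \<partial>N n) = (SUP i. \<integral>\<^sup>+x. U i x \<partial>N n)" for n
    unfolding SUP_apply by (intro nn_integral_monotone_convergence_SUP seq UN)
  have inc: "incseq (\<lambda>i. w n * (\<integral>\<^sup>+x. U i x \<partial>N n))" for n
    using seq by (intro incseq_SucI mult_left_mono nn_integral_mono) (auto simp: incseq_Suc_iff le_fun_def)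
  have "(\<integral>\<^sup>+x. (SUP i. U i) x \<partial>M) = (SUP i. \<integral>\<^sup>+x. U i x \<partial>M)"
    unfolding SUP_apply by (intro nn_integral_monotone_convergence_SUP seq)
  also have "\<dots> = (SUP i. \<Sum>n. w n * (\<integral>\<^sup>+x. U i x \<partial>N n))" using seq by simp
  also have "\<dots> = (\<Sum>n. SUP i. w n * (\<integral>\<^sup>+x. U i x \<partial>N n))" by (rule ennreal_suminf_SUP_eq[OF inc, symmetric])
  also have "\<dots> = (\<Sum>n. w n * (\<integral>\<^sup>+x. (SUP i. U i) x \<partial>N n))" by (simp only: eqN SUP_mult_left_ennreal)
  finally show ?case .
qed

locale config_space = fock_space \<mu> for \<mu> :: "'m::{t2_space,second_countable_topology} measure" +
  assumes sets_mu: "sets \<mu> = sets borel" and singleton_null: "emeasure \<mu> {x} = 0"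
begin

abbreviation "Pn n \<equiv> PiM {..<n} (\<lambda>_::nat. \<mu>)"

lemma sets_Pn: "sets (Pn n) = sets (PiM {..<n} (\<lambda>_. borel))"
  by (rule sets_PiM_cong) (auto simp: sets_mu)

lemma space_mu [simp]: "space \<mu> = UNIV"
  using sets_eq_imp_space_eq[OF sets_mu] by simp

lemma space_Pn: "space (Pn n) = PiE {..<n} (\<lambda>_. UNIV)"
  by (simp add: space_PiM)

lemma coincidence_sets: assumes "i < n" "j < n" shows "{x \<in> space (Pn n). x i = x j} \<in> sets (Pn n)"
proof -
  have c: "(\<lambda>x. x k) \<in> borel_measurable (Pn n)" if "k < n" for k
  proof -
    have "(\<lambda>x. x k) \<in> measurable (Pn n) \<mu>" using that by simp
    then show ?thesis using measurable_cong_sets[OF refl sets_mu] by blast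
  qed
  show ?thesis using c[OF assms(1)] c[OF assms(2)] by (rule measurable_equality_set)
qed

lemma tuples_distinct_sets: "tuples_distinct n \<in> sets (Pn n)"
proof -
  have eq: "tuples_distinct n = space (Pn n) - (\<Union>i\<in>{..<n}. \<Union>j\<in>{..<n} - {i}. {x \<in> space (Pn n). x i = x j})"
    by (auto simp: tuples_distinct_def space_Pn inj_on_def)
  show ?thesis unfolding eq by (intro sets.Diff sets.top sets.finite_UN coincidence_sets) auto
qed

text \<open>Fubini in the coordinate \<open>i\<close>: with the other coordinates fixed, a
  coincidence with \<open>x j\<close> leaves the single point \<open>x j\<close>, which is
  null.\<close>

lemma AE_tuples_distinct: "AE x in Pn n. x \<in> tuples_distinct n"
proof -
  have "AE x in Pn n. x i \<noteq> x j" if ij: "i < n" "j < n" "i \<noteq> j" for i j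
  proof -
    let ?N = "{x \<in> space (Pn n). x i = x j}"
    have ins: "insert i ({..<n} - {i}) = {..<n}" using ij by auto
    have N: "?N \<in> sets (Pn n)" using ij coincidence_sets by blast
    have "emeasure (Pn n) ?N = (\<integral>\<^sup>+x. indicator ?N x \<partial>Pn n)" using N by simp
    also have "\<dots> = (\<integral>\<^sup>+x. (\<integral>\<^sup>+y. indicator ?N (x(i := y)) \<partial>\<mu>) \<partial>PiM ({..<n} - {i}) (\<lambda>_. \<mu>))"
      by (rule P.product_nn_integral_insert[of "{..<n} - {i}" i "indicator ?N", unfolded ins]) (use N in auto)
    also have "\<dots> = (\<integral>\<^sup>+x. 0 \<partial>PiM ({..<n} - {i}) (\<lambda>_. \<mu>))"
    proof (rule nn_integral_cong)
      fix x
      have "(\<integral>\<^sup>+y. indicator ?N (x(i := y)) \<partial>\<mu>) \<le> (\<integral>\<^sup>+y. indicator {x j} y \<partial>\<mu>)"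
        using ij by (intro nn_integral_mono) (auto simp: indicator_def)
      also have "\<dots> = 0" using singleton_null by (simp add: sets_mu)
      finally show "(\<integral>\<^sup>+y. indicator ?N (x(i := y)) \<partial>\<mu>) = 0" by simp
    qed
    finally have "?N \<in> null_sets (Pn n)" using N by (auto intro: null_setsI)
    then show ?thesis by (rule AE_I'[of ?N]) auto
  qed
  then have "AE x in Pn n. \<forall>i\<in>{..<n}. \<forall>j\<in>{..<n}. i \<noteq> j \<longrightarrow> x i \<noteq> x j"
    by (intro AE_finite_allI) auto
  moreover have "AE x in Pn n. x \<in> space (Pn n)" by (rule AE_space)
  ultimately show ?thesis
    by eventually_elim (auto simp: tuples_distinct_def space_Pn inj_on_def)
qed

lemma measurable_config_map:
  "(\<lambda>x. x ` {..<n}) \<in> measurable (restrict_space (Pn n) (tuples_distinct n)) config_borel"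
  unfolding config_borel_def
proof (rule measurable_measure_of[OF config_open_Pow])
  show "(\<lambda>x. x ` {..<n}) \<in> space (restrict_space (Pn n) (tuples_distinct n)) \<rightarrow> finite_configs"
    by (auto simp: finite_configs_def)
  fix W :: "'m set set" assume "W \<in> {W. config_open W}"
  then obtain V where V: "openin (product_topology (\<lambda>_. euclidean) {..<n}) V"
    "{x \<in> tuples_distinct n. x ` {..<n} \<in> W} = V \<inter> tuples_distinct n"
    unfolding config_open_def openin_subtopology by blast
  have VS: "V \<in> sets (Pn n)" using openin_product_sets[OF V(1)] by (simp add: sets_Pn)
  have T: "tuples_distinct n \<inter> space (Pn n) = tuples_distinct n" by (auto simp: tuples_distinct_def space_Pn)
  have "(\<lambda>x. x ` {..<n}) -` W \<inter> space (restrict_space (Pn n) (tuples_distinct n)) = tuples_distinct n \<inter> V"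
    using V(2) T by (auto simp: space_restrict_space)
  then show "(\<lambda>x. x ` {..<n}) -` W \<inter> space (restrict_space (Pn n) (tuples_distinct n)) \<in> sets (restrict_space (Pn n) (tuples_distinct n))"
    using VS by (auto simp: sets_restrict_space)
qed

lemma sets_n_point [simp]: "sets (n_point_measure \<mu> n) = sets config_borel"
  by (simp add: n_point_measure_def)

lemma nn_integral_n_point:
  assumes f: "f \<in> borel_measurable config_borel"
  shows "(\<integral>\<^sup>+\<eta>. f \<eta> \<partial>n_point_measure \<mu> n) = (\<integral>\<^sup>+x. f (x ` {..<n}) * indicator (tuples_distinct n) x \<partial>Pn n)"
proof -
  have "tuples_distinct n \<inter> space (Pn n) \<in> sets (Pn n)" using tuples_distinct_sets by blast
  then show ?thesis
    unfolding n_point_measure_def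
    by (subst nn_integral_distr[OF measurable_config_map]) (simp_all add: f nn_integral_restrict_space)
qed

lemma sets_weighted [simp]: "sets (weighted_config_measure w \<mu>) = sets config_borel"
  unfolding weighted_config_measure_def
  using sets.sigma_sets_eq[of config_borel] sets.space_closed[of config_borel] by (subst sets_measure_of) auto

lemma emeasure_weighted:
  assumes B: "B \<in> sets config_borel"
  shows "emeasure (weighted_config_measure w \<mu>) B = (\<Sum>n. ennreal (w n) * emeasure (n_point_measure \<mu> n) B)"
proof (rule emeasure_measure_of[OF weighted_config_measure_def])
  show "sets config_borel \<subseteq> Pow finite_configs" using sets.space_closed[of config_borel] by simp
  show "B \<in> sets (weighted_config_measure w \<mu>)" using B by simp
  show "positive (sets (weighted_config_measure w \<mu>)) (\<lambda>B. \<Sum>n. ennreal (w n) * emeasure (n_point_measure \<mu> n) B)"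
    by (simp add: positive_def)
  show "countably_additive (sets (weighted_config_measure w \<mu>)) (\<lambda>B. \<Sum>n. ennreal (w n) * emeasure (n_point_measure \<mu> n) B)"
  proof (rule countably_additiveI)
    fix A :: "nat \<Rightarrow> 'm set set" assume A: "range A \<subseteq> sets (weighted_config_measure w \<mu>)" "disjoint_family A"
    have "(\<Sum>i. emeasure (n_point_measure \<mu> n) (A i)) = emeasure (n_point_measure \<mu> n) (\<Union>i. A i)" for n
      using A by (intro suminf_emeasure) auto
    then show "(\<Sum>i. \<Sum>n. ennreal (w n) * emeasure (n_point_measure \<mu> n) (A i)) = (\<Sum>n. ennreal (w n) * emeasure (n_point_measure \<mu> n) (\<Union>i. A i))"
      by (subst suminf_ennreal_commute) simp
  qed
qed

lemma nn_integral_weighted: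
  assumes f: "f \<in> borel_measurable config_borel"
  shows "(\<integral>\<^sup>+\<eta>. f \<eta> \<partial>weighted_config_measure w \<mu>) =
    (\<Sum>n. ennreal (w n) * (\<integral>\<^sup>+x. f (x ` {..<n}) * indicator (tuples_distinct n) x \<partial>Pn n))"
proof -
  have f': "f \<in> borel_measurable (weighted_config_measure w \<mu>)"
    using f measurable_cong_sets[OF sets_weighted refl] by blast
  show ?thesis
    using nn_integral_weighted_sum[OF _ _ f', of "n_point_measure \<mu>" "\<lambda>n. ennreal (w n)"] emeasure_weighted
    by (simp add: nn_integral_n_point[OF f])
qed

end

section \<open>The fractional second quantization\<close>

lemma L2_cong_AE:
  assumes f: "f \<in> vecs (L2 M)" and g: "g \<in> borel_measurable M" and ae: "AE x in M. f x = g x"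
  shows "g \<in> vecs (L2 M)" "hnorm (L2 M) (f - g) = 0"
proof -
  interpret semi_inner "L2 M" by (rule semi_inner_L2)
  have "integrable M (\<lambda>x. (norm (f x))\<^sup>2) \<longleftrightarrow> integrable M (\<lambda>x. (norm (g x))\<^sup>2)"
    using f g ae by (intro integrable_cong_AE) (auto simp: L2_vecs)
  then show gV: "g \<in> vecs (L2 M)" using f g by (simp add: L2_vecs)
  have "AE x in M. (f - g) x = 0" using ae by eventually_elim (simp add: minus_apply)
  then show "hnorm (L2 M) (f - g) = 0" using L2_null_iff[of "f - g" M] f gV by auto
qed

section \<open>Equality almost everywhere in the Fock space\<close>

context fock_space
begin

lemma fock_cong_AE:
  assumes F: "F \<in> vecs (fock \<mu>)" and G: "\<And>n. sector G n \<in> borel_measurable (PiM {..<n} (\<lambda>_. \<mu>))" "\<And>n. perm_inv G n"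
    and ae: "\<And>n. AE x in PiM {..<n} (\<lambda>_. \<mu>). sector F n x = sector G n x"
  shows "G \<in> vecs (fock \<mu>)" "hnorm (fock \<mu>) (F - G) = 0"
proof -
  have *: "sector G n \<in> vecs (LL n)" "hnorm (LL n) (sector F n - sector G n) = 0" for n
    using L2_cong_AE[OF sector_mem[OF F] G(1) ae] by auto
  have "hnorm (LL n) (sector F n) = hnorm (LL n) (sector G n)" for n
    using * F by (intro L.nrm_cong) auto
  then show GV: "G \<in> vecs (fock \<mu>)" using fock_summable_norm[OF F] * G(2) by (simp add: fock_vecs)
  have "F - G \<in> vecs (fock \<mu>)" using F GV by auto
  then have "(hnorm (fock \<mu>) (F - G))\<^sup>2 = 0" by (simp add: fock_nrm_sq sector_simps *)
  then show "hnorm (fock \<mu>) (F - G) = 0" by simp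
qed

lemma fock_null_AE:
  assumes F: "F \<in> vecs (fock \<mu>)" and G: "G \<in> vecs (fock \<mu>)" and z: "hnorm (fock \<mu>) (F - G) = 0"
  shows "AE x in PiM {..<n} (\<lambda>_. \<mu>). sector F n x = sector G n x"
proof -
  have d: "F - G \<in> vecs (fock \<mu>)" using F G by auto
  have "hnorm (LL n) (sector (F - G) n) = 0"
    using fock_term_le[OF d, of n] L.nrm_nonneg[OF sector_mem[OF d], of n] z by simp
  then have "AE x in PiM {..<n} (\<lambda>_. \<mu>). sector (F - G) n x = 0"
    using L2_null_iff[OF sector_mem[OF d]] by blast
  then show ?thesis by eventually_elim (simp add: sector_simps minus_apply)
qed

end

section \<open>Configurations and the Fock space\<close>

context config_space
begin

lemma sector_fock_iso: "sector (fock_iso G) n x = (if inj_on x {..<n} then G (x ` {..<n}) / fact n else 0)"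
  by (simp add: sector_def fock_iso_def)

lemma fock_iso_sector_measurable:
  assumes G: "G \<in> borel_measurable config_borel"
  shows "sector (fock_iso G) n \<in> borel_measurable (Pn n)"
proof -
  have "(\<lambda>x. G (x ` {..<n}) / fact n) \<in> borel_measurable (restrict_space (Pn n) (tuples_distinct n))"
    using measurable_compose[OF measurable_config_map G] by simp
  moreover have "tuples_distinct n \<inter> space (Pn n) \<in> sets (Pn n)" using tuples_distinct_sets by blast
  ultimately have "(\<lambda>x. indicator (tuples_distinct n) x *\<^sub>R (G (x ` {..<n}) / fact n)) \<in> borel_measurable (Pn n)"
    by (simp add: borel_measurable_restrict_space_iff)
  moreover have "indicator (tuples_distinct n) x *\<^sub>R (G (x ` {..<n}) / fact n) = sector (fock_iso G) n x" if "x \<in> space (Pn n)" for x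
    using that by (auto simp: sector_fock_iso tuples_distinct_def space_Pn)
  ultimately show ?thesis by (subst measurable_cong[symmetric]) auto
qed

lemma perm_inv_fock_iso: "perm_inv (fock_iso G) n"
proof -
  have "fock_iso G (n, x \<circ> \<sigma>) = fock_iso G (n, x)" if s: "\<sigma> permutes {..<n}" for x \<sigma>
  proof -
    have i: "(x \<circ> \<sigma>) ` {..<n} = x ` {..<n}" using permutes_image[OF s] by (simp only: image_comp[symmetric])
    have "inj_on (x \<circ> \<sigma>) {..<n} \<longleftrightarrow> inj_on x {..<n}"
      using comp_inj_on_iff[of \<sigma> "{..<n}" x] permutes_inj_on[OF s] permutes_image[OF s] by simp
    then show ?thesis using i by (simp add: fock_iso_def)
  qed
  then show ?thesis by (simp add: perm_inv_def)
qed

lemma coherent_image: "inj_on x {..<n} \<Longrightarrow> coherent f (x ` {..<n}) = (\<Prod>i<n. f (x i))" for x :: "nat \<Rightarrow> 'm"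
  by (simp add: coherent_def prod.reindex)

lemma dcoherent_image:
  fixes x :: "nat \<Rightarrow> 'm"
  assumes "inj_on x {..<n}"
  shows "dcoherent f g (x ` {..<n}) = (\<Sum>i<n. \<Prod>j<n. (if j = i then g else f) (x j))"
proof -
  have "dcoherent f g (x ` {..<n}) = (\<Sum>i<n. g (x i) * coherent f (x ` {..<n} - {x i}))"
    using assms by (simp add: dcoherent_def sum.reindex)
  also have "\<dots> = (\<Sum>i<n. \<Prod>j<n. (if j = i then g else f) (x j))"
  proof (rule sum.cong)
    fix i assume i: "i \<in> {..<n}"
    have "x ` {..<n} - {x i} = x ` ({..<n} - {i})" using assms i by (auto simp: inj_on_def)
    then have "coherent f (x ` {..<n} - {x i}) = (\<Prod>j\<in>{..<n} - {i}. f (x j))"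
      using assms by (simp add: coherent_def prod.reindex inj_on_diff)
    then show "g (x i) * coherent f (x ` {..<n} - {x i}) = (\<Prod>j<n. (if j = i then g else f) (x j))"
      using i by (simp add: prod.remove[of "{..<n}" i])
  qed simp
  finally show ?thesis .
qed

lemma AE_inj: "AE x in Pn n. inj_on x {..<n}"
  using AE_tuples_distinct by eventually_elim (simp add: tuples_distinct_def)

lemma borel_of_L2: "f \<in> vecs (L2 \<mu>) \<Longrightarrow> f \<in> borel_measurable borel"
  using measurable_cong_sets[OF sets_mu refl] by (auto simp: L2_vecs)

lemma fock_iso_coherent:
  assumes f: "f \<in> vecs (L2 \<mu>)"
  shows "fock_iso (coherent f) \<in> vecs (fock \<mu>)" "hnorm (fock \<mu>) (fock_coherent f - fock_iso (coherent f)) = 0"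
proof -
  have "AE x in Pn n. sector (fock_coherent f) n x = sector (fock_iso (coherent f)) n x" for n
    using AE_inj
    by eventually_elim (simp add: sector_fock_iso coherent_image, simp add: sector_def fock_coherent_def)
  note fock_cong_AE[OF coherent_mem[OF f] fock_iso_sector_measurable[OF coherent_measurable[OF borel_of_L2[OF f]]] perm_inv_fock_iso this]
  then show "fock_iso (coherent f) \<in> vecs (fock \<mu>)" "hnorm (fock \<mu>) (fock_coherent f - fock_iso (coherent f)) = 0" by auto
qed

lemma fock_iso_dcoherent:
  assumes f: "f \<in> vecs (L2 \<mu>)" and g: "g \<in> vecs (L2 \<mu>)"
  shows "fock_iso (dcoherent f g) \<in> vecs (fock \<mu>)" "hnorm (fock \<mu>) (dcoh f g - fock_iso (dcoherent f g)) = 0"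
proof -
  have "AE x in Pn n. sector (dcoh f g) n x = sector (fock_iso (dcoherent f g)) n x" for n
    using AE_inj
    by eventually_elim (simp add: sector_fock_iso dcoherent_image, simp add: sector_def dcoh_def)
  note fock_cong_AE[OF dcoh_mem[OF f g] fock_iso_sector_measurable[OF dcoherent_measurable[OF borel_of_L2[OF f] borel_of_L2[OF g]]] perm_inv_fock_iso this]
  then show "fock_iso (dcoherent f g) \<in> vecs (fock \<mu>)" "hnorm (fock \<mu>) (dcoh f g - fock_iso (dcoherent f g)) = 0" by auto
qed

lemma borel_measurable_weighted: "borel_measurable (weighted_config_measure w \<mu>) = borel_measurable config_borel"
  using measurable_cong_sets[OF sets_weighted refl] by blast

text \<open>With \<open>g = G / fact n\<close> on the sector \<open>n\<close>,
  \<open>1 / fact n\<close> times the squared modulus of \<open>G\<close> is \<open>fact n\<close>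
  times that of \<open>g\<close>, so the two squared norms agree term by term.
  \<open>conj_op\<close> demands the membership.\<close>

lemma L2_lebesgue_poisson_fock:
  assumes G: "G \<in> borel_measurable config_borel" and F: "fock_iso G \<in> vecs (fock \<mu>)"
  shows "G \<in> vecs (L2 (lebesgue_poisson \<mu>))"
proof (rule L2_vecsI_nn)
  show "G \<in> borel_measurable (lebesgue_poisson \<mu>)" using G by (simp add: lebesgue_poisson_def borel_measurable_weighted)
  let ?I = "\<lambda>n. \<integral>\<^sup>+x. ennreal ((norm (G (x ` {..<n})))\<^sup>2) * indicator (tuples_distinct n) x \<partial>Pn n"
  have t: "ennreal (1 / fact n) * ?I n = ennreal (fact n * (hnorm (LL n) (sector (fock_iso G) n))\<^sup>2)" for n
  proof -
    have m: "(\<lambda>x. ennreal ((norm (sector (fock_iso G) n x))\<^sup>2)) \<in> borel_measurable (Pn n)"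
      using fock_iso_sector_measurable[OF G] by measurable
    have eq: "ennreal ((norm (G (x ` {..<n})))\<^sup>2) * indicator (tuples_distinct n) x = ennreal (fact n * fact n) * ennreal ((norm (sector (fock_iso G) n x))\<^sup>2)"
      if "x \<in> space (Pn n)" for x
      using that by (auto simp: sector_fock_iso tuples_distinct_def space_Pn norm_divide power_divide power2_eq_square simp flip: ennreal_mult)
    have "?I n = (\<integral>\<^sup>+x. ennreal (fact n * fact n) * ennreal ((norm (sector (fock_iso G) n x))\<^sup>2) \<partial>Pn n)"
      by (rule nn_integral_cong) (rule eq)
    also have "\<dots> = ennreal (fact n * fact n) * (\<integral>\<^sup>+x. ennreal ((norm (sector (fock_iso G) n x))\<^sup>2) \<partial>Pn n)"
      by (rule nn_integral_cmult[OF m])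
    also have "\<dots> = ennreal (fact n * fact n * (hnorm (LL n) (sector (fock_iso G) n))\<^sup>2)"
      using L2_nrm_nn[OF sector_mem[OF F]] by (simp add: ennreal_mult)
    finally have "ennreal (1 / fact n) * ?I n = ennreal (1 / fact n * (fact n * fact n * (hnorm (LL n) (sector (fock_iso G) n))\<^sup>2))"
      by (simp only: ennreal_mult' divide_nonneg_nonneg fact_ge_zero zero_le_one)
    then show ?thesis by simp
  qed
  have "(\<integral>\<^sup>+\<eta>. ennreal ((norm (G \<eta>))\<^sup>2) \<partial>lebesgue_poisson \<mu>) = (\<Sum>n. ennreal (1 / fact n) * ?I n)"
    unfolding lebesgue_poisson_def using G by (intro nn_integral_weighted) measurable
  also have "\<dots> = (\<Sum>n. ennreal (fact n * (hnorm (LL n) (sector (fock_iso G) n))\<^sup>2))" by (simp only: t)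
  also have "\<dots> \<noteq> top" by (rule ennreal_suminf_neq_top[OF fock_summable_norm[OF F]]) simp
  finally show "(\<integral>\<^sup>+\<eta>. ennreal ((norm (G \<eta>))\<^sup>2) \<partial>lebesgue_poisson \<mu>) < \<infinity>" by (simp add: less_top)
qed

lemma L2_frac_lebesgue_poisson:
  assumes \<alpha>: "\<alpha> > 0" and G: "G \<in> borel_measurable config_borel" and F: "frac_iso \<alpha> G \<in> vecs (L2 (lebesgue_poisson \<mu>))"
  shows "G \<in> vecs (L2 (frac_lebesgue_poisson \<alpha> \<mu>))"
proof (rule L2_vecsI_nn)
  show "G \<in> borel_measurable (frac_lebesgue_poisson \<alpha> \<mu>)" using G by (simp add: frac_lebesgue_poisson_def borel_measurable_weighted)
  have Fm: "frac_iso \<alpha> G \<in> borel_measurable config_borel" using F by (simp add: L2_vecs lebesgue_poisson_def borel_measurable_weighted)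
  let ?I = "\<lambda>G n. \<integral>\<^sup>+x. ennreal ((norm (G (x ` {..<n})))\<^sup>2) * indicator (tuples_distinct n) x \<partial>Pn n"
  have t: "ennreal (1 / Gamma (\<alpha> * real n + 1)) * ?I G n = ennreal (1 / fact n) * ?I (frac_iso \<alpha> G) n" for n
  proof -
    have m: "(\<lambda>x. ennreal ((norm (G (x ` {..<n})))\<^sup>2) * indicator (tuples_distinct n) x) \<in> borel_measurable (Pn n)"
    proof -
      have "(\<lambda>x. ennreal ((norm (fact n * sector (fock_iso G) n x))\<^sup>2)) \<in> borel_measurable (Pn n)"
        using fock_iso_sector_measurable[OF G] by measurable
      then show ?thesis
        by (subst measurable_cong[where g = "\<lambda>x. ennreal ((norm (fact n * sector (fock_iso G) n x))\<^sup>2)"])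
          (auto simp: sector_fock_iso tuples_distinct_def space_Pn)
    qed
    have "?I (frac_iso \<alpha> G) n = (\<integral>\<^sup>+x. ennreal (ml_deriv0 \<alpha> n) * (ennreal ((norm (G (x ` {..<n})))\<^sup>2) * indicator (tuples_distinct n) x) \<partial>Pn n)"
    proof (rule nn_integral_cong)
      fix x :: "nat \<Rightarrow> 'm"
      have "card (x ` {..<n}) = n" if "x \<in> tuples_distinct n" using that card_image[of x "{..<n}"] by (simp add: tuples_distinct_def)
      then show "ennreal ((norm (frac_iso \<alpha> G (x ` {..<n})))\<^sup>2) * indicator (tuples_distinct n) x =
        ennreal (ml_deriv0 \<alpha> n) * (ennreal ((norm (G (x ` {..<n})))\<^sup>2) * indicator (tuples_distinct n) x)"
        using ml_deriv0_pos[OF \<alpha>, of n]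
        by (auto simp: frac_iso_def norm_mult power_mult_distrib mult.commute indicator_def ennreal_mult less_imp_le)
    qed
    also have "\<dots> = ennreal (ml_deriv0 \<alpha> n) * ?I G n" by (rule nn_integral_cmult[OF m])
    finally have "ennreal (1 / fact n) * ?I (frac_iso \<alpha> G) n = (ennreal (1 / fact n) * ennreal (ml_deriv0 \<alpha> n)) * ?I G n"
      by (simp only: mult.assoc)
    also have "ennreal (1 / fact n) * ennreal (ml_deriv0 \<alpha> n) = ennreal (1 / fact n * ml_deriv0 \<alpha> n)"
      by (rule ennreal_mult'[symmetric]) simp
    finally have "ennreal (1 / fact n) * ?I (frac_iso \<alpha> G) n = ennreal (1 / fact n * ml_deriv0 \<alpha> n) * ?I G n" .
    then show ?thesis by (simp add: ml_deriv0_eq[OF \<alpha>])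
  qed
  have "(\<integral>\<^sup>+\<eta>. ennreal ((norm (G \<eta>))\<^sup>2) \<partial>frac_lebesgue_poisson \<alpha> \<mu>) = (\<Sum>n. ennreal (1 / Gamma (\<alpha> * real n + 1)) * ?I G n)"
    unfolding frac_lebesgue_poisson_def using G by (intro nn_integral_weighted) measurable
  also have "\<dots> = (\<Sum>n. ennreal (1 / fact n) * ?I (frac_iso \<alpha> G) n)" by (simp only: t)
  also have "\<dots> = (\<integral>\<^sup>+\<eta>. ennreal ((norm (frac_iso \<alpha> G \<eta>))\<^sup>2) \<partial>lebesgue_poisson \<mu>)"
    unfolding lebesgue_poisson_def using Fm by (intro nn_integral_weighted[symmetric]) measurable
  also have "\<dots> < \<infinity>" using L2_nrm_nn[OF F] by (metis ennreal_less_top infinity_ennreal_def)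
  finally show "(\<integral>\<^sup>+\<eta>. ennreal ((norm (G \<eta>))\<^sup>2) \<partial>frac_lebesgue_poisson \<alpha> \<mu>) < \<infinity>" .
qed

lemma AE_lebesgue_poissonI:
  assumes N: "{\<eta> \<in> finite_configs. \<not> Q \<eta>} \<in> sets config_borel" and ae: "\<And>n. AE x in Pn n. Q (x ` {..<n})"
  shows "AE \<eta> in lebesgue_poisson \<mu>. Q \<eta>"
proof -
  let ?N = "{\<eta> \<in> finite_configs. \<not> Q \<eta>}"
  have "(\<integral>\<^sup>+x. indicator ?N (x ` {..<n}) * indicator (tuples_distinct n) x \<partial>Pn n) = (\<integral>\<^sup>+x. 0 \<partial>Pn n)" for n
    using ae[of n] by (intro nn_integral_cong_AE) (auto elim!: eventually_mono)
  then have "(\<integral>\<^sup>+\<eta>. indicator ?N \<eta> \<partial>lebesgue_poisson \<mu>) = 0"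
    unfolding lebesgue_poisson_def using N by (subst nn_integral_weighted) simp_all
  then have "?N \<in> null_sets (lebesgue_poisson \<mu>)"
    using N by (intro null_setsI) (simp_all add: lebesgue_poisson_def)
  moreover have "space (lebesgue_poisson \<mu>) = finite_configs"
    using sets_eq_imp_space_eq[OF sets_weighted] by (simp add: lebesgue_poisson_def)
  ultimately show ?thesis by (intro AE_I'[of ?N]) auto
qed

lemma measurable_sqrt_ml: "(\<lambda>\<eta>. complex_of_real (sqrt (ml_deriv0 \<alpha> (card \<eta>)))) \<in> borel_measurable (config_borel :: 'm set measure)"
  using measurable_compose[OF measurable_card_Int[of UNIV], of "\<lambda>n. complex_of_real (sqrt (ml_deriv0 \<alpha> n))" borel] by simp

text \<open>Every \<open>\<eta> - {x}\<close> has \<open>card \<eta> - 1\<close> points, so the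
  denominators of the summands agree and cancel against the numerator of the root. For empty
  \<open>\<eta>\<close> both sides vanish, whatever the truncated subtraction returns.\<close>

lemma frac_formula:
  assumes \<alpha>: "\<alpha> > 0" and \<eta>: "finite \<eta>"
  shows "complex_of_real (sqrt (ml_deriv0 \<alpha> (card \<eta> - 1) / ml_deriv0 \<alpha> (card \<eta>))) * (\<Sum>x\<in>\<eta>. g x * frac_coherent \<alpha> f (\<eta> - {x}))
    = dcoherent f g \<eta> / complex_of_real (sqrt (ml_deriv0 \<alpha> (card \<eta>)))"
proof -
  let ?e = "complex_of_real (sqrt (ml_deriv0 \<alpha> (card \<eta> - 1)))"
  have e: "?e \<noteq> 0" using ml_deriv0_pos[OF \<alpha>, of "card \<eta> - 1"] by simp
  have "(\<Sum>x\<in>\<eta>. g x * frac_coherent \<alpha> f (\<eta> - {x})) = (\<Sum>x\<in>\<eta>. g x * coherent f (\<eta> - {x}) / ?e)"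
    using \<eta> by (intro sum.cong) (auto simp: frac_coherent_def)
  also have "\<dots> = dcoherent f g \<eta> / ?e" by (simp add: dcoherent_def sum_divide_distrib)
  finally show ?thesis using e by (simp add: real_sqrt_divide)
qed

text \<open>An explicit image \<open>h0\<close> puts the coherent state into the domain. Any
  \<open>h\<close> in the graph has the same Fock image as \<open>h0\<close> modulo null vectors,
  hence agrees with \<open>h0\<close> at almost all tuples of each sector.\<close>

theorem frac_second_quantization_coherent:
  assumes \<alpha>: "\<alpha> > 0" and A: "self_adjoint (L2 \<mu>) A" "positive_op (L2 \<mu>) A" and fg: "(f, g) \<in> A"
  shows "frac_coherent \<alpha> f \<in> Domain (H_frac \<alpha> \<mu> A)"
    and "(frac_coherent \<alpha> f, h) \<in> H_frac \<alpha> \<mu> A \<Longrightarrow> AE \<eta> in lebesgue_poisson \<mu>.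
      h \<eta> = complex_of_real (sqrt (ml_deriv0 \<alpha> (card \<eta> - 1) / ml_deriv0 \<alpha> (card \<eta>))) * (\<Sum>x\<in>\<eta>. g x * frac_coherent \<alpha> f (\<eta> - {x}))"
proof -
  have op: "is_operator (L2 \<mu>) A" using A by (simp add: self_adjoint_def)
  have V: "f \<in> vecs (L2 \<mu>)" "g \<in> vecs (L2 \<mu>)" using M.is_operatorD(1,2)[OF op fg] by auto
  let ?K = "coherent f" and ?D = "dcoherent f g"
  let ?E = "\<lambda>\<eta>. complex_of_real (sqrt (ml_deriv0 \<alpha> (card \<eta>)))"
  have E0: "?E \<eta> \<noteq> 0" for \<eta> :: "'m set" using ml_deriv0_pos[OF \<alpha>, of "card \<eta>"] by simp
  have Km: "?K \<in> borel_measurable config_borel" and Dm: "?D \<in> borel_measurable config_borel"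
    using coherent_measurable dcoherent_measurable borel_of_L2 V by auto
  note K = fock_iso_coherent[OF V(1)] and D = fock_iso_dcoherent[OF V]
  have KD: "(fock_iso ?K, fock_iso ?D) \<in> dExp_op \<mu> A"
    by (rule dExp_op_cong[OF A dExp_op_coherent[OF A fg] K D])
  have L: "?K \<in> vecs (L2 (lebesgue_poisson \<mu>))" "?D \<in> vecs (L2 (lebesgue_poisson \<mu>))"
    using L2_lebesgue_poisson_fock Km Dm K D by auto
  have HLP: "(?K, ?D) \<in> H_LP \<mu> A" using KD L by (simp add: H_LP_def conj_op_def)
  have IK: "frac_iso \<alpha> (frac_coherent \<alpha> f) = ?K" using E0 by (simp add: fun_eq_iff frac_iso_def frac_coherent_def)
  define h0 where "h0 = (\<lambda>\<eta>. ?D \<eta> / ?E \<eta>)"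
  have ID: "frac_iso \<alpha> h0 = ?D" using E0 by (simp add: fun_eq_iff frac_iso_def h0_def)
  have h0m: "h0 \<in> borel_measurable config_borel"
    unfolding h0_def by (intro borel_measurable_divide Dm measurable_sqrt_ml)
  have "frac_coherent \<alpha> f \<in> borel_measurable config_borel"
    unfolding frac_coherent_def[abs_def] by (intro borel_measurable_divide Km measurable_sqrt_ml)
  then have "frac_coherent \<alpha> f \<in> vecs (L2 (frac_lebesgue_poisson \<alpha> \<mu>))" "h0 \<in> vecs (L2 (frac_lebesgue_poisson \<alpha> \<mu>))"
    using L2_frac_lebesgue_poisson[OF \<alpha>] h0m L IK ID by auto
  then have "(frac_coherent \<alpha> f, h0) \<in> H_frac \<alpha> \<mu> A" using HLP IK ID by (simp add: H_frac_def conj_op_def)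
  then show "frac_coherent \<alpha> f \<in> Domain (H_frac \<alpha> \<mu> A)" by auto
  assume "(frac_coherent \<alpha> f, h) \<in> H_frac \<alpha> \<mu> A"
  then have h: "h \<in> vecs (L2 (frac_lebesgue_poisson \<alpha> \<mu>))" "(?K, frac_iso \<alpha> h) \<in> H_LP \<mu> A"
    by (auto simp: H_frac_def conj_op_def IK)
  have dh: "(fock_iso ?K, fock_iso (frac_iso \<alpha> h)) \<in> dExp_op \<mu> A" using h(2) by (simp add: H_LP_def conj_op_def)
  have hm: "h \<in> borel_measurable config_borel"
    using h(1) by (simp add: L2_vecs frac_lebesgue_poisson_def borel_measurable_weighted)
  have "fock_iso (frac_iso \<alpha> h) \<in> vecs (fock \<mu>)" using dh by (simp add: dExp_op_def F.generator_iff)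
  then have ae: "AE x in Pn n. sector (fock_iso (frac_iso \<alpha> h)) n x = sector (fock_iso ?D) n x" for n
    using dExp_op_unique[OF A dh KD] D by (intro fock_null_AE) auto
  have "AE \<eta> in lebesgue_poisson \<mu>. h \<eta> = h0 \<eta>"
  proof (rule AE_lebesgue_poissonI)
    have "{\<eta> \<in> space config_borel. h \<eta> = h0 \<eta>} \<in> sets config_borel" using hm h0m by (rule measurable_equality_set)
    then have "space config_borel - {\<eta> \<in> space config_borel. h \<eta> = h0 \<eta>} \<in> sets config_borel" by (rule sets.compl_sets)
    moreover have "space config_borel - {\<eta> \<in> space config_borel. h \<eta> = h0 \<eta>} = {\<eta> \<in> finite_configs. h \<eta> \<noteq> h0 \<eta>}" by auto
    ultimately show "{\<eta> \<in> finite_configs. h \<eta> \<noteq> h0 \<eta>} \<in> sets config_borel" by simp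
    fix n
    show "AE x in Pn n. h (x ` {..<n}) = h0 (x ` {..<n})"
      using ae[of n] AE_inj
    proof eventually_elim
      case (elim x)
      then have "frac_iso \<alpha> h (x ` {..<n}) = ?D (x ` {..<n})" by (simp add: sector_fock_iso)
      then show ?case using E0[of "x ` {..<n}"] by (simp add: frac_iso_def h0_def field_simps)
    qed
  qed
  moreover have "AE \<eta> in lebesgue_poisson \<mu>. finite \<eta>"
  proof -
    have "space (lebesgue_poisson \<mu>) = finite_configs"
      using sets_eq_imp_space_eq[OF sets_weighted] by (simp add: lebesgue_poisson_def)
    then show ?thesis using AE_space[of "lebesgue_poisson \<mu>"] by (simp add: finite_configs_def)
  qed
  ultimately show "AE \<eta> in lebesgue_poisson \<mu>.
      h \<eta> = complex_of_real (sqrt (ml_deriv0 \<alpha> (card \<eta> - 1) / ml_deriv0 \<alpha> (card \<eta>))) * (\<Sum>x\<in>\<eta>. g x * frac_coherent \<alpha> f (\<eta> - {x}))"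
    by eventually_elim (simp only: frac_formula[OF \<alpha>] h0_def)
qed

end

text \<open>Inside a chart every point has an open neighbourhood contained in the compact image of a
  closed coordinate ball, hence of finite measure. By the Lindelof property countably many open sets
  of finite measure cover the space.\<close>

lemma radon_measure_sigma_finite:
  fixes \<A> :: "('m::{t2_space, second_countable_topology}, 'n::finite) chart set"
    and \<mu> :: "'m measure"
  assumes atlas: "oriented_smooth_atlas \<A>" and radon: "radon_measure \<mu>"
  shows "sigma_finite_measure \<mu>"
proof -
  have s: "sets \<mu> = sets borel" and K: "\<And>K. compact K \<Longrightarrow> emeasure \<mu> K < \<infinity>"
    using radon by (auto simp: radon_measure_def)
  have loc: "\<exists>U. open U \<and> x \<in> U \<and> emeasure \<mu> U < \<infinity>" for x :: 'm
  proof -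
    obtain c where c: "c \<in> \<A>" "x \<in> fst c" "is_chart c"
      using atlas unfolding oriented_smooth_atlas_def by (metis UNIV_I UN_E)
    have o: "open (fst c)" "open (snd c ` fst c)" and hom: "homeomorphism (fst c) (snd c ` fst c) (snd c) (chart_inv c)"
      using c(3) by (auto simp: is_chart_def)
    obtain e where e: "e > 0" "cball (snd c x) e \<subseteq> snd c ` fst c"
      using o(2) c(2) by (meson image_eqI open_contains_cball)
    let ?K = "chart_inv c ` cball (snd c x) e"
    have "continuous_on (cball (snd c x) e) (chart_inv c)"
      using hom e(2) by (auto simp: homeomorphism_def intro: continuous_on_subset)
    then have comp: "compact ?K" by (rule compact_continuous_image) simp
    define U where "U = fst c \<inter> snd c -` ball (snd c x) e"
    have "open U" unfolding U_def
      using hom o(1) by (intro continuous_open_preimage) (auto simp: homeomorphism_def)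
    moreover have "x \<in> U" using c(2) e(1) by (simp add: U_def)
    moreover have "U \<subseteq> ?K"
    proof
      fix y assume y: "y \<in> U"
      then have "chart_inv c (snd c y) = y" using hom by (auto simp: U_def homeomorphism_def)
      moreover have "snd c y \<in> cball (snd c x) e" using y by (simp add: U_def)
      ultimately show "y \<in> ?K" by (metis imageI)
    qed
    moreover have "?K \<in> sets \<mu>" using compact_imp_closed[OF comp] by (simp add: s)
    ultimately show ?thesis using K[OF comp] emeasure_mono[of U ?K \<mu>] by (meson le_less_trans)
  qed
  define F where "F = {U. open U \<and> emeasure \<mu> U < \<infinity>}"
  have "\<And>S. S \<in> F \<Longrightarrow> open S" by (simp add: F_def)
  from Lindelof[OF this] obtain F' where F': "F' \<subseteq> F" "countable F'" "\<Union>F' = \<Union>F" .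
  have "\<Union>F = UNIV" using loc by (fastforce simp: F_def)
  show ?thesis
  proof (intro sigma_finite_measure.intro exI[of _ F'] conjI ballI)
    show "F' \<subseteq> sets \<mu>" unfolding s using F'(1) by (auto simp: F_def)
    show "\<Union>F' = space \<mu>" using sets_eq_imp_space_eq[OF s] F'(3) \<open>\<Union>F = UNIV\<close> by simp
    fix U assume "U \<in> F'"
    then have "U \<in> F" using F'(1) by blast
    then show "emeasure \<mu> U \<noteq> \<infinity>" by (auto simp: F_def)
  qed (rule F'(2))
qed

text \<open>A subset of \<open>{x}\<close> is empty or everything, so none has measure strictly
  between \<open>0\<close> and that of \<open>{x}\<close>.\<close>

lemma nonatomic_singleton_null:
  fixes \<mu> :: "'m::t2_space measure"
  assumes s: "sets \<mu> = sets borel" and na: "nonatomic \<mu>"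
  shows "emeasure \<mu> {x} = 0"
proof (rule ccontr)
  assume "emeasure \<mu> {x} \<noteq> 0"
  then have "emeasure \<mu> {x} > 0" by (simp add: zero_less_iff_neq_zero)
  moreover have "{x} \<in> sets \<mu>" by (simp add: s)
  ultimately obtain C where C: "C \<subseteq> {x}" "0 < emeasure \<mu> C" "emeasure \<mu> C < emeasure \<mu> {x}"
    using na unfolding nonatomic_def by blast
  then show False by (auto simp: subset_singleton_iff)
qed

theorem proposition6:
  fixes \<A> :: "('m::{t2_space, second_countable_topology}, 'n::finite) chart set"
    and g :: "('m, 'n) chart \<Rightarrow> real ^ 'n \<Rightarrow> real ^ 'n ^ 'n"
    and \<mu> :: "'m measure"
    and \<alpha> :: real
    and A :: "'m operator"
  assumes "oriented_smooth_atlas \<A>"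
    and "riemannian_metric \<A> g"
    and "geodesically_complete \<A> g"
    and "connected (UNIV :: 'm set)"
    and "\<not> compact (UNIV :: 'm set)"
    and "radon_measure \<mu>"
    and "nonatomic \<mu>"
    and "\<And>S. open S \<Longrightarrow> S \<noteq> {} \<Longrightarrow> emeasure \<mu> S > 0"
    and "emeasure \<mu> UNIV = \<infinity>"
    and "0 < \<alpha>" and "\<alpha> < 1"
    and "self_adjoint (L2 \<mu>) A"
    and "positive_op (L2 \<mu>) A"
  shows "\<forall>f\<in>Domain A.
    frac_coherent \<alpha> f \<in> Domain (H_frac \<alpha> \<mu> A) \<and>
    (\<forall>Af h. (f, Af) \<in> A \<and> (frac_coherent \<alpha> f, h) \<in> H_frac \<alpha> \<mu> A \<longrightarrow>
      (AE \<eta> in lebesgue_poisson \<mu>.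
         h \<eta> = complex_of_real (sqrt (ml_deriv0 \<alpha> (card \<eta> - 1) / ml_deriv0 \<alpha> (card \<eta>))) *
           (\<Sum>x\<in>\<eta>. Af x * frac_coherent \<alpha> f (\<eta> - {x}))))"
proof -
  have s: "sets \<mu> = sets borel" using assms(6) by (simp add: radon_measure_def)
  interpret config_space \<mu>
    by (intro config_space.intro fock_space.intro config_space_axioms.intro
        radon_measure_sigma_finite[OF assms(1,6)] s nonatomic_singleton_null[OF s assms(7)])
  show ?thesis
    using frac_second_quantization_coherent[OF assms(10,12,13)] by blast
qed

end
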